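(* Consider the constraint $$e^{u_j}=\Gamma^{j-\frac12}\gamma_0^{-\frac12}\prod_{k=1}^{j-1}\gamma_k^{-1},$$ where $$\gamma_j=1-(-1)^j\pi^{(-1)}_{j,-j},\qquad \Gamma=\prod_{k=1}^{2n}\gamma_k^{\frac1{2n}}.$$ Under this constraint the Lax pair of the two dimensional hyperbolic $C_n^{(1)}$ Toda equation, taken for the column solutions $\Phi_\sigma$ with $\lambda=\lambda_\sigma$ ($\sigma=1,\dots,r$), is changed to the system of ODEs $$\phi_{j\sigma,x}=\lambda_\sigma\phi_{j+1,\sigma}+(-1)^{j-1}\pi^{(0)}_{j,1-j}\phi_{j\sigma},\qquad \phi_{j\sigma,t}=\lambda_\sigma^{-1}\Big(\prod_{k=1}^{2n}\gamma_k^{\frac1{2n}}\Big)\gamma_{j-1}^{-1}\phi_{j-1,\sigma},$$ or equivalently $$\Phi_{\sigma,x}=(\lambda L(\lambda))_+|_{\lambda=\lambda_\sigma}\Phi_\sigma,\qquad \Phi_{\sigma,t}=\lambda_\sigma^{-1}\Big(\frac1{2n}\mathrm{tr}(L(0)^{2n})\Big)^{\frac1{2n}-1}L(0)^{2n-1}\Phi_\sigma .$$ These ODEs (the $x$-system and the $t$-system) are Liouville integrable Hamiltonian systems with the Hamiltonian functions $$H^x=\frac12\mathrm{tr}\,\mathrm{Res}\big(\lambda L^2(\lambda)\big)=\sum_{j=1}^{2n}(-1)^j\pi^{(1)}_{j,2n+2-j}+\frac12\sum_{j=1}^{2n}\big(\pi^{(0)}_{j,2n+1-j}\big)^2,$$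 $$H^t=-n\Big(\frac1{2n}\mathrm{tr}(L(0)^{2n})\Big)^{\frac1{2n}}=-n\prod_{j=1}^{2n}\Big(1-(-1)^j\pi^{(-1)}_{j,-j}\Big)^{\frac1{2n}}.$$
   Context: All matrix and component indices are taken modulo $2n$ (e.g. $\phi_{2n+j,\sigma}=\phi_{j\sigma}$, $\gamma_0=\gamma_{2n}$, $\delta_{j,k}$ is understood mod $2n$). $\lambda_1,\dots,\lambda_r$ are non-zero real numbers with $\lambda_1^2,\dots,\lambda_r^2$ distinct; $\Phi_\sigma=(\phi_{1\sigma},\dots,\phi_{2n,\sigma})^T$ are real column vectors, and $\pi^{(l)}_{j,k}=\sum_{\sigma=1}^r\lambda_\sigma^l\phi_{j\sigma}\phi_{k\sigma}$. The two dimensional hyperbolic $C_n^{(1)}$ Toda equation is $u_{1,xt}=e^{2u_1}-e^{u_2-u_1}$, $u_{j,xt}=e^{u_j-u_{j-1}}-e^{u_{j+1}-u_j}$ ($2\le j\le n-1$), $u_{n,xt}=e^{u_n-u_{n-1}}-e^{-2u_n}$. Its Lax pair is $\Phi_x=(\lambda K+P)\Phi$, $\Phi_t=\lambda^{-1}Q\Phi$, where $K=(\delta_{j+1,k})_{1\le j,k\le2n}$; $P=(p_j\delta_{jk})$ with $p_j=u_{j,x}$ for $1\le j\le n$ and $p_j=-u_{2n+1-j,x}$ for $n+1\le j\le2n$; $Q=(q_k\delta_{j,k+1})$ with $q_k=e^{u_{k+1}-u_k}$ for $1\le k\le n-1$, $q_n=e^{-2u_n}$, $q_k=e^{u_{2n+1-k}-u_{2n-k}}$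 for $n+1\le k\le2n-1$, $q_{2n}=e^{2u_1}$. In components: $\phi_{j,x}=\lambda\phi_{j+1}+p_j\phi_j$, $\phi_{j,t}=\lambda^{-1}q_{j-1}\phi_{j-1}$. Let $\rho=\exp(\pi\sqrt{-1}/2n)$, $\omega=\rho^2$, $\Omega=(\rho^{-2j+1}\delta_{jk})_{1\le j,k\le2n}$, $W=((-1)^j\delta_{j,2n+1-k})_{1\le j,k\le2n}$. The Lax matrix is $$L(\lambda)=K+\frac1{2n}\sum_{\alpha=1}^{2n}\sum_{\sigma=1}^r\frac{\Omega^\alpha\Phi_\sigma\Phi_\sigma^T(\Omega^\alpha)^TW}{\lambda-\omega^\alpha\lambda_\sigma}.$$ For a series $N(\lambda)=\sum_{j\le m}N_j\lambda^j$ (expansion at $\lambda=\infty$), $N(\lambda)_+=\sum_{0\le j\le m}N_j\lambda^j$ and $\mathrm{Res}\,N(\lambda)=N_{-1}$. Hamiltonian structure. On $\mathbf R^{2n\times r}$ with coordinates $\phi_{j\sigma}$ the Poisson bracket is $\{f,g\}=\sum_{j,k=1}^{2n}\sum_{\sigma=1}^r(W^{-1})_{jk}\frac{\partial f}{\partial\phi_{j\sigma}}\frac{\partial g}{\partial\phi_{k\sigma}}$; the Hamiltonian system of $H$ with time $s$ ($s=x$ or $t$) is $\phi_{j\sigma,s}=\sum_k(W^{-1})_{jk}\partial H/\partial\phi_{k\sigma}$. It is Liouville integrable if there exist $nr$ functions Poisson-commuting with $H$ that are pairwise in involution and functionally independent on a dense open subset of the phase space.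
   Formalization: With the given Poisson bracket, the Hamiltonian system of H^x is twice the x-system, so the x-system is proved to be generated by H^x/2 (H^x as given is still proved Liouville integrable); the constraint, t-system and H^t are taken where all γ_k > 0, so that the real fractional powers exist. *)

theory Defs
  imports "HOL-Complex_Analysis.Complex_Analysis" "HOL-Library.Numeral_Type"
begin

text \<open>
  Matrix and component indices live in the type \<open>'n bit0\<close>, i.e. the ring of integers modulo
  \<open>2n\<close> where \<open>n = CARD('n)\<close>, so index arithmetic is automatically modulo \<open>2n\<close> and an index
  such as \<open>2n+1-j\<close> reads \<open>1 - j\<close>. The number of columns is \<open>r = CARD('r)\<close>.
\<close>

type_synonym ('n, 'r) phase = "real ^ 'r ^ ('n bit0)"
type_synonym 'n cmat = "complex ^ ('n bit0) ^ ('n bit0)"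

text \<open>The representative of an index in \<open>{1..2n}\<close> (so the index \<open>0\<close> is represented by \<open>2n\<close>).\<close>

definition idx :: "'n::finite bit0 \<Rightarrow> nat" where
  "idx j = nat (Rep_bit0 (j - 1)) + 1"

lemma idx_bounds: "1 \<le> idx (j :: 'n::finite bit0)" "idx j \<le> 2 * CARD('n)"
  using Rep_bit0[of "j - 1"] by (auto simp: idx_def)

lemma of_nat_idx: "of_nat (idx (j :: 'n::finite bit0)) = j"
proof -
  have r: "0 \<le> Rep_bit0 (j - 1)" "Rep_bit0 (j - 1) < 2 * int CARD('n)"
    using Rep_bit0[of "j - 1"] by auto
  have "of_nat (nat (Rep_bit0 (j - 1))) = (of_int (Rep_bit0 (j - 1)) :: 'n bit0)"
    using r by simp
  also have "\<dots> = Abs_bit0 (Rep_bit0 (j - 1) mod int CARD('n bit0))"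
    by (rule bit0.of_int_eq)
  also have "\<dots> = j - 1"
    using r by (simp add: Rep_bit0_inverse)
  finally show ?thesis by (simp add: idx_def)
qed

text \<open>Well defined modulo \<open>2n\<close> because \<open>2n\<close> is even.\<close>

definition alt :: "'n::finite bit0 \<Rightarrow> 'a::ring_1" where
  "alt j = (-1) ^ idx j"


section \<open>Matrices\<close>

definition mscale :: "'a::semiring_1 \<Rightarrow> 'a^'m^'k \<Rightarrow> 'a^'m^'k" where
  "mscale c = map_matrix ((*) c)"

primrec mpow :: "'a::semiring_1^'m^'m \<Rightarrow> nat \<Rightarrow> 'a^'m^'m" where
  "mpow A 0 = mat 1"
| "mpow A (Suc k) = A ** mpow A k"

definition outer :: "'a::semiring_1^'m \<Rightarrow> 'a^'m^'m" where
  "outer v = (\<chi> j k. v $ j * v $ k)"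

definition cvec :: "real^'m \<Rightarrow> complex^'m" where
  "cvec v = (\<chi> j. complex_of_real (v $ j))"

definition Kmat :: "'a::ring_1 ^ ('n::finite bit0) ^ ('n bit0)" where
  "Kmat = (\<chi> j k. if k = j + 1 then 1 else 0)"

definition Wmat :: "'a::ring_1 ^ ('n::finite bit0) ^ ('n bit0)" where
  "Wmat = (\<chi> j k. if k = 1 - j then alt j else 0)"


section \<open>The Lax pair of the hyperbolic \<open>C\<^sub>n\<^sup>(\<^sup>1\<^sup>)\<close> Toda equation\<close>

text \<open>Here \<open>u j x t\<close> is used only for \<open>1 \<le> j \<le> n\<close>.\<close>

definition Pmat :: "(nat \<Rightarrow> real \<Rightarrow> real \<Rightarrow> real) \<Rightarrow> real \<Rightarrow> real
    \<Rightarrow> real ^ ('n::finite bit0) ^ ('n bit0)" where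
  "Pmat u x t = (\<chi> j k. if j = k then
       (if idx j \<le> CARD('n) then deriv (\<lambda>s. u (idx j) s t) x
        else - deriv (\<lambda>s. u (2 * CARD('n) + 1 - idx j) s t) x)
     else 0)"

definition qcoef :: "nat \<Rightarrow> (nat \<Rightarrow> real) \<Rightarrow> nat \<Rightarrow> real" where
  "qcoef n v k =
     (if k < n then exp (v (k + 1) - v k)
      else if k = n then exp (- 2 * v n)
      else if k < 2 * n then exp (v (2 * n + 1 - k) - v (2 * n - k))
      else exp (2 * v 1))"

definition Qmat :: "(nat \<Rightarrow> real \<Rightarrow> real \<Rightarrow> real) \<Rightarrow> real \<Rightarrow> real
    \<Rightarrow> real ^ ('n::finite bit0) ^ ('n bit0)" where
  "Qmat u x t = (\<chi> j k. if j = k + 1 then qcoef CARD('n) (\<lambda>i. u i x t) (idx k) else 0)"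

definition lax_x_on :: "(real \<times> real) set \<Rightarrow> ('r::finite \<Rightarrow> real) \<Rightarrow> (nat \<Rightarrow> real \<Rightarrow> real \<Rightarrow> real)
    \<Rightarrow> (real \<Rightarrow> real \<Rightarrow> ('n::finite, 'r) phase) \<Rightarrow> bool" where
  "lax_x_on D l u \<Phi> \<longleftrightarrow> (\<forall>(x, t) \<in> D. \<forall>\<sigma>.
     ((\<lambda>s. column \<sigma> (\<Phi> s t)) has_vector_derivative
        (mscale (l \<sigma>) Kmat + Pmat u x t) *v column \<sigma> (\<Phi> x t)) (at x))"

definition lax_t_on :: "(real \<times> real) set \<Rightarrow> ('r::finite \<Rightarrow> real) \<Rightarrow> (nat \<Rightarrow> real \<Rightarrow> real \<Rightarrow> real)
    \<Rightarrow> (real \<Rightarrow> real \<Rightarrow> ('n::finite, 'r) phase) \<Rightarrow> bool" where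
  "lax_t_on D l u \<Phi> \<longleftrightarrow> (\<forall>(x, t) \<in> D. \<forall>\<sigma>.
     ((\<lambda>s. column \<sigma> (\<Phi> x s)) has_vector_derivative
        mscale (inverse (l \<sigma>)) (Qmat u x t) *v column \<sigma> (\<Phi> x t)) (at t))"


section \<open>The constraint and the resulting systems of ODEs\<close>

text \<open>\<open>mom l \<Phi> m j k\<close> is \<open>\<pi>\<close> with superscript \<open>(m)\<close> and subscript \<open>j,k\<close>.\<close>

definition mom :: "('r::finite \<Rightarrow> real) \<Rightarrow> ('n::finite, 'r) phase \<Rightarrow> int
    \<Rightarrow> 'n bit0 \<Rightarrow> 'n bit0 \<Rightarrow> real" where
  "mom l \<Phi> m j k = (\<Sum>\<sigma>\<in>UNIV. l \<sigma> powi m * \<Phi> $ j $ \<sigma> * \<Phi> $ k $ \<sigma>)"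

definition gam :: "('r::finite \<Rightarrow> real) \<Rightarrow> ('n::finite, 'r) phase \<Rightarrow> 'n bit0 \<Rightarrow> real" where
  "gam l \<Phi> j = 1 - alt j * mom l \<Phi> (-1) j (- j)"

text \<open>The region of the phase space on which the real fractional powers of all the
  \<open>\<gamma>\<^sub>k\<close> make sense.\<close>

definition gam_region :: "('r::finite \<Rightarrow> real) \<Rightarrow> ('n::finite, 'r) phase set" where
  "gam_region l = {\<Phi>. \<forall>k. gam l \<Phi> k > 0}"

definition Gam :: "('r::finite \<Rightarrow> real) \<Rightarrow> ('n::finite, 'r) phase \<Rightarrow> real" where
  "Gam l \<Phi> = (\<Prod>k\<in>UNIV. gam l \<Phi> k powr (1 / (2 * real CARD('n))))"

definition constraint_on :: "(real \<times> real) set \<Rightarrow> ('r::finite \<Rightarrow> real)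
    \<Rightarrow> (nat \<Rightarrow> real \<Rightarrow> real \<Rightarrow> real) \<Rightarrow> (real \<Rightarrow> real \<Rightarrow> ('n::finite, 'r) phase) \<Rightarrow> bool" where
  "constraint_on D l u \<Phi> \<longleftrightarrow> (\<forall>(x, t) \<in> D. \<Phi> x t \<in> gam_region l \<and>
     (\<forall>j\<in>{1..CARD('n)}. exp (u j x t) =
        Gam l (\<Phi> x t) powr (real j - 1 / 2) * gam l (\<Phi> x t) 0 powr (- 1 / 2) *
        (\<Prod>k = 1..j - 1. inverse (gam l (\<Phi> x t) (of_nat k)))))"

definition x_field :: "('r::finite \<Rightarrow> real) \<Rightarrow> ('n::finite, 'r) phase \<Rightarrow> ('n, 'r) phase" where
  "x_field l \<Phi> = (\<chi> j \<sigma>. l \<sigma> * \<Phi> $ (j + 1) $ \<sigma> +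
     alt (j - 1) * mom l \<Phi> 0 j (1 - j) * \<Phi> $ j $ \<sigma>)"

definition t_field :: "('r::finite \<Rightarrow> real) \<Rightarrow> ('n::finite, 'r) phase \<Rightarrow> ('n, 'r) phase" where
  "t_field l \<Phi> = (\<chi> j \<sigma>. inverse (l \<sigma>) * (\<Prod>k\<in>UNIV. gam l \<Phi> k powr (1 / (2 * real CARD('n)))) *
     inverse (gam l \<Phi> (j - 1)) * \<Phi> $ (j - 1) $ \<sigma>)"

definition ode_x_on :: "(real \<times> real) set \<Rightarrow> ('r::finite \<Rightarrow> real)
    \<Rightarrow> (real \<Rightarrow> real \<Rightarrow> ('n::finite, 'r) phase) \<Rightarrow> bool" where
  "ode_x_on D l \<Phi> \<longleftrightarrow> (\<forall>(x, t) \<in> D.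
     ((\<lambda>s. \<Phi> s t) has_vector_derivative x_field l (\<Phi> x t)) (at x))"

definition ode_t_on :: "(real \<times> real) set \<Rightarrow> ('r::finite \<Rightarrow> real)
    \<Rightarrow> (real \<Rightarrow> real \<Rightarrow> ('n::finite, 'r) phase) \<Rightarrow> bool" where
  "ode_t_on D l \<Phi> \<longleftrightarrow> (\<forall>(x, t) \<in> D.
     ((\<lambda>s. \<Phi> x s) has_vector_derivative t_field l (\<Phi> x t)) (at t))"


section \<open>The Lax matrix and the Lax form of the ODEs\<close>

definition rho :: "nat \<Rightarrow> complex" where
  "rho n = exp (of_real pi * \<i> / of_nat (2 * n))"

definition Omega :: "'n::finite cmat" where
  "Omega = (\<chi> j k. if j = k then rho CARD('n) powi (1 - 2 * int (idx j)) else 0)"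

definition Lax :: "('r::finite \<Rightarrow> real) \<Rightarrow> ('n::finite, 'r) phase \<Rightarrow> complex \<Rightarrow> 'n cmat" where
  "Lax l \<Phi> z = Kmat + mscale (1 / of_nat (2 * CARD('n)))
     (\<Sum>\<alpha> = 1..2 * CARD('n). \<Sum>\<sigma>\<in>UNIV.
        mscale (1 / (z - (rho CARD('n))\<^sup>2 ^ \<alpha> * of_real (l \<sigma>)))
          (mpow Omega \<alpha> ** outer (cvec (column \<sigma> \<Phi>)) ** transpose (mpow Omega \<alpha>) ** Wmat))"

text \<open>The coefficient of \<open>z\<^sup>m\<close> in the expansion of \<open>N\<close> at infinity: it is the coefficient of
  \<open>w\<^sup>-\<^sup>m\<close> in the Laurent expansion of \<open>N (1/w)\<close> at \<open>w = 0\<close>.\<close>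

definition coeff_infinity :: "(complex \<Rightarrow> complex^'k^'m) \<Rightarrow> int \<Rightarrow> complex^'k^'m" where
  "coeff_infinity N m = (\<chi> j k. fls_nth (laurent_expansion (\<lambda>w. N (inverse w) $ j $ k) 0) (- m))"

text \<open>A function meromorphic at infinity has only finitely many non-zero coefficients of
  non-negative index there, so the following sum is finite.\<close>

definition plus_part :: "(complex \<Rightarrow> complex^'k^'m) \<Rightarrow> complex \<Rightarrow> complex^'k^'m" where
  "plus_part N z = (\<Sum>m | 0 \<le> m \<and> coeff_infinity N m \<noteq> 0. mscale (z powi m) (coeff_infinity N m))"

definition Res_infinity :: "(complex \<Rightarrow> complex^'k^'m) \<Rightarrow> complex^'k^'m" where
  "Res_infinity N = coeff_infinity N (-1)"

definition lax_form_x :: "('r::finite \<Rightarrow> real) \<Rightarrow> ('n::finite, 'r) phase \<Rightarrow> 'r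
    \<Rightarrow> complex ^ ('n bit0)" where
  "lax_form_x l \<Phi> \<sigma> =
     plus_part (\<lambda>z. mscale z (Lax l \<Phi> z)) (of_real (l \<sigma>)) *v cvec (column \<sigma> \<Phi>)"

definition lax_form_t :: "('r::finite \<Rightarrow> real) \<Rightarrow> ('n::finite, 'r) phase \<Rightarrow> 'r
    \<Rightarrow> complex ^ ('n bit0)" where
  "lax_form_t l \<Phi> \<sigma> =
     mscale (inverse (of_real (l \<sigma>)) *
         (1 / of_nat (2 * CARD('n)) * trace (mpow (Lax l \<Phi> 0) (2 * CARD('n))))
           powr (1 / of_nat (2 * CARD('n)) - 1))
       (mpow (Lax l \<Phi> 0) (2 * CARD('n) - 1)) *v cvec (column \<sigma> \<Phi>)"

definition lax_ode_x_on :: "(real \<times> real) set \<Rightarrow> ('r::finite \<Rightarrow> real)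
    \<Rightarrow> (real \<Rightarrow> real \<Rightarrow> ('n::finite, 'r) phase) \<Rightarrow> bool" where
  "lax_ode_x_on D l \<Phi> \<longleftrightarrow> (\<forall>(x, t) \<in> D. \<forall>\<sigma>.
     ((\<lambda>s. cvec (column \<sigma> (\<Phi> s t))) has_vector_derivative lax_form_x l (\<Phi> x t) \<sigma>) (at x))"

definition lax_ode_t_on :: "(real \<times> real) set \<Rightarrow> ('r::finite \<Rightarrow> real)
    \<Rightarrow> (real \<Rightarrow> real \<Rightarrow> ('n::finite, 'r) phase) \<Rightarrow> bool" where
  "lax_ode_t_on D l \<Phi> \<longleftrightarrow> (\<forall>(x, t) \<in> D. \<forall>\<sigma>.
     ((\<lambda>s. cvec (column \<sigma> (\<Phi> x s))) has_vector_derivative lax_form_t l (\<Phi> x t) \<sigma>) (at t))"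


section \<open>Hamiltonian systems and Liouville integrability\<close>

text \<open>Iterated directional derivatives; a function is smooth on an open set iff all of them
  exist and are (Frechet) differentiable there.\<close>

primrec dir_derivs :: "'a::real_normed_vector list \<Rightarrow> ('a \<Rightarrow> real) \<Rightarrow> 'a \<Rightarrow> real" where
  "dir_derivs [] f = f"
| "dir_derivs (v # vs) f = dir_derivs vs (\<lambda>x. frechet_derivative f (at x) v)"

definition smooth_on :: "'a::real_normed_vector set \<Rightarrow> ('a \<Rightarrow> real) \<Rightarrow> bool" where
  "smooth_on M f \<longleftrightarrow> open M \<and> (\<forall>vs. \<forall>x\<in>M. dir_derivs vs f differentiable (at x))"

text \<open>\<open>pdiff f j \<sigma> \<Phi>\<close> is the partial derivative with respect to the entry of \<open>\<Phi>\<close> in row \<open>j\<close> and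
  column \<open>\<sigma>\<close>.\<close>

definition pdiff :: "(('n::finite, 'r::finite) phase \<Rightarrow> real) \<Rightarrow> 'n bit0 \<Rightarrow> 'r
    \<Rightarrow> ('n, 'r) phase \<Rightarrow> real" where
  "pdiff f j \<sigma> \<Phi> = frechet_derivative f (at \<Phi>) (axis j (axis \<sigma> 1))"

definition poisson :: "(('n::finite, 'r::finite) phase \<Rightarrow> real) \<Rightarrow> (('n, 'r) phase \<Rightarrow> real)
    \<Rightarrow> ('n, 'r) phase \<Rightarrow> real" where
  "poisson f g \<Phi> = (\<Sum>j\<in>UNIV. \<Sum>k\<in>UNIV. \<Sum>\<sigma>\<in>UNIV.
     matrix_inv Wmat $ j $ k * pdiff f j \<sigma> \<Phi> * pdiff g k \<sigma> \<Phi>)"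

definition ham_field :: "(('n::finite, 'r::finite) phase \<Rightarrow> real) \<Rightarrow> ('n, 'r) phase
    \<Rightarrow> ('n, 'r) phase" where
  "ham_field H \<Phi> = (\<chi> j \<sigma>. \<Sum>k\<in>UNIV. matrix_inv Wmat $ j $ k * pdiff H k \<sigma> \<Phi>)"

text \<open>The autonomous system \<open>\<Phi>\<^sub>s = X \<Phi>\<close> on \<open>M\<close> is the Hamiltonian system of \<open>H\<close>.\<close>

definition hamiltonian_system :: "('n::finite, 'r::finite) phase set
    \<Rightarrow> (('n, 'r) phase \<Rightarrow> ('n, 'r) phase) \<Rightarrow> (('n, 'r) phase \<Rightarrow> real) \<Rightarrow> bool" where
  "hamiltonian_system M X H \<longleftrightarrow> smooth_on M H \<and> (\<forall>\<Phi>\<in>M. X \<Phi> = ham_field H \<Phi>)"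

definition functionally_independent_at :: "nat \<Rightarrow> (nat \<Rightarrow> 'a::real_normed_vector \<Rightarrow> real)
    \<Rightarrow> 'a \<Rightarrow> bool" where
  "functionally_independent_at N F x \<longleftrightarrow>
     (\<forall>c :: nat \<Rightarrow> real. (\<forall>v. (\<Sum>i<N. c i * frechet_derivative (F i) (at x) v) = 0)
        \<longrightarrow> (\<forall>i<N. c i = 0))"

definition liouville_integrable :: "('n::finite, 'r::finite) phase set
    \<Rightarrow> (('n, 'r) phase \<Rightarrow> real) \<Rightarrow> bool" where
  "liouville_integrable M H \<longleftrightarrow> smooth_on M H \<and>
     (\<exists>F :: nat \<Rightarrow> ('n, 'r) phase \<Rightarrow> real.
        (\<forall>i < CARD('n) * CARD('r). smooth_on M (F i)) \<and>
        (\<forall>i < CARD('n) * CARD('r). \<forall>\<Phi>\<in>M. poisson (F i) H \<Phi> = 0) \<and>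
        (\<forall>i < CARD('n) * CARD('r). \<forall>k < CARD('n) * CARD('r). \<forall>\<Phi>\<in>M. poisson (F i) (F k) \<Phi> = 0) \<and>
        (\<exists>U. open U \<and> U \<subseteq> M \<and> M \<subseteq> closure U \<and>
           (\<forall>\<Phi>\<in>U. functionally_independent_at (CARD('n) * CARD('r)) F \<Phi>)))"

text \<open>Each monomial of \<open>Hx\<close> is met twice when differentiating, so for the bracket above
  \<open>ham_field (Hx l) = 2 *\<^sub>R x_field l\<close>: the Hamiltonian function of the x-system is \<open>Hx l / 2\<close>. For
  \<open>Ht\<close> there is no such factor.\<close>

definition Hx :: "('r::finite \<Rightarrow> real) \<Rightarrow> ('n::finite, 'r) phase \<Rightarrow> real" where
  "Hx l \<Phi> = (\<Sum>j\<in>UNIV. alt j * mom l \<Phi> 1 j (2 - j)) + 1 / 2 * (\<Sum>j\<in>UNIV. (mom l \<Phi> 0 j (1 - j))\<^sup>2)"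

definition Ht :: "('r::finite \<Rightarrow> real) \<Rightarrow> ('n::finite, 'r) phase \<Rightarrow> real" where
  "Ht l \<Phi> = - real CARD('n) *
     (\<Prod>j\<in>UNIV. (1 - alt j * mom l \<Phi> (-1) j (- j)) powr (1 / (2 * real CARD('n))))"

end

theory Submission
  imports Defs
begin

text \<open>
  After averaging over the powers of \<open>\<Omega>\<close> the Lax matrix has real entries for real \<open>z\<close>,
  \<open>L(z)\<^sub>j\<^sub>k = \<delta>\<^sub>k\<^sub>,\<^sub>j\<^sub>+\<^sub>1 + \<Sum>\<^sub>\<sigma> c\<^sub>j\<^sub>-\<^sub>k(z, \<lambda>\<^sub>\<sigma>) \<phi>\<^sub>j\<^sub>\<sigma> \<phi>\<^sub>1\<^sub>-\<^sub>k\<^sub>,\<^sub>\<sigma> (-1)\<^sup>1\<^sup>-\<^sup>k\<close> with scalar coefficients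
  \<open>c\<^sub>p(z, w) = w\<^sup>p z\<^sup>2\<^sup>n\<^sup>-\<^sup>1\<^sup>-\<^sup>p / (z\<^sup>2\<^sup>n - w\<^sup>2\<^sup>n)\<close>, \<open>0 \<le> p < 2n\<close>, which satisfy a twisted partial fraction
  identity. Because of it, the Hamiltonian flow of \<open>tr L(z)\<^sup>2\<^sup>k\<close> moves \<open>L(w)\<close> by a commutator, so all
  these traces are in involution; the flow of \<open>H\<^sup>x\<close> also acts by a commutator, and \<open>H\<^sup>t\<close> is a function
  of \<open>tr L(0)\<^sup>2\<^sup>n\<close>. As integrals we take \<open>tr L(z)\<^sup>2\<^sup>k\<close>, \<open>1 \<le> k \<le> n\<close>, at \<open>r\<close> values of \<open>z\<close> for each \<open>k\<close>,
  all \<open>nr\<close> values being distinct. Their quadratic parts at \<open>\<Phi> = 0\<close> yield a Jacobian minor that is block diagonal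
  with Cauchy blocks, hence non-zero somewhere near \<open>0\<close>; being polynomial, it is non-zero on a dense open set.

  For the constraint, taking logarithms and differentiating gives \<open>p\<^sub>j\<^sub>+\<^sub>1 - p\<^sub>j = \<Gamma>\<^sub>x/\<Gamma> - \<gamma>\<^sub>j\<^sub>,\<^sub>x/\<gamma>\<^sub>j\<close>, and summing the equations for
  \<open>\<gamma>\<^sub>j\<^sub>,\<^sub>x\<close> over the cycle of indices forces \<open>\<Gamma>\<^sub>x = 0\<close>.
\<close>

text \<open>L(z) lies in the symplectic Lie algebra of W, so traces of its odd powers vanish; n even
  exponents times r spectral points give exactly nr integrals. The spectral points differ even
  between different exponents, because the partial fraction identity has the denominator z^(2n) -
  w^(2n). L is quadratic in \<Phi> apart from K, so all differentials of the integrals vanish at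
  \<Phi> = 0. The Jacobian is therefore followed along a ray t * \<Phi>0, divided by t, and
  evaluated at t = 0. The integrals depend neither on the Hamiltonian nor on the region, so one
  criterion, \<open>liouville_integrableI\<close>, serves \<open>Hx\<close> and \<open>Ht\<close>.
  The real matrix \<open>lax\<close> carries the Poisson geometry. The complex \<open>Lax\<close> is
  evaluated from its own entries at zero and at infinity, the two places that the Lax form of the
  ODEs and the formulas for the Hamiltonians refer to. In the constraint u_i is given for i \<le> n
  only. The symmetry \<gamma>_(-k) = \<gamma>_k continues it to 2n indices, and the case
  distinctions in P and Q then become relations on one cycle.\<close>

no_notation fps_nth (infixl "$" 75)

section \<open>Index arithmetic modulo \<open>2n\<close>\<close>

lemma of_nat_bit0_eq_iff:
  "(of_nat a :: 'n::finite bit0) = of_nat b \<longleftrightarrow> a mod (2 * CARD('n)) = b mod (2 * CARD('n))"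
proof -
  have "(of_nat a :: 'n bit0) = of_nat b \<longleftrightarrow> int a mod (2 * int CARD('n)) = int b mod (2 * int CARD('n))"
    using bit0.of_nat_eq[where 'a = 'n, of a] bit0.of_nat_eq[where 'a = 'n, of b]
      bit0.Rep_Abs_mod[where 'a = 'n, of "int a"] bit0.Rep_Abs_mod[where 'a = 'n, of "int b"]
    by (metis (mono_tags, lifting) card_bit0 of_nat_mult of_nat_numeral)
  also have "\<dots> \<longleftrightarrow> a mod (2 * CARD('n)) = b mod (2 * CARD('n))"
    by (metis of_nat_eq_iff of_nat_mult of_nat_numeral zmod_int)
  finally show ?thesis .
qed

lemma of_nat_bit0_card [simp]: "(of_nat (2 * CARD('n)) :: 'n::finite bit0) = 0"
  using of_nat_bit0_eq_iff[where 'n = 'n, of "2 * CARD('n)" 0] by simp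

lemma two_card_bit0 [simp]: "2 * (of_nat CARD('n) :: 'n::finite bit0) = 0"
  using of_nat_bit0_card[where 'n = 'n] by (simp only: of_nat_mult of_nat_numeral)

lemma even_mod_double: "even ((a::nat) mod (2 * n)) \<longleftrightarrow> even a"
  by (simp add: dvd_mod_iff)

lemma alt_of_nat: "alt (of_nat m :: 'n::finite bit0) = (-1) ^ m"
proof -
  have "(of_nat (idx (of_nat m :: 'n bit0)) :: 'n bit0) = of_nat m"
    by (rule of_nat_idx)
  hence "idx (of_nat m :: 'n bit0) mod (2 * CARD('n)) = m mod (2 * CARD('n))"
    by (simp only: of_nat_bit0_eq_iff)
  hence "even (idx (of_nat m :: 'n bit0)) \<longleftrightarrow> even m"
    by (metis even_mod_double)
  thus ?thesis by (simp add: alt_def minus_one_power_iff)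
qed

lemma alt_add: "alt (j + k :: 'n::finite bit0) = alt j * alt k"
proof -
  have "j + k = of_nat (idx j + idx k)" by (simp add: of_nat_idx)
  hence "alt (j + k) = (-1) ^ (idx j + idx k)" by (simp only: alt_of_nat)
  thus ?thesis by (simp add: alt_def power_add)
qed

lemma alt_square: "alt (j :: 'n::finite bit0) * alt j = 1"
  by (simp add: alt_def minus_one_power_iff)

lemma alt_0 [simp]: "alt (0 :: 'n::finite bit0) = 1"
  using alt_of_nat[where 'n = 'n, of 0] by simp

lemma alt_1 [simp]: "alt (1 :: 'n::finite bit0) = -1"
  using alt_of_nat[where 'n = 'n, of 1] by simp

lemma alt_minus [simp]: "(alt (- j :: 'n::finite bit0) :: 'a::ring_1) = alt j"
proof -
  have "alt j * alt (- j) = (1 :: 'a)"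
    using alt_add[of j "- j", where 'a = 'a] by simp
  hence "alt j * alt j * alt (- j) = (alt j * 1 :: 'a)"
    by (metis mult.assoc)
  thus ?thesis by (simp add: alt_square)
qed

lemma alt_diff: "alt (j - k :: 'n::finite bit0) = alt j * alt k"
  using alt_add[of j "- k"] by simp

lemma alt_one_minus: "alt (1 - j :: 'n::finite bit0) = - alt j"
  by (simp add: alt_diff)

lemma alt_two_minus: "(alt (2 - j :: 'n::finite bit0) :: 'a::ring_1) = alt j"
  using alt_of_nat[where 'n = 'n and 'a = 'a, of 2] by (simp add: alt_diff)

lemma of_real_alt: "of_real (alt j) = alt j"
  by (simp add: alt_def)

text \<open>Residues run through {0..2n-1} here and not through {1..2n} as for \<open>idx\<close>:
  they serve as exponents in \<open>pole\<close>.\<close>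

definition rep :: "'n::finite bit0 \<Rightarrow> nat" where
  "rep j = nat (Rep_bit0 j)"

lemma rep_less: "rep (j :: 'n::finite bit0) < 2 * CARD('n)"
  using bit0.Rep_less_n[of j] Rep_bit0[of j] by (simp add: rep_def nat_less_iff)

lemma of_nat_rep [simp]: "of_nat (rep j) = (j :: 'n::finite bit0)"
proof -
  have "of_nat (rep j) = (Abs_bit0 (int (rep j) mod int CARD('n bit0)) :: 'n bit0)"
    using bit0.of_nat_eq[where 'a = 'n, of "rep j"] by simp
  also have "\<dots> = j"
    using Rep_bit0[of j] by (simp add: rep_def Rep_bit0_inverse)
  finally show ?thesis .
qed

lemma rep_of_nat: "rep (of_nat m :: 'n::finite bit0) = m mod (2 * CARD('n))"
proof -
  have "(of_nat (rep (of_nat m :: 'n bit0)) :: 'n bit0) = of_nat m" by simp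
  thus ?thesis using rep_less[of "of_nat m :: 'n bit0"]
    by (simp only: of_nat_bit0_eq_iff mod_less)
qed

lemma rep_unique: "of_nat m = (j :: 'n::finite bit0) \<Longrightarrow> m < 2 * CARD('n) \<Longrightarrow> rep j = m"
  by (metis mod_less rep_of_nat)

lemma rep_diff:
  "rep (b - a :: 'n::finite bit0) =
     (if rep a \<le> rep b then rep b - rep a else 2 * CARD('n) + rep b - rep a)"
proof (rule rep_unique)
  show "of_nat (if rep a \<le> rep b then rep b - rep a else 2 * CARD('n) + rep b - rep a) = b - a"
    using rep_less[of a] by (auto simp: of_nat_diff)
  show "(if rep a \<le> rep b then rep b - rep a else 2 * CARD('n) + rep b - rep a) < 2 * CARD('n)"
    using rep_less[of a] rep_less[of b] by auto
qed

lemma rep_diff_1: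
  "rep (a - b - 1 :: 'n::finite bit0) =
     (if rep b < rep a then rep a - rep b - 1 else 2 * CARD('n) + rep a - rep b - 1)"
proof (rule rep_unique)
  show "of_nat (if rep b < rep a then rep a - rep b - 1 else 2 * CARD('n) + rep a - rep b - 1) = a - b - 1"
    using rep_less[of a] rep_less[of b] by (auto simp: of_nat_diff)
  show "(if rep b < rep a then rep a - rep b - 1 else 2 * CARD('n) + rep a - rep b - 1) < 2 * CARD('n)"
    using rep_less[of a] rep_less[of b] by auto
qed

text \<open>This is the average \<open>(1/2n) \<Sum>\<^sub>\<alpha> \<omega>\<^sup>-\<^sup>\<alpha>\<^sup>p / (z - \<omega>\<^sup>\<alpha> w)\<close>.\<close>

definition pole :: "'n::finite bit0 \<Rightarrow> real \<Rightarrow> real \<Rightarrow> real" where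
  "pole p z w = w ^ rep p * z ^ (2 * CARD('n) - 1 - rep p) / (z ^ (2 * CARD('n)) - w ^ (2 * CARD('n)))"

text \<open>The twisted form of \<open>1/((z-w)(w-x)) = (1/(w-x) + 1/(z-w))/(z-x)\<close>.\<close>

lemma pole_mult:
  fixes a b :: "'n::finite bit0"
  assumes zw: "z ^ (2 * CARD('n)) \<noteq> w ^ (2 * CARD('n))" and wx: "w ^ (2 * CARD('n)) \<noteq> x ^ (2 * CARD('n))"
    and zx: "z ^ (2 * CARD('n)) \<noteq> x ^ (2 * CARD('n))"
  shows "pole a z w * pole b w x = pole (b - a) w x * pole a z x + pole (a - b - 1) z w * pole b z x"
proof -
  define N where "N = 2 * CARD('n)"
  define Z W X where "Z = z ^ N" and "W = w ^ N" and "X = x ^ N"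
  define A B where "A = rep a" and "B = rep b"
  have AB: "A < N" "B < N" by (simp_all add: A_def B_def N_def rep_less)
  have ne: "Z - W \<noteq> 0" "W - X \<noteq> 0" "Z - X \<noteq> 0"
    using zw wx zx by (simp_all add: Z_def W_def X_def N_def)
  show ?thesis
  \<comment> \<open>Of the differences \<open>b - a\<close> and \<open>a - b - 1\<close> exactly one
    wraps around modulo 2n. If \<open>A \<le> B\<close>, the three products share the monomial
    \<open>E\<close>; otherwise they carry the extra factors W, X and Z, and the scalar identity
    changes accordingly.\<close>
  proof (cases "A \<le> B")
    case True
    define E where "E = w ^ (N - 1 - B + A) * z ^ (N - 1 - A) * x ^ B"
    have pw: "w ^ A * w ^ (N - 1 - B) = w ^ (N - 1 - B + A)" "x ^ (B - A) * x ^ A = x ^ B"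
      "z ^ (B - A) * z ^ (N - 1 - B) = z ^ (N - 1 - A)"
      "N - 1 - (B - A) = N - 1 - B + A" "N + A - B - 1 = N - 1 - B + A" "N - 1 - (N - 1 - B + A) = B - A"
      using True AB by (auto simp flip: power_add intro: arg_cong)
    have 1: "pole a z w * pole b w x = E * (1 / ((Z - W) * (W - X)))"
      unfolding pole_def A_def[symmetric] B_def[symmetric] N_def[symmetric] Z_def[symmetric]
        W_def[symmetric] X_def[symmetric] E_def pw(1)[symmetric] by simp
    have 2: "pole (b - a) w x * pole a z x = E * (1 / ((W - X) * (Z - X)))"
      using True unfolding pole_def rep_diff A_def[symmetric] B_def[symmetric] N_def[symmetric] Z_def[symmetric]
        W_def[symmetric] X_def[symmetric] E_def pw(2)[symmetric] if_P[OF True] pw(4) by simp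
    have 3: "pole (a - b - 1) z w * pole b z x = E * (1 / ((Z - W) * (Z - X)))"
      using True unfolding pole_def rep_diff_1 A_def[symmetric] B_def[symmetric] N_def[symmetric] Z_def[symmetric]
        W_def[symmetric] X_def[symmetric] E_def pw(3)[symmetric] if_not_P[OF True[folded linorder_not_less]] pw(5,6) by simp
    have "1 / ((Z - W) * (W - X)) = 1 / ((W - X) * (Z - X)) + 1 / ((Z - W) * (Z - X))"
      using ne by (simp add: divide_simps)
    thus ?thesis unfolding 1 2 3 by (simp only: distrib_left)
  next
    case False
    define E where "E = w ^ (A - B - 1) * z ^ (N - 1 - A) * x ^ B"
    have pw: "w ^ A * w ^ (N - 1 - B) = w ^ (A - B - 1) * W" "x ^ (N + B - A) * x ^ A = x ^ B * X"
      "z ^ (N - 1 - (A - B - 1)) * z ^ (N - 1 - B) = z ^ (N - 1 - A) * Z"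
      "N - 1 - (N + B - A) = A - B - 1"
      using False AB by (auto simp: W_def X_def Z_def simp flip: power_add intro: arg_cong)
    have 1: "pole a z w * pole b w x = E * (W / ((Z - W) * (W - X)))"
      unfolding pole_def A_def[symmetric] B_def[symmetric] N_def[symmetric] Z_def[symmetric]
        W_def[symmetric] X_def[symmetric] E_def using pw(1) by simp
    have 2: "pole (b - a) w x * pole a z x = E * (X / ((W - X) * (Z - X)))"
      using pw(2) unfolding pole_def rep_diff A_def[symmetric] B_def[symmetric] N_def[symmetric] Z_def[symmetric]
        W_def[symmetric] X_def[symmetric] E_def if_not_P[OF False] pw(4) by simp
    have 3: "pole (a - b - 1) z w * pole b z x = E * (Z / ((Z - W) * (Z - X)))"
      using False pw(3) unfolding pole_def rep_diff_1 A_def[symmetric] B_def[symmetric] N_def[symmetric] Z_def[symmetric]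
        W_def[symmetric] X_def[symmetric] E_def by simp
    have "W / ((Z - W) * (W - X)) = X / ((W - X) * (Z - X)) + Z / ((Z - W) * (Z - X))"
      using ne by (simp add: divide_simps) (simp add: algebra_simps)
    thus ?thesis unfolding 1 2 3 by (simp only: distrib_left)
  qed
qed

text \<open>Twisted form of (w - x)/(w - x) = 1: raising the residue trades a factor w for x, and
  only the wrap from 2n-1 to 0 leaves a remainder.\<close>

lemma pole_shift:
  fixes p :: "'n::finite bit0"
  assumes "w ^ (2 * CARD('n)) \<noteq> x ^ (2 * CARD('n))"
  shows "w * pole (p + 1) w x - x * pole p w x = (if p = -1 then 1 else 0)"
proof (cases "p = -1")
  case True
  have "rep (-1 :: 'n bit0) = 2 * CARD('n) - 1"
    by (rule rep_unique) (simp_all add: of_nat_diff)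
  moreover have "rep (0 :: 'n bit0) = 0" by (rule rep_unique) simp_all
  moreover have "w * w ^ (2 * CARD('n) - Suc 0) = w ^ (2 * CARD('n))" "x * x ^ (2 * CARD('n) - Suc 0) = x ^ (2 * CARD('n))"
    by (simp_all flip: power_Suc)
  ultimately show ?thesis using assms True by (simp add: pole_def diff_divide_distrib[symmetric])
next
  case False
  have lt: "rep p + 1 < 2 * CARD('n)"
  proof (rule ccontr)
    assume "\<not> ?thesis"
    hence "rep p + 1 = 2 * CARD('n)" using rep_less[of p] by linarith
    hence "of_nat (rep p + 1) = (0 :: 'n bit0)" by (simp only: of_nat_bit0_card)
    hence "p + 1 = 0" by (simp only: of_nat_add of_nat_rep of_nat_1)
    thus False using False by (simp only: eq_neg_iff_add_eq_0)
  qed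
  hence "rep (p + 1) = rep p + 1" by (intro rep_unique) simp_all
  moreover have "w * w ^ (2 * CARD('n) - 1 - (rep p + 1)) = w ^ (2 * CARD('n) - 1 - rep p)"
    using lt by (simp flip: power_Suc add: Suc_diff_Suc)
  ultimately show ?thesis using False
    by (simp add: pole_def)
qed

section \<open>The real Lax matrix and its spectral invariants\<close>

lemma mpow_Suc_right: "mpow A (Suc m) = mpow A m ** (A :: 'a::comm_semiring_1^'m^'m)"
proof (induction m)
  case (Suc m)
  have "mpow A (Suc (Suc m)) = A ** (mpow A m ** A)"
    using Suc by simp
  thus ?case by (simp add: matrix_mul_assoc)
qed simp

lemma mpow_nth_Suc: "mpow A (Suc m) $ j $ k = (\<Sum>i\<in>UNIV. A $ j $ i * mpow A m $ i $ k)"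
  by (simp add: matrix_matrix_mult_def)

lemma sum_bit0_one_minus: "(\<Sum>j\<in>UNIV. f (1 - j)) = (\<Sum>j\<in>UNIV. f (j :: 'n::finite bit0))"
  by (rule sum.reindex_bij_witness[of _ "\<lambda>j. 1 - j" "\<lambda>j. 1 - j"]) auto

text \<open>The hypothesis says that A lies in the symplectic Lie algebra of W. Transposition with
  respect to W reverses products and gives one sign per factor; reflecting the summation index i to
  1 - i carries out the reversal. Odd powers thus stay in the Lie algebra.\<close>

lemma mpow_symplectic:
  fixes A :: "real^('n::finite bit0)^('n bit0)"
  assumes A: "\<And>j k. A $ j $ k = - (alt j * alt k * A $ (1 - k) $ (1 - j))"
  shows "mpow A m $ j $ k = (-1) ^ m * alt j * alt k * mpow A m $ (1 - k) $ (1 - j)"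
proof (induction m arbitrary: j k)
  case 0
  show ?case by (auto simp: mat_def alt_square)
next
  case (Suc m)
  have "mpow A (Suc m) $ j $ k = (\<Sum>i\<in>UNIV. A $ j $ i * mpow A m $ i $ k)"
    by (rule mpow_nth_Suc)
  also have "\<dots> = (\<Sum>i\<in>UNIV. (-1) ^ Suc m * alt j * alt k * (mpow A m $ (1 - k) $ (1 - i) * A $ (1 - i) $ (1 - j)))"
  proof (rule sum.cong[OF refl])
    fix i :: "'n bit0"
    have "A $ j $ i * mpow A m $ i $ k =
      - (alt j * alt i * A $ (1 - i) $ (1 - j)) * ((-1) ^ m * alt i * alt k * mpow A m $ (1 - k) $ (1 - i))"
      by (subst A, subst Suc.IH) simp
    also have "\<dots> = (alt i * alt i) * ((-1) ^ Suc m * alt j * alt k * (mpow A m $ (1 - k) $ (1 - i) * A $ (1 - i) $ (1 - j)))"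
      by simp
    finally show "A $ j $ i * mpow A m $ i $ k =
      (-1) ^ Suc m * alt j * alt k * (mpow A m $ (1 - k) $ (1 - i) * A $ (1 - i) $ (1 - j))"
      by (simp only: alt_square mult_1)
  qed
  also have "\<dots> = (-1) ^ Suc m * alt j * alt k * (\<Sum>i\<in>UNIV. mpow A m $ (1 - k) $ i * A $ i $ (1 - j))"
    by (simp only: sum_distrib_left[symmetric]
        sum_bit0_one_minus[of "\<lambda>i. mpow A m $ (1 - k) $ i * A $ i $ (1 - j)"])
  also have "(\<Sum>i\<in>UNIV. mpow A m $ (1 - k) $ i * A $ i $ (1 - j)) = mpow A (Suc m) $ (1 - k) $ (1 - j)"
    unfolding mpow_Suc_right by (simp add: matrix_matrix_mult_def)
  finally show ?case .
qed

definition lax :: "('r::finite \<Rightarrow> real) \<Rightarrow> real \<Rightarrow> ('n::finite, 'r) phase \<Rightarrow> real^('n bit0)^('n bit0)" where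
  "lax l z \<Phi> = (\<chi> j k. (if k = j + 1 then 1 else 0) +
     (\<Sum>\<sigma>\<in>UNIV. pole (j - k) z (l \<sigma>) * \<Phi> $ j $ \<sigma> * \<Phi> $ (1 - k) $ \<sigma> * alt (1 - k)))"

definition dlax :: "('r::finite \<Rightarrow> real) \<Rightarrow> real \<Rightarrow> ('n::finite, 'r) phase \<Rightarrow> ('n, 'r) phase
    \<Rightarrow> real^('n bit0)^('n bit0)" where
  "dlax l z \<Phi> v = (\<chi> j k. \<Sum>\<sigma>\<in>UNIV. pole (j - k) z (l \<sigma>) *
     (v $ j $ \<sigma> * \<Phi> $ (1 - k) $ \<sigma> + \<Phi> $ j $ \<sigma> * v $ (1 - k) $ \<sigma>) * alt (1 - k))"

text \<open>K and each rank-one term satisfy the relation separately: the reflection exchanges the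
  two factors of \<Phi> and keeps the difference \<open>j - k\<close> on which the coefficient
  depends.\<close>

lemma lax_symplectic:
  "lax l z \<Phi> $ j $ k = - (alt j * alt k * lax l z \<Phi> $ (1 - k) $ (1 - j))"
proof -
  have K: "(if k = j + 1 then 1 else 0) = - (alt j * alt k * (if 1 - j = 1 - k + 1 then 1 else 0 :: real))"
  proof (cases "k = j + 1")
    case True
    have "alt j * alt k = (-1 :: real)" using alt_square[of j, where 'a = real] by (simp add: True alt_add)
    thus ?thesis by (simp add: True)
  next
    case False
    hence "1 - j \<noteq> 1 - k + 1" by (auto simp: algebra_simps)
    thus ?thesis using False by simp
  qed
  have S: "pole (j - k) z (l \<sigma>) * \<Phi> $ j $ \<sigma> * \<Phi> $ (1 - k) $ \<sigma> * alt (1 - k) =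
      - (alt j * alt k * (pole (1 - k - (1 - j)) z (l \<sigma>) * \<Phi> $ (1 - k) $ \<sigma> * \<Phi> $ (1 - (1 - j)) $ \<sigma> * alt (1 - (1 - j))))"
    for \<sigma>
  proof -
    have "- (alt j * alt k * (pole (j - k) z (l \<sigma>) * \<Phi> $ (1 - k) $ \<sigma> * \<Phi> $ j $ \<sigma> * alt j)) =
      - (alt j * alt j) * (alt k * (pole (j - k) z (l \<sigma>) * \<Phi> $ (1 - k) $ \<sigma> * \<Phi> $ j $ \<sigma>))"
      by simp
    thus ?thesis by (simp add: alt_square alt_one_minus)
  qed
  show ?thesis unfolding lax_def vec_lambda_beta
    by (subst K, subst S) (simp add: algebra_simps sum_distrib_left sum_negf)
qed

lemma dlax_scale: "dlax l z \<Phi> (c *\<^sub>R v) = c *\<^sub>R dlax l z \<Phi> v"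
  by (simp add: dlax_def vec_eq_iff algebra_simps sum_distrib_left)

lemma has_derivative_phase_nth:
  "((\<lambda>\<Phi>. \<Phi> $ j $ \<sigma>) has_derivative (\<lambda>v. v $ j $ \<sigma>)) (at (\<Phi> :: real^'r::finite^'k::finite))"
  by (intro bounded_linear_imp_has_derivative bounded_linear_compose[OF bounded_linear_vec_nth] bounded_linear_vec_nth)

lemma has_derivative_lax_nth:
  "((\<lambda>\<Phi>. lax l z \<Phi> $ j $ k) has_derivative (\<lambda>v. dlax l z \<Phi> v $ j $ k)) (at \<Phi>)"
  unfolding lax_def dlax_def vec_lambda_beta
  by (rule derivative_eq_intros has_derivative_phase_nth refl)+ (simp add: algebra_simps)

section \<open>Differentiating traces of matrix powers\<close>

primrec dmpow :: "'a::semiring_1^'m^'m \<Rightarrow> 'a^'m^'m \<Rightarrow> nat \<Rightarrow> 'a^'m^'m" where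
  "dmpow A D 0 = 0"
| "dmpow A D (Suc m) = D ** mpow A m + A ** dmpow A D m"

text \<open>The factor B makes the induction work: \<open>dmpow\<close> peels A off on the left,
  which replaces B by \<open>B ** A\<close>, again commuting with A. Cyclicity of the trace moves
  each D to the end.\<close>

lemma trace_dmpow_mult:
  fixes A :: "real^'m::finite^'m"
  assumes "B ** A = A ** B"
  shows "trace (B ** dmpow A D m) = real m * trace (B ** mpow A (m - 1) ** D)"
  using assms
proof (induction m arbitrary: B)
  case 0
  show ?case by (simp add: trace_def matrix_matrix_mult_def)
next
  case (Suc m)
  have comm: "B ** mpow A m = mpow A m ** B"
  proof (induction m)
    case (Suc m)
    thus ?case using Suc.prems \<open>B ** A = A ** B\<close> by (simp add: matrix_mul_assoc) (metis matrix_mul_assoc)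
  qed simp
  have "trace (B ** (D ** mpow A m)) = trace (B ** mpow A m ** D)"
    by (metis comm matrix_mul_assoc trace_mul_sym)
  moreover have "trace (B ** (A ** dmpow A D m)) = real m * trace (B ** mpow A m ** D)"
  proof (cases m)
    case 0
    thus ?thesis by (simp add: trace_def matrix_matrix_mult_def)
  next
    case (Suc m')
    have "trace ((B ** A) ** dmpow A D m) = real m * trace ((B ** A) ** mpow A (m - 1) ** D)"
      using Suc.prems by (intro Suc.IH) (metis matrix_mul_assoc)
    thus ?thesis using Suc by (simp add: matrix_mul_assoc)
  qed
  ultimately show ?case by (simp add: matrix_add_ldistrib trace_add algebra_simps)
qed

lemma trace_dmpow: "trace (dmpow A D m) = real m * trace (mpow A (m - 1) ** (D :: real^'m::finite^'m))"
  using trace_dmpow_mult[of "mat 1" A D m] by simp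

lemma has_derivative_mpow_lax_nth:
  "((\<lambda>\<Phi>. mpow (lax l z \<Phi>) m $ j $ k) has_derivative
     (\<lambda>v. dmpow (lax l z \<Phi>) (dlax l z \<Phi> v) m $ j $ k)) (at \<Phi>)"
proof (induction m arbitrary: j k)
  case 0
  show ?case by simp
next
  case (Suc m)
  show ?case unfolding mpow_nth_Suc
    by (rule derivative_eq_intros has_derivative_lax_nth Suc.IH refl)+
      (simp add: matrix_matrix_mult_def fun_eq_iff sum.distrib algebra_simps)
qed

definition tr_lax :: "('r::finite \<Rightarrow> real) \<Rightarrow> real \<Rightarrow> nat \<Rightarrow> ('n::finite, 'r) phase \<Rightarrow> real" where
  "tr_lax l z m \<Phi> = trace (mpow (lax l z \<Phi>) m)"

lemma has_derivative_tr_lax: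
  "(tr_lax l z m has_derivative
     (\<lambda>v. real m * trace (mpow (lax l z \<Phi>) (m - 1) ** dlax l z \<Phi> v))) (at \<Phi>)"
proof -
  have "(tr_lax l z m has_derivative
     (\<lambda>v. trace (dmpow (lax l z \<Phi>) (dlax l z \<Phi> v) m))) (at \<Phi>)"
    unfolding tr_lax_def[abs_def] trace_def
    by (rule derivative_eq_intros has_derivative_mpow_lax_nth refl)+
  thus ?thesis by (simp only: trace_dmpow)
qed

lemma frechet_derivative_tr_lax:
  "frechet_derivative (tr_lax l z m) (at \<Phi>) v =
     real m * trace (mpow (lax l z \<Phi>) (m - 1) ** dlax l z \<Phi> v)"
  by (metis frechet_derivative_at has_derivative_tr_lax)

lemma differentiable_tr_lax: "tr_lax l z m differentiable at \<Phi>"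
  using has_derivative_tr_lax unfolding differentiable_def by blast

lemma trace_mult_commutator:
  fixes M A :: "real^'m::finite^'m"
  assumes "M ** A = A ** M"
  shows "trace (M ** (B ** A - A ** B)) = 0"
proof -
  have "trace (M ** (B ** A)) = trace (M ** (A ** B))"
    by (metis assms matrix_mul_assoc trace_mul_sym)
  moreover have "M ** (B ** A - A ** B) = M ** (B ** A) - M ** (A ** B)"
    by (simp add: matrix_matrix_mult_def vec_eq_iff algebra_simps sum_subtractf)
  ultimately show ?thesis by (simp add: trace_sub)
qed

lemma mpow_commute: "mpow A m ** A = A ** mpow A m" for A :: "'a::comm_semiring_1^'m^'m"
  by (metis mpow.simps(2) mpow_Suc_right)

lemma tr_lax_conserved:
  assumes "dlax l z \<Phi> v = c *\<^sub>R (N ** lax l z \<Phi> - lax l z \<Phi> ** N)"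
  shows "frechet_derivative (tr_lax l z m) (at \<Phi>) v = 0"
proof -
  have "mpow (lax l z \<Phi>) (m - 1) ** dlax l z \<Phi> v =
      c *\<^sub>R (mpow (lax l z \<Phi>) (m - 1) ** (N ** lax l z \<Phi> - lax l z \<Phi> ** N))"
    unfolding assms by (simp add: matrix_matrix_mult_def vec_eq_iff sum_distrib_left mult.left_commute)
  thus ?thesis using trace_mult_commutator[OF mpow_commute, of "lax l z \<Phi>" "m - 1" N]
    by (simp add: frechet_derivative_tr_lax trace_def sum_distrib_left[symmetric])
qed

section \<open>Poisson brackets of spectral invariants\<close>

lemma Wmat_square: "Wmat ** Wmat = (- mat 1 :: real^('n::finite bit0)^('n bit0))"
proof -
  have "(Wmat ** Wmat) $ i $ k = (- mat 1 :: real^('n bit0)^('n bit0)) $ i $ k" for i k :: "'n bit0"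
  proof -
    have "(Wmat ** Wmat) $ i $ k =
      (\<Sum>m\<in>UNIV. if m = 1 - i then alt i * (if k = 1 - m then alt m else 0) else (0::real))"
      unfolding matrix_matrix_mult_def Wmat_def vec_lambda_beta by (rule sum.cong[OF refl]) simp
    also have "\<dots> = alt i * (if k = i then alt (1 - i) else 0)"
      by simp
    also have "\<dots> = (- mat 1 :: real^('n bit0)^('n bit0)) $ i $ k"
      by (simp add: mat_def alt_one_minus alt_square)
    finally show ?thesis .
  qed
  thus ?thesis by (simp add: vec_eq_iff)
qed

lemma matrix_inv_unique:
  fixes A :: "'a::semiring_1^'n^'n"
  assumes "A ** B = mat 1" "B ** A = mat 1"
  shows "matrix_inv A = B"
proof -
  have "A ** matrix_inv A = mat 1 \<and> matrix_inv A ** A = mat 1"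
    unfolding matrix_inv_def by (rule someI_ex) (use assms in blast)
  hence "matrix_inv A = (B ** A) ** matrix_inv A" "A ** matrix_inv A = mat 1"
    using assms(2) by simp_all
  thus ?thesis by (metis matrix_mul_assoc matrix_mul_rid)
qed

lemma matrix_inv_Wmat: "matrix_inv Wmat = (- Wmat :: real^('n::finite bit0)^('n bit0))"
proof (rule matrix_inv_unique)
  have "Wmat ** (- Wmat) = - (Wmat ** (Wmat :: real^('n bit0)^('n bit0)))"
    "(- Wmat) ** Wmat = - (Wmat ** (Wmat :: real^('n bit0)^('n bit0)))"
    by (simp_all add: matrix_matrix_mult_def vec_eq_iff sum_negf)
  thus "Wmat ** (- Wmat) = (mat 1 :: real^('n bit0)^('n bit0))"
    "(- Wmat) ** Wmat = (mat 1 :: real^('n bit0)^('n bit0))"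
    by (simp_all add: Wmat_square)
qed

lemma ham_field_nth:
  "ham_field H \<Phi> $ j $ \<sigma> = - (alt j * pdiff H (1 - j) \<sigma> (\<Phi> :: ('n::finite, 'r::finite) phase))"
proof -
  have "ham_field H \<Phi> $ j $ \<sigma> = (\<Sum>k\<in>UNIV. if k = 1 - j then - (alt j * pdiff H k \<sigma> \<Phi>) else 0)"
    unfolding ham_field_def matrix_inv_Wmat
    unfolding Wmat_def uminus_vec_def vec_lambda_beta
    by (rule sum.cong[OF refl]) simp
  thus ?thesis by simp
qed

lemma phase_axis_expansion:
  "v = (\<Sum>j\<in>UNIV. \<Sum>\<sigma>\<in>UNIV. v $ j $ \<sigma> *\<^sub>R axis j (axis \<sigma> 1))" for v :: "real^'r::finite^'k::finite"
proof -
  have "(\<Sum>j\<in>UNIV. \<Sum>\<sigma>\<in>UNIV. v $ j $ \<sigma> *\<^sub>R axis j (axis \<sigma> (1::real))) $ a $ b =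
    v $ a $ b" for a b
  proof -
    have "v $ j $ \<sigma> * axis j (axis \<sigma> (1::real)) $ a $ b =
      (if j = a then if \<sigma> = b then v $ j $ \<sigma> else 0 else 0)" for j \<sigma>
      by (auto simp: axis_def)
    moreover have "(\<Sum>\<sigma>\<in>UNIV. if j = a then if \<sigma> = b then v $ j $ \<sigma> else 0 else 0) =
      (if j = a then v $ a $ b else 0)" for j
      by (cases "j = a") simp_all
    ultimately show ?thesis by simp
  qed
  thus ?thesis by (simp add: vec_eq_iff)
qed

lemma frechet_derivative_pdiff:
  assumes "f differentiable at \<Phi>"
  shows "frechet_derivative f (at \<Phi>) v = (\<Sum>j\<in>UNIV. \<Sum>\<sigma>\<in>UNIV. v $ j $ \<sigma> * pdiff f j \<sigma> \<Phi>)"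
proof -
  interpret linear "frechet_derivative f (at \<Phi>)"
    using assms by (rule linear_frechet_derivative)
  show ?thesis
    by (subst phase_axis_expansion[of v]) (simp add: sum scaleR pdiff_def)
qed

lemma poisson_eq_frechet_derivative:
  assumes "f differentiable at \<Phi>"
  shows "poisson f g \<Phi> = frechet_derivative f (at \<Phi>) (ham_field g \<Phi>)"
proof -
  have "poisson f g \<Phi> = (\<Sum>j\<in>UNIV. \<Sum>\<sigma>\<in>UNIV. \<Sum>k\<in>UNIV.
      matrix_inv Wmat $ j $ k * pdiff f j \<sigma> \<Phi> * pdiff g k \<sigma> \<Phi>)"
    unfolding poisson_def by (intro sum.cong refl sum.swap)
  thus ?thesis
    by (simp add: frechet_derivative_pdiff[OF assms] ham_field_def sum_distrib_left sum_distrib_right mult_ac)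
qed

lemma poisson_skew: "poisson f g \<Phi> = - poisson g f (\<Phi> :: ('n::finite, 'r::finite) phase)"
proof -
  have W: "matrix_inv Wmat $ j $ k = (- (matrix_inv Wmat $ k $ j) :: real)" for j k :: "'n bit0"
    unfolding matrix_inv_Wmat
    unfolding Wmat_def uminus_vec_def vec_lambda_beta
    by (auto simp: alt_one_minus)
  have "poisson f g \<Phi> = (\<Sum>k\<in>UNIV. \<Sum>j\<in>UNIV. \<Sum>\<sigma>\<in>UNIV.
      matrix_inv Wmat $ j $ k * pdiff f j \<sigma> \<Phi> * pdiff g k \<sigma> \<Phi>)"
    unfolding poisson_def by (rule sum.swap)
  also have "\<dots> = (\<Sum>k\<in>UNIV. \<Sum>j\<in>UNIV. \<Sum>\<sigma>\<in>UNIV.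
      - (matrix_inv Wmat $ k $ j * pdiff g k \<sigma> \<Phi> * pdiff f j \<sigma> \<Phi>))"
  proof -
    have "matrix_inv Wmat $ j $ k * pdiff f j \<sigma> \<Phi> * pdiff g k \<sigma> \<Phi> =
      - (matrix_inv Wmat $ k $ j * pdiff g k \<sigma> \<Phi> * pdiff f j \<sigma> \<Phi>)" for j k \<sigma>
      using W[of j k] by simp
    thus ?thesis by simp
  qed
  finally show ?thesis by (simp add: poisson_def sum_negf)
qed

lemma poisson_self: "poisson f f (\<Phi> :: ('n::finite, 'r::finite) phase) = 0"
  using poisson_skew[of f f \<Phi>] by simp

lemma sum_UNIV_delta_mult:
  fixes f :: "'a::finite \<Rightarrow> real"
  shows "(\<Sum>i\<in>UNIV. (if i = a then 1 else 0) * f i) = f a"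
proof -
  have "(\<Sum>i\<in>UNIV. (if i = a then 1 else 0) * f i) = (\<Sum>i\<in>UNIV. if i = a then f i else 0)"
    by (intro sum.cong) auto
  thus ?thesis by simp
qed

text \<open>A coordinate occurs in L both as a row factor and as a column factor. For odd m the
  power L^m has the symplectic symmetry, which makes the two contributions equal; hence the factor
  2.\<close>

lemma pdiff_tr_lax:
  fixes \<Phi> :: "('n::finite, 'r::finite) phase"
  assumes "odd m"
  shows "pdiff (tr_lax l z (Suc m)) k \<sigma> \<Phi> = 2 * real (Suc m) * alt k *
    (\<Sum>a\<in>UNIV. pole (a + k - 1) z (l \<sigma>) * mpow (lax l z \<Phi>) m $ (1 - k) $ a * \<Phi> $ a $ \<sigma>)"
proof -
  define M where "M = mpow (lax l z \<Phi>) m"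
  have sp: "M $ j $ k = - (alt j * alt k * M $ (1 - k) $ (1 - j))" for j k
    using mpow_symplectic[of "lax l z \<Phi>" m j k, OF lax_symplectic] assms by (simp add: M_def)
  have D: "dlax l z \<Phi> (axis k (axis \<sigma> 1)) $ a $ b =
      (if a = k then 1 else 0) * (pole (a - b) z (l \<sigma>) * \<Phi> $ (1 - b) $ \<sigma> * alt (1 - b)) +
      (if b = 1 - k then 1 else 0) * (pole (a - b) z (l \<sigma>) * \<Phi> $ a $ \<sigma> * alt (1 - b))" for a b
  proof -
    have "1 - b = k \<longleftrightarrow> b = 1 - k" by (auto simp: algebra_simps)
    hence "dlax l z \<Phi> (axis k (axis \<sigma> 1)) $ a $ b = (\<Sum>\<tau>\<in>UNIV. (if \<tau> = \<sigma> then 1 else 0) *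
      ((if a = k then 1 else 0) * (pole (a - b) z (l \<tau>) * \<Phi> $ (1 - b) $ \<tau> * alt (1 - b)) +
      (if b = 1 - k then 1 else 0) * (pole (a - b) z (l \<tau>) * \<Phi> $ a $ \<tau> * alt (1 - b))))"
      unfolding dlax_def vec_lambda_beta by (intro sum.cong) (auto simp: axis_def)
    thus ?thesis by (simp only: sum_UNIV_delta_mult)
  qed
  have "trace (M ** dlax l z \<Phi> (axis k (axis \<sigma> 1))) =
      (\<Sum>b\<in>UNIV. \<Sum>a\<in>UNIV. (if a = k then 1 else 0) * (M $ b $ a * (pole (a - b) z (l \<sigma>) * \<Phi> $ (1 - b) $ \<sigma> * alt (1 - b)))) +
      (\<Sum>b\<in>UNIV. (if b = 1 - k then 1 else 0) * (\<Sum>a\<in>UNIV. M $ b $ a * (pole (a - b) z (l \<sigma>) * \<Phi> $ a $ \<sigma> * alt (1 - b))))"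
    unfolding trace_def matrix_matrix_mult_def vec_lambda_beta D
    by (simp add: algebra_simps sum.distrib sum_distrib_left)
  also have "\<dots> = (\<Sum>b\<in>UNIV. M $ b $ k * (pole (k - b) z (l \<sigma>) * \<Phi> $ (1 - b) $ \<sigma> * alt (1 - b))) +
      (\<Sum>a\<in>UNIV. M $ (1 - k) $ a * (pole (a - (1 - k)) z (l \<sigma>) * \<Phi> $ a $ \<sigma> * alt (1 - (1 - k))))"
    by (simp only: sum_UNIV_delta_mult)
  also have "(\<Sum>b\<in>UNIV. M $ b $ k * (pole (k - b) z (l \<sigma>) * \<Phi> $ (1 - b) $ \<sigma> * alt (1 - b))) =
      (\<Sum>a\<in>UNIV. M $ (1 - a) $ k * (pole (k - (1 - a)) z (l \<sigma>) * \<Phi> $ a $ \<sigma> * alt a))"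
    by (subst sum_bit0_one_minus[symmetric]) simp
  also have "\<dots> = (\<Sum>a\<in>UNIV. alt k * (pole (a + k - 1) z (l \<sigma>) * M $ (1 - k) $ a * \<Phi> $ a $ \<sigma>))"
  proof (intro sum.cong refl)
    fix a :: "'n bit0"
    have "M $ (1 - a) $ k * alt a = (alt a * alt a) * alt k * M $ (1 - k) $ a"
      by (subst sp) (simp add: alt_one_minus)
    hence "M $ (1 - a) $ k * alt a = alt k * M $ (1 - k) $ a"
      by (simp add: alt_square)
    thus "M $ (1 - a) $ k * (pole (k - (1 - a)) z (l \<sigma>) * \<Phi> $ a $ \<sigma> * alt a) =
      alt k * (pole (a + k - 1) z (l \<sigma>) * M $ (1 - k) $ a * \<Phi> $ a $ \<sigma>)"
      by (simp add: algebra_simps)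
  qed
  also have "(\<Sum>a\<in>UNIV. M $ (1 - k) $ a * (pole (a - (1 - k)) z (l \<sigma>) * \<Phi> $ a $ \<sigma> * alt (1 - (1 - k)))) =
      (\<Sum>a\<in>UNIV. alt k * (pole (a + k - 1) z (l \<sigma>) * M $ (1 - k) $ a * \<Phi> $ a $ \<sigma>))"
    by (intro sum.cong refl) (simp add: algebra_simps)
  finally have "trace (M ** dlax l z \<Phi> (axis k (axis \<sigma> 1))) =
      2 * alt k * (\<Sum>a\<in>UNIV. pole (a + k - 1) z (l \<sigma>) * M $ (1 - k) $ a * \<Phi> $ a $ \<sigma>)"
    by (simp add: sum_distrib_left mult_ac)
  thus ?thesis
    by (simp add: pdiff_def frechet_derivative_tr_lax M_def mult_ac)
qed

lemma ham_field_tr_lax: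
  fixes \<Phi> :: "('n::finite, 'r::finite) phase"
  assumes "odd m"
  shows "ham_field (tr_lax l z (Suc m)) \<Phi> $ j $ \<sigma> = 2 * real (Suc m) *
    (\<Sum>a\<in>UNIV. pole (a - j) z (l \<sigma>) * mpow (lax l z \<Phi>) m $ j $ a * \<Phi> $ a $ \<sigma>)"
proof -
  have "- (alt j * (2 * real (Suc m) * alt (1 - j) * s)) = (alt j * alt j) * (2 * real (Suc m) * s)" for s :: real
    by (simp add: alt_one_minus)
  thus ?thesis
    by (simp add: ham_field_nth pdiff_tr_lax[OF assms] alt_square)
qed

text \<open>The flow with generator \<open>M\<close> at spectral parameter \<open>z\<close> moves \<open>L(w)\<close> by a commutator: the
  partial fraction identity for \<^const>\<open>pole\<close> leaves a remainder proportional to \<open>[M, L(z)]\<close>.\<close>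

lemma dlax_generated:
  fixes \<Phi> v :: "('n::finite, 'r::finite) phase"
  assumes zw: "z ^ (2 * CARD('n)) \<noteq> w ^ (2 * CARD('n))"
    and zl: "\<And>\<sigma>. z ^ (2 * CARD('n)) \<noteq> l \<sigma> ^ (2 * CARD('n))"
    and wl: "\<And>\<sigma>. w ^ (2 * CARD('n)) \<noteq> l \<sigma> ^ (2 * CARD('n))"
    and comm: "M ** lax l z \<Phi> = lax l z \<Phi> ** M"
    and sp: "\<And>j k. M $ j $ k = - (alt j * alt k * M $ (1 - k) $ (1 - j))"
    and v: "\<And>j \<sigma>. v $ j $ \<sigma> = (\<Sum>a\<in>UNIV. pole (a - j) z (l \<sigma>) * M $ j $ a * \<Phi> $ a $ \<sigma>)"
  defines "N \<equiv> (\<chi> j k. pole (k - j) z w * M $ j $ k)"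
  shows "dlax l w \<Phi> v = N ** lax l w \<Phi> - lax l w \<Phi> ** N"
proof -
  define B where "B \<sigma> j k = \<Phi> $ j $ \<sigma> * \<Phi> $ (1 - k) $ \<sigma> * alt (1 - k)" for \<sigma> j k
  have L: "lax l z \<Phi> $ j $ k = (if k = j + 1 then 1 else 0) + (\<Sum>\<sigma>\<in>UNIV. pole (j - k) z (l \<sigma>) * B \<sigma> j k)"
    for z j k
    by (simp add: lax_def B_def mult.assoc)
  \<comment> \<open>By the symmetry \<open>sp\<close>, the motion of the column factor is right
    multiplication by M with the opposite sign, as a commutator requires.\<close>
  have v': "v $ (1 - k) $ \<sigma> * alt (1 - k) =
      - (\<Sum>m\<in>UNIV. pole (k - m) z (l \<sigma>) * M $ m $ k * \<Phi> $ (1 - m) $ \<sigma> * alt (1 - m))" for k \<sigma>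
  proof -
    have "v $ (1 - k) $ \<sigma> = (\<Sum>m\<in>UNIV. pole (1 - m - (1 - k)) z (l \<sigma>) * M $ (1 - k) $ (1 - m) * \<Phi> $ (1 - m) $ \<sigma>)"
      unfolding v by (rule sum_bit0_one_minus[symmetric])
    hence "v $ (1 - k) $ \<sigma> * alt (1 - k) =
      (\<Sum>m\<in>UNIV. pole (k - m) z (l \<sigma>) * (M $ (1 - k) $ (1 - m) * alt (1 - k)) * \<Phi> $ (1 - m) $ \<sigma>)"
      by (simp add: sum_distrib_left mult_ac)
    also have "\<dots> = (\<Sum>m\<in>UNIV. - (pole (k - m) z (l \<sigma>) * M $ m $ k * \<Phi> $ (1 - m) $ \<sigma> * alt (1 - m)))"
    proof (intro sum.cong refl)
      fix m :: "'n bit0"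
      have "M $ (1 - k) $ (1 - m) * alt (1 - k) = (alt k * alt k) * (alt m * M $ m $ k)"
        by (subst sp) (simp add: alt_one_minus)
      hence "M $ (1 - k) $ (1 - m) * alt (1 - k) = - (M $ m $ k * alt (1 - m))"
        by (simp add: alt_square alt_one_minus)
      thus "pole (k - m) z (l \<sigma>) * (M $ (1 - k) $ (1 - m) * alt (1 - k)) * \<Phi> $ (1 - m) $ \<sigma> =
        - (pole (k - m) z (l \<sigma>) * M $ m $ k * \<Phi> $ (1 - m) $ \<sigma> * alt (1 - m))"
        by (simp add: mult_ac)
    qed
    finally show ?thesis by (simp add: sum_negf)
  qed
  have "dlax l w \<Phi> v $ j $ k = (N ** lax l w \<Phi> - lax l w \<Phi> ** N) $ j $ k" for j k
  proof -
    have D: "dlax l w \<Phi> v $ j $ k = (\<Sum>\<sigma>\<in>UNIV. \<Sum>m\<in>UNIV.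
        pole (j - k) w (l \<sigma>) * pole (m - j) z (l \<sigma>) * (M $ j $ m * B \<sigma> m k)) -
        (\<Sum>\<sigma>\<in>UNIV. \<Sum>m\<in>UNIV. pole (j - k) w (l \<sigma>) * pole (k - m) z (l \<sigma>) * (B \<sigma> j m * M $ m $ k))"
    proof -
      have "dlax l w \<Phi> v $ j $ k = (\<Sum>\<sigma>\<in>UNIV. pole (j - k) w (l \<sigma>) *
          (v $ j $ \<sigma> * \<Phi> $ (1 - k) $ \<sigma> * alt (1 - k) + \<Phi> $ j $ \<sigma> * (v $ (1 - k) $ \<sigma> * alt (1 - k))))"
        by (simp add: dlax_def algebra_simps)
      also have "\<dots> = (\<Sum>\<sigma>\<in>UNIV. pole (j - k) w (l \<sigma>) *
          ((\<Sum>m\<in>UNIV. pole (m - j) z (l \<sigma>) * (M $ j $ m * B \<sigma> m k)) -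
           (\<Sum>m\<in>UNIV. pole (k - m) z (l \<sigma>) * (B \<sigma> j m * M $ m $ k))))"
        by (intro sum.cong refl, subst v', subst v)
          (simp add: B_def sum_distrib_left sum_distrib_right mult_ac)
      finally show ?thesis
        by (simp add: right_diff_distrib sum_subtractf sum_distrib_left mult.assoc)
    qed
    have K1: "(\<Sum>m\<in>UNIV. N $ j $ m * (if k = m + 1 then 1 else 0)) = pole (k - j - 1) z w * M $ j $ (k - 1)"
    proof -
      have "(\<Sum>m\<in>UNIV. N $ j $ m * (if k = m + 1 then 1 else 0)) =
        (\<Sum>m\<in>UNIV. (if m = k - 1 then 1 else 0) * N $ j $ m)"
        by (intro sum.cong) (auto simp: algebra_simps)
      thus ?thesis by (simp only: sum_UNIV_delta_mult) (simp add: N_def algebra_simps)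
    qed
    have K2: "(\<Sum>m\<in>UNIV. (if m = j + 1 then 1 else 0) * N $ m $ k) = pole (k - j - 1) z w * M $ (j + 1) $ k"
      by (simp only: sum_UNIV_delta_mult) (simp add: N_def algebra_simps)
    have K3: "(\<Sum>m\<in>UNIV. M $ j $ m * (if k = m + 1 then 1 else 0)) = M $ j $ (k - 1)"
    proof -
      have "(\<Sum>m\<in>UNIV. M $ j $ m * (if k = m + 1 then 1 else 0)) =
        (\<Sum>m\<in>UNIV. (if m = k - 1 then 1 else 0) * M $ j $ m)"
        by (intro sum.cong) (auto simp: algebra_simps)
      thus ?thesis by (simp only: sum_UNIV_delta_mult)
    qed
    \<comment> \<open>\<open>pole_mult\<close> splits the coefficient into the one that occurs in
      \<open>dlax\<close> and a remainder whose factor \<open>pole (k - j - 1) z w\<close> depends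
      neither on m nor on \<sigma>. The remainders, together with the K part from \<open>K1\<close>,
      add up to this factor times an entry of M L(z).\<close>
    have P1: "N $ j $ m * (pole (m - k) w (l \<sigma>) * B \<sigma> m k) =
        pole (j - k) w (l \<sigma>) * pole (m - j) z (l \<sigma>) * (M $ j $ m * B \<sigma> m k) +
        pole (k - j - 1) z w * (M $ j $ m * (pole (m - k) z (l \<sigma>) * B \<sigma> m k))" for m \<sigma>
    proof -
      have "pole (m - j) z w * pole (m - k) w (l \<sigma>) =
        pole (j - k) w (l \<sigma>) * pole (m - j) z (l \<sigma>) + pole (k - j - 1) z w * pole (m - k) z (l \<sigma>)"
        using pole_mult[of z w "l \<sigma>" "m - j" "m - k"] zw zl wl by (simp add: algebra_simps)
      hence "pole (m - j) z w * pole (m - k) w (l \<sigma>) * (M $ j $ m * B \<sigma> m k) =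
        (pole (j - k) w (l \<sigma>) * pole (m - j) z (l \<sigma>) + pole (k - j - 1) z w * pole (m - k) z (l \<sigma>)) * (M $ j $ m * B \<sigma> m k)"
        by simp
      thus ?thesis by (simp add: N_def algebra_simps)
    qed
    have P2: "pole (j - m) w (l \<sigma>) * B \<sigma> j m * N $ m $ k =
        pole (j - k) w (l \<sigma>) * pole (k - m) z (l \<sigma>) * (B \<sigma> j m * M $ m $ k) +
        pole (k - j - 1) z w * (pole (j - m) z (l \<sigma>) * B \<sigma> j m * M $ m $ k)" for m \<sigma>
    proof -
      have "pole (k - m) z w * pole (j - m) w (l \<sigma>) =
        pole (j - k) w (l \<sigma>) * pole (k - m) z (l \<sigma>) + pole (k - j - 1) z w * pole (j - m) z (l \<sigma>)"
        using pole_mult[of z w "l \<sigma>" "k - m" "j - m"] zw zl wl by (simp add: algebra_simps)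
      hence "pole (k - m) z w * pole (j - m) w (l \<sigma>) * (B \<sigma> j m * M $ m $ k) =
        (pole (j - k) w (l \<sigma>) * pole (k - m) z (l \<sigma>) + pole (k - j - 1) z w * pole (j - m) z (l \<sigma>)) * (B \<sigma> j m * M $ m $ k)"
        by simp
      thus ?thesis by (simp add: N_def algebra_simps)
    qed
    define X where "X = (\<Sum>m\<in>UNIV. \<Sum>\<sigma>\<in>UNIV. M $ j $ m * (pole (m - k) z (l \<sigma>) * B \<sigma> m k))"
    define Y where "Y = (\<Sum>m\<in>UNIV. \<Sum>\<sigma>\<in>UNIV. pole (j - m) z (l \<sigma>) * B \<sigma> j m * M $ m $ k)"
    have M_L: "(M ** lax l z \<Phi>) $ j $ k = M $ j $ (k - 1) + X"
      unfolding matrix_matrix_mult_def vec_lambda_beta L X_def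
      by (simp add: distrib_left sum.distrib K3 sum_distrib_left)
    have L_M: "(lax l z \<Phi> ** M) $ j $ k = M $ (j + 1) $ k + Y"
      unfolding matrix_matrix_mult_def vec_lambda_beta L Y_def
      by (simp only: distrib_right sum.distrib sum_UNIV_delta_mult sum_distrib_right)
    have N_L: "(N ** lax l w \<Phi>) $ j $ k = pole (k - j - 1) z w * M $ j $ (k - 1) +
        (\<Sum>\<sigma>\<in>UNIV. \<Sum>m\<in>UNIV. pole (j - k) w (l \<sigma>) * pole (m - j) z (l \<sigma>) * (M $ j $ m * B \<sigma> m k)) +
        pole (k - j - 1) z w * X"
    proof -
      have "(N ** lax l w \<Phi>) $ j $ k = (\<Sum>m\<in>UNIV. N $ j $ m * (if k = m + 1 then 1 else 0)) +
        (\<Sum>m\<in>UNIV. \<Sum>\<sigma>\<in>UNIV. N $ j $ m * (pole (m - k) w (l \<sigma>) * B \<sigma> m k))"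
        unfolding matrix_matrix_mult_def vec_lambda_beta L
        by (simp only: distrib_left sum.distrib sum_distrib_left)
      also have "(\<Sum>m\<in>UNIV. \<Sum>\<sigma>\<in>UNIV. N $ j $ m * (pole (m - k) w (l \<sigma>) * B \<sigma> m k)) =
        (\<Sum>m\<in>UNIV. \<Sum>\<sigma>\<in>UNIV. pole (j - k) w (l \<sigma>) * pole (m - j) z (l \<sigma>) * (M $ j $ m * B \<sigma> m k)) +
        pole (k - j - 1) z w * X"
        unfolding P1 X_def by (simp only: sum.distrib sum_distrib_left)
      also have "(\<Sum>m\<in>UNIV. \<Sum>\<sigma>\<in>UNIV. pole (j - k) w (l \<sigma>) * pole (m - j) z (l \<sigma>) * (M $ j $ m * B \<sigma> m k)) =
        (\<Sum>\<sigma>\<in>UNIV. \<Sum>m\<in>UNIV. pole (j - k) w (l \<sigma>) * pole (m - j) z (l \<sigma>) * (M $ j $ m * B \<sigma> m k))"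
        by (rule sum.swap)
      finally show ?thesis unfolding K1 by simp
    qed
    have L_N: "(lax l w \<Phi> ** N) $ j $ k = pole (k - j - 1) z w * M $ (j + 1) $ k +
        (\<Sum>\<sigma>\<in>UNIV. \<Sum>m\<in>UNIV. pole (j - k) w (l \<sigma>) * pole (k - m) z (l \<sigma>) * (B \<sigma> j m * M $ m $ k)) +
        pole (k - j - 1) z w * Y"
    proof -
      have "(lax l w \<Phi> ** N) $ j $ k = (\<Sum>m\<in>UNIV. (if m = j + 1 then 1 else 0) * N $ m $ k) +
        (\<Sum>m\<in>UNIV. \<Sum>\<sigma>\<in>UNIV. pole (j - m) w (l \<sigma>) * B \<sigma> j m * N $ m $ k)"
        unfolding matrix_matrix_mult_def vec_lambda_beta L
        by (simp only: distrib_right sum.distrib sum_distrib_right)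
      also have "(\<Sum>m\<in>UNIV. \<Sum>\<sigma>\<in>UNIV. pole (j - m) w (l \<sigma>) * B \<sigma> j m * N $ m $ k) =
        (\<Sum>m\<in>UNIV. \<Sum>\<sigma>\<in>UNIV. pole (j - k) w (l \<sigma>) * pole (k - m) z (l \<sigma>) * (B \<sigma> j m * M $ m $ k)) +
        pole (k - j - 1) z w * Y"
        unfolding P2 Y_def by (simp only: sum.distrib sum_distrib_left)
      also have "(\<Sum>m\<in>UNIV. \<Sum>\<sigma>\<in>UNIV. pole (j - k) w (l \<sigma>) * pole (k - m) z (l \<sigma>) * (B \<sigma> j m * M $ m $ k)) =
        (\<Sum>\<sigma>\<in>UNIV. \<Sum>m\<in>UNIV. pole (j - k) w (l \<sigma>) * pole (k - m) z (l \<sigma>) * (B \<sigma> j m * M $ m $ k))"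
        by (rule sum.swap)
      finally show ?thesis unfolding K2 by simp
    qed
    \<comment> \<open>The remainders on the two sides are entries of M L(z) and of L(z) M with the
      same factor, so \<open>comm\<close> cancels them.\<close>
    have "M $ j $ (k - 1) + X = M $ (j + 1) $ k + Y"
      using M_L L_M comm by simp
    hence "pole (k - j - 1) z w * (M $ j $ (k - 1) + X) = pole (k - j - 1) z w * (M $ (j + 1) $ k + Y)"
      by simp
    thus ?thesis
      by (simp add: D N_L L_N distrib_left)
  qed
  thus ?thesis by (simp add: vec_eq_iff)
qed

text \<open>The free factor \<open>c\<close> lets the lemma serve both the Hamiltonian fields of the
  traces and the t-flow, where \<open>c\<close> is the value of a function of \<Phi>.\<close>

lemma tr_lax_conserved_generated:
  fixes \<Phi> v :: "('n::finite, 'r::finite) phase"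
  assumes zw: "z ^ (2 * CARD('n)) \<noteq> w ^ (2 * CARD('n))"
    and zl: "\<And>\<sigma>. z ^ (2 * CARD('n)) \<noteq> l \<sigma> ^ (2 * CARD('n))"
    and wl: "\<And>\<sigma>. w ^ (2 * CARD('n)) \<noteq> l \<sigma> ^ (2 * CARD('n))"
    and "odd m"
    and v: "\<And>j \<sigma>. v $ j $ \<sigma> = c * (\<Sum>a\<in>UNIV. pole (a - j) z (l \<sigma>) * mpow (lax l z \<Phi>) m $ j $ a * \<Phi> $ a $ \<sigma>)"
  shows "frechet_derivative (tr_lax l w k) (at \<Phi>) v = 0"
proof -
  define M where "M = mpow (lax l z \<Phi>) m"
  define v' :: "('n, 'r) phase" where
    "v' = (\<chi> j \<sigma>. \<Sum>a\<in>UNIV. pole (a - j) z (l \<sigma>) * M $ j $ a * \<Phi> $ a $ \<sigma>)"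
  have vv': "v = c *\<^sub>R v'" using v by (simp add: vec_eq_iff v'_def M_def)
  have sp: "M $ j $ k = - (alt j * alt k * M $ (1 - k) $ (1 - j))" for j k
    using mpow_symplectic[of "lax l z \<Phi>" m j k, OF lax_symplectic] \<open>odd m\<close> by (simp add: M_def)
  have "dlax l w \<Phi> v = c *\<^sub>R ((\<chi> j k. pole (k - j) z w * M $ j $ k) ** lax l w \<Phi> -
      lax l w \<Phi> ** (\<chi> j k. pole (k - j) z w * M $ j $ k))"
    unfolding vv' dlax_scale
    by (rule arg_cong[where f = "scaleR c"], rule dlax_generated[OF zw zl wl _ sp])
      (simp_all add: M_def mpow_commute v'_def)
  thus ?thesis by (rule tr_lax_conserved)
qed

lemma poisson_tr_lax:
  fixes \<Phi> :: "('n::finite, 'r::finite) phase"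
  assumes "z ^ (2 * CARD('n)) \<noteq> w ^ (2 * CARD('n))"
    and "\<And>\<sigma>. z ^ (2 * CARD('n)) \<noteq> l \<sigma> ^ (2 * CARD('n))"
    and "\<And>\<sigma>. w ^ (2 * CARD('n)) \<noteq> l \<sigma> ^ (2 * CARD('n))"
    and "odd m"
  shows "poisson (tr_lax l w k) (tr_lax l z (Suc m)) \<Phi> = 0"
  unfolding poisson_eq_frechet_derivative[OF differentiable_tr_lax]
  by (rule tr_lax_conserved_generated[OF assms(1-4) ham_field_tr_lax[OF assms(4)]])

section \<open>The flows of the Hamiltonian functions\<close>

lemma mom_commute: "mom l \<Phi> m j k = mom l \<Phi> m k j"
  by (simp add: mom_def mult_ac)

lemma gam_minus: "gam l \<Phi> (- j) = gam l \<Phi> j"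
  by (simp add: gam_def mom_commute)

lemma has_derivative_mom:
  "((\<lambda>\<Phi>. mom l \<Phi> m j k) has_derivative
     (\<lambda>v. \<Sum>\<sigma>\<in>UNIV. l \<sigma> powi m * (v $ j $ \<sigma> * \<Phi> $ k $ \<sigma> + \<Phi> $ j $ \<sigma> * v $ k $ \<sigma>))) (at \<Phi>)"
  unfolding mom_def
  by (rule derivative_eq_intros has_derivative_phase_nth refl)+ (simp add: algebra_simps)

lemma sum_axis_mult:
  "(\<Sum>\<tau>\<in>UNIV. c \<tau> * (axis k (axis \<sigma> 1) $ j $ \<tau> * f \<tau> + g \<tau> * axis k (axis \<sigma> 1) $ i $ \<tau>)) =
    c \<sigma> * ((if j = k then 1 else 0) * f \<sigma> + (if i = k then 1 else 0) * (g \<sigma> :: real))"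
proof -
  have "(\<Sum>\<tau>\<in>UNIV. c \<tau> * (axis k (axis \<sigma> 1) $ j $ \<tau> * f \<tau> + g \<tau> * axis k (axis \<sigma> 1) $ i $ \<tau>)) =
    (\<Sum>\<tau>\<in>UNIV. (if \<tau> = \<sigma> then 1 else 0) * (c \<tau> * ((if j = k then 1 else 0) * f \<tau> + (if i = k then 1 else 0) * g \<tau>)))"
    by (rule sum.cong[OF refl]) (simp add: axis_def)
  thus ?thesis by (simp only: sum_UNIV_delta_mult)
qed

section \<open>The Hamiltonian field of \<open>Hx\<close> and its Lax equation\<close>

lemma has_derivative_Hx:
  fixes \<Phi> :: "('n::finite, 'r::finite) phase"
  shows "(Hx l has_derivative (\<lambda>v.
    (\<Sum>j\<in>UNIV. alt j * (\<Sum>\<sigma>\<in>UNIV. l \<sigma> powi 1 * (v $ j $ \<sigma> * \<Phi> $ (2 - j) $ \<sigma> + \<Phi> $ j $ \<sigma> * v $ (2 - j) $ \<sigma>))) +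
    (\<Sum>j\<in>UNIV. mom l \<Phi> 0 j (1 - j) *
      (\<Sum>\<sigma>\<in>UNIV. l \<sigma> powi 0 * (v $ j $ \<sigma> * \<Phi> $ (1 - j) $ \<sigma> + \<Phi> $ j $ \<sigma> * v $ (1 - j) $ \<sigma>))))) (at \<Phi>)"
proof -
  have "((\<lambda>\<Phi>. (\<Sum>j\<in>UNIV. alt j * mom l \<Phi> 1 j (2 - j)) +
      1 / 2 * (\<Sum>j\<in>UNIV. mom l \<Phi> 0 j (1 - j) * mom l \<Phi> 0 j (1 - j))) has_derivative (\<lambda>v.
    (\<Sum>j\<in>UNIV. alt j * (\<Sum>\<sigma>\<in>UNIV. l \<sigma> powi 1 * (v $ j $ \<sigma> * \<Phi> $ (2 - j) $ \<sigma> + \<Phi> $ j $ \<sigma> * v $ (2 - j) $ \<sigma>))) +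
    (\<Sum>j\<in>UNIV. mom l \<Phi> 0 j (1 - j) *
      (\<Sum>\<sigma>\<in>UNIV. l \<sigma> powi 0 * (v $ j $ \<sigma> * \<Phi> $ (1 - j) $ \<sigma> + \<Phi> $ j $ \<sigma> * v $ (1 - j) $ \<sigma>))))) (at \<Phi>)"
    by (rule derivative_eq_intros has_derivative_mom refl)+
      (simp add: fun_eq_iff sum_distrib_left sum.distrib[symmetric] algebra_simps)
  thus ?thesis unfolding Hx_def[abs_def] power2_eq_square .
qed

lemma differentiable_Hx: "Hx l differentiable at \<Phi>"
  using has_derivative_Hx unfolding differentiable_def by blast

text \<open>The reflections j to 2 - j and j to 1 - j match the two occurrences of a coordinate.
  They add up because \<open>alt (2 - j) = alt j\<close> and \<open>mom\<close> is
  symmetric.\<close>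

lemma pdiff_Hx:
  fixes \<Phi> :: "('n::finite, 'r::finite) phase"
  shows "pdiff (Hx l) k \<sigma> \<Phi> =
    2 * (alt k * l \<sigma> * \<Phi> $ (2 - k) $ \<sigma> + mom l \<Phi> 0 k (1 - k) * \<Phi> $ (1 - k) $ \<sigma>)"
proof -
  have sw: "2 - j = k \<longleftrightarrow> j = 2 - k" "1 - j = k \<longleftrightarrow> j = 1 - k" for j k :: "'n bit0"
    by (auto simp: algebra_simps)
  have "pdiff (Hx l) k \<sigma> \<Phi> =
    (\<Sum>j\<in>UNIV. alt j * (l \<sigma> powi 1 * ((if j = k then 1 else 0) * \<Phi> $ (2 - j) $ \<sigma> + (if 2 - j = k then 1 else 0) * \<Phi> $ j $ \<sigma>))) +
    (\<Sum>j\<in>UNIV. mom l \<Phi> 0 j (1 - j) *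
      (l \<sigma> powi 0 * ((if j = k then 1 else 0) * \<Phi> $ (1 - j) $ \<sigma> + (if 1 - j = k then 1 else 0) * \<Phi> $ j $ \<sigma>)))"
    unfolding pdiff_def frechet_derivative_at[OF has_derivative_Hx, symmetric] sum_axis_mult ..
  also have "\<dots> =
    ((\<Sum>j\<in>UNIV. (if j = k then 1 else 0) * (alt j * l \<sigma> * \<Phi> $ (2 - j) $ \<sigma>)) +
     (\<Sum>j\<in>UNIV. (if j = 2 - k then 1 else 0) * (alt j * l \<sigma> * \<Phi> $ j $ \<sigma>))) +
    ((\<Sum>j\<in>UNIV. (if j = k then 1 else 0) * (mom l \<Phi> 0 j (1 - j) * \<Phi> $ (1 - j) $ \<sigma>)) +
     (\<Sum>j\<in>UNIV. (if j = 1 - k then 1 else 0) * (mom l \<Phi> 0 j (1 - j) * \<Phi> $ j $ \<sigma>)))"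
    unfolding sw sum.distrib[symmetric] by (intro arg_cong2[where f = "(+)"] sum.cong refl) (simp_all add: algebra_simps)
  also have "\<dots> = 2 * (alt k * l \<sigma> * \<Phi> $ (2 - k) $ \<sigma> + mom l \<Phi> 0 k (1 - k) * \<Phi> $ (1 - k) $ \<sigma>)"
    unfolding sum_UNIV_delta_mult by (simp add: alt_two_minus mom_commute[of l \<Phi> 0 "1 - k" k])
  finally show ?thesis .
qed

lemma pdiff_cmult:
  assumes "f differentiable at \<Phi>"
  shows "pdiff (\<lambda>\<Phi>. f \<Phi> / c) k \<sigma> \<Phi> = pdiff f k \<sigma> \<Phi> / c"
proof -
  have "(f has_derivative frechet_derivative f (at \<Phi>)) (at \<Phi>)"
    using assms by (simp add: frechet_derivative_works)
  hence "((\<lambda>\<Phi>. f \<Phi> / c) has_derivative (\<lambda>v. frechet_derivative f (at \<Phi>) v / c)) (at \<Phi>)"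
    by (auto intro!: derivative_eq_intros simp: divide_inverse)
  from frechet_derivative_at[OF this] show ?thesis
    by (simp add: pdiff_def) metis
qed

lemma ham_field_Hx: "ham_field (Hx l) \<Phi> = 2 *\<^sub>R x_field l (\<Phi> :: ('n::finite, 'r::finite) phase)"
proof -
  have "ham_field (Hx l) \<Phi> $ j $ \<sigma> = (2 *\<^sub>R x_field l \<Phi>) $ j $ \<sigma>" for j \<sigma>
  proof -
    have "ham_field (Hx l) \<Phi> $ j $ \<sigma> = (alt j * alt j) * (2 * l \<sigma> * \<Phi> $ (1 + j) $ \<sigma>) -
        2 * alt j * mom l \<Phi> 0 j (1 - j) * \<Phi> $ j $ \<sigma>"
      by (simp add: ham_field_nth pdiff_Hx alt_one_minus mom_commute[of l \<Phi> 0 "1 - j" j] algebra_simps)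
    thus ?thesis by (simp add: alt_square x_field_def alt_diff add.commute)
  qed
  thus ?thesis by (simp add: vec_eq_iff)
qed

lemma ham_field_half_Hx: "ham_field (\<lambda>\<Phi>. Hx l \<Phi> / 2) \<Phi> = x_field l (\<Phi> :: ('n::finite, 'r::finite) phase)"
proof -
  have "ham_field (\<lambda>\<Phi>. Hx l \<Phi> / 2) \<Phi> = (1 / 2) *\<^sub>R ham_field (Hx l) \<Phi>"
    by (simp add: vec_eq_iff ham_field_nth pdiff_cmult[OF differentiable_Hx])
  thus ?thesis by (simp add: ham_field_Hx)
qed

text \<open>V is the matrix of the x-part of the Lax pair at spectral parameter w, with its diagonal
  expressed through \<Phi>.\<close>

lemma dlax_x_field:
  fixes \<Phi> :: "('n::finite, 'r::finite) phase"
  assumes wl: "\<And>\<sigma>. w ^ (2 * CARD('n)) \<noteq> l \<sigma> ^ (2 * CARD('n))"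
  defines "V \<equiv> (\<chi> j k. (if k = j + 1 then w else 0) + (if k = j then alt (j - 1) * mom l \<Phi> 0 j (1 - j) else 0))"
  shows "dlax l w \<Phi> (x_field l \<Phi>) = V ** lax l w \<Phi> - lax l w \<Phi> ** V"
proof -
  define b where "b j = alt (j - 1) * mom l \<Phi> 0 j (1 - j)" for j
  define S where "S j k = (\<Sum>\<sigma>\<in>UNIV. pole (j - k) w (l \<sigma>) * (\<Phi> $ j $ \<sigma> * \<Phi> $ (1 - k) $ \<sigma> * alt (1 - k)))" for j k
  have b_minus: "b (1 - k) = - b k" for k
    by (simp add: b_def alt_diff mom_commute[of l \<Phi> 0 "1 - k" k])
  have L: "lax l w \<Phi> $ j $ k = (if k = j + 1 then 1 else 0) + S j k" for j k
    by (simp add: lax_def S_def mult.assoc)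
  have "dlax l w \<Phi> (x_field l \<Phi>) $ j $ k = (V ** lax l w \<Phi> - lax l w \<Phi> ** V) $ j $ k" for j k
  proof -
    define T where "T = (\<Sum>\<sigma>\<in>UNIV. pole (j - k) w (l \<sigma>) * l \<sigma> *
      (\<Phi> $ (j + 1) $ \<sigma> * \<Phi> $ (1 - k) $ \<sigma> + \<Phi> $ j $ \<sigma> * \<Phi> $ (2 - k) $ \<sigma>) * alt (1 - k))"
    have D: "dlax l w \<Phi> (x_field l \<Phi>) $ j $ k = T + (b j - b k) * S j k"
    proof -
      have "x_field l \<Phi> $ i $ \<sigma> = l \<sigma> * \<Phi> $ (i + 1) $ \<sigma> + b i * \<Phi> $ i $ \<sigma>" for i \<sigma>
        by (simp add: x_field_def b_def)
      hence "dlax l w \<Phi> (x_field l \<Phi>) $ j $ k = T + (b j + b (1 - k)) * S j k"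
        by (simp add: dlax_def T_def S_def sum.distrib[symmetric] sum_distrib_left algebra_simps)
      thus ?thesis by (simp add: b_minus)
    qed
    have VL: "(V ** lax l w \<Phi>) $ j $ k = w * lax l w \<Phi> $ (j + 1) $ k + b j * lax l w \<Phi> $ j $ k"
    proof -
      have "(V ** lax l w \<Phi>) $ j $ k =
        (\<Sum>m\<in>UNIV. (if m = j + 1 then 1 else 0) * (w * lax l w \<Phi> $ m $ k)) +
        (\<Sum>m\<in>UNIV. (if m = j then 1 else 0) * (b j * lax l w \<Phi> $ m $ k))"
        unfolding matrix_matrix_mult_def vec_lambda_beta sum.distrib[symmetric]
        by (intro sum.cong refl) (simp add: V_def b_def)
      thus ?thesis by (simp only: sum_UNIV_delta_mult)
    qed
    have LV: "(lax l w \<Phi> ** V) $ j $ k = w * lax l w \<Phi> $ j $ (k - 1) + b k * lax l w \<Phi> $ j $ k"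
    proof -
      have "(lax l w \<Phi> ** V) $ j $ k =
        (\<Sum>m\<in>UNIV. (if m = k - 1 then 1 else 0) * (w * lax l w \<Phi> $ j $ m)) +
        (\<Sum>m\<in>UNIV. (if m = k then 1 else 0) * (b k * lax l w \<Phi> $ j $ m))"
        unfolding matrix_matrix_mult_def vec_lambda_beta sum.distrib[symmetric]
      proof (intro sum.cong refl)
        fix m :: "'n bit0"
        have "k = m + 1 \<longleftrightarrow> m = k - 1" by (auto simp: algebra_simps)
        thus "lax l w \<Phi> $ j $ m * V $ m $ k = (if m = k - 1 then 1 else 0) * (w * lax l w \<Phi> $ j $ m) +
            (if m = k then 1 else 0) * (b k * lax l w \<Phi> $ j $ m)"
          by (auto simp: V_def b_def)
      qed
      thus ?thesis by (simp only: sum_UNIV_delta_mult)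
    qed
    \<comment> \<open>\<open>pole_shift\<close> trades w for the eigenvalues; its remainder at
      \<open>k = j + 1\<close> is what cancels the commutator of the diagonal of V with K.\<close>
    have "w * S (j + 1) k - w * S j (k - 1) = T + (if k = j + 1 then b (j + 1) - b j else 0)"
    proof -
      have p: "w * pole (j - k + 1) w (l \<sigma>) = l \<sigma> * pole (j - k) w (l \<sigma>) + (if k = j + 1 then 1 else 0)" for \<sigma>
      proof -
        have "j - k = -1 \<longleftrightarrow> k = j + 1" by (auto simp: algebra_simps)
        thus ?thesis using pole_shift[OF wl, of "j - k"] by (simp add: algebra_simps)
      qed
      have "w * S (j + 1) k - w * S j (k - 1) = (\<Sum>\<sigma>\<in>UNIV. w * pole (j - k + 1) w (l \<sigma>) *
         ((\<Phi> $ (j + 1) $ \<sigma> * \<Phi> $ (1 - k) $ \<sigma> + \<Phi> $ j $ \<sigma> * \<Phi> $ (2 - k) $ \<sigma>) * alt (1 - k)))"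
      proof -
        have "1 - (k - 1) = 2 - k" "j - (k - 1) = j - k + 1" "j + 1 - k = j - k + 1"
          by (simp_all add: algebra_simps)
        moreover have "alt (2 - k) = (- alt (1 - k) :: real)"
          by (simp add: alt_two_minus alt_one_minus)
        ultimately show ?thesis
          by (simp add: S_def sum_distrib_left sum_subtractf[symmetric] algebra_simps)
      qed
      also have "\<dots> = T + (if k = j + 1 then 1 else 0) * (\<Sum>\<sigma>\<in>UNIV.
         ((\<Phi> $ (j + 1) $ \<sigma> * \<Phi> $ (1 - k) $ \<sigma> + \<Phi> $ j $ \<sigma> * \<Phi> $ (2 - k) $ \<sigma>) * alt (1 - k)))"
        unfolding p T_def by (simp add: sum.distrib[symmetric] sum_distrib_left algebra_simps)
      also have "\<dots> = T + (if k = j + 1 then b (j + 1) - b j else 0)"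
        by (auto simp: b_def mom_def alt_diff alt_add sum_distrib_left sum.distrib sum_negf algebra_simps)
      finally show ?thesis .
    qed
    moreover have "k = j + 1 + 1 \<longleftrightarrow> k - 1 = j + 1" by (auto simp: algebra_simps)
    ultimately show ?thesis
      by (auto simp: D VL LV L algebra_simps)
  qed
  thus ?thesis by (simp add: vec_eq_iff)
qed

lemma tr_lax_conserved_x_field:
  fixes \<Phi> :: "('n::finite, 'r::finite) phase"
  assumes "\<And>\<sigma>. w ^ (2 * CARD('n)) \<noteq> l \<sigma> ^ (2 * CARD('n))"
  shows "frechet_derivative (tr_lax l w m) (at \<Phi>) (x_field l \<Phi>) = 0"
  using tr_lax_conserved[of l w \<Phi> "x_field l \<Phi>" 1, unfolded scaleR_one, OF dlax_x_field, OF assms] .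

lemma poisson_tr_lax_Hx:
  fixes \<Phi> :: "('n::finite, 'r::finite) phase"
  assumes "\<And>\<sigma>. w ^ (2 * CARD('n)) \<noteq> l \<sigma> ^ (2 * CARD('n))"
  shows "poisson (tr_lax l w m) (Hx l) \<Phi> = 0" "poisson (tr_lax l w m) (\<lambda>\<Phi>. Hx l \<Phi> / 2) \<Phi> = 0"
proof -
  interpret linear "frechet_derivative (tr_lax l w m) (at \<Phi>)"
    using differentiable_tr_lax by (rule linear_frechet_derivative)
  show "poisson (tr_lax l w m) (Hx l) \<Phi> = 0" "poisson (tr_lax l w m) (\<lambda>\<Phi>. Hx l \<Phi> / 2) \<Phi> = 0"
    using tr_lax_conserved_x_field[OF assms]
    by (simp_all add: poisson_eq_frechet_derivative[OF differentiable_tr_lax] ham_field_Hx ham_field_half_Hx scale)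
qed

section \<open>Powers of weighted cyclic shifts and the value of L at zero\<close>

lemma mpow_weighted_shift:
  fixes A :: "'a::comm_ring_1^('n::finite bit0)^('n bit0)"
  assumes "\<And>j k. A $ j $ k = (if k = j + 1 then g j else 0)"
  shows "mpow A m $ j $ k = (if k = j + of_nat m then \<Prod>i<m. g (j + of_nat i) else 0)"
proof (induction m arbitrary: j k)
  case 0
  show ?case by (simp add: mat_def eq_commute)
next
  case (Suc m)
  have "mpow A (Suc m) $ j $ k = (\<Sum>i\<in>UNIV. if i = j + 1 then g j * mpow A m $ i $ k else 0)"
    unfolding mpow_nth_Suc by (intro sum.cong refl) (simp add: assms)
  also have "\<dots> = g j * mpow A m $ (j + 1) $ k" by simp
  also have "\<dots> = (if k = j + of_nat (Suc m) then \<Prod>i<Suc m. g (j + of_nat i) else 0)"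
    by (simp add: Suc.IH prod.lessThan_Suc_shift algebra_simps del: prod.lessThan_Suc)
  finally show ?case .
qed

lemma bij_betw_of_nat_bit0: "bij_betw (\<lambda>i. j + of_nat i) {..<2 * CARD('n)} (UNIV :: 'n::finite bit0 set)"
proof (rule bij_betwI')
  fix a b :: nat assume "a \<in> {..<2 * CARD('n)}" "b \<in> {..<2 * CARD('n)}"
  thus "(j + of_nat a = j + of_nat b) = (a = b)" by (simp add: of_nat_bit0_eq_iff)
next
  fix y :: "'n bit0"
  have "y = j + of_nat (rep (y - j))" by simp
  thus "\<exists>x\<in>{..<2 * CARD('n)}. y = j + of_nat x" using rep_less by blast
qed simp

lemma prod_of_nat_bit0: "(\<Prod>i<2 * CARD('n). g (j + of_nat i)) = (\<Prod>k\<in>UNIV. g (k :: 'n::finite bit0))"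
  by (rule prod.reindex_bij_betw[OF bij_betw_of_nat_bit0])

text \<open>2n steps go once around the cycle and collect every weight. From j, 2n-1 steps miss
  exactly the weight at \<open>j - 1\<close>; multiplying by it avoids a division.\<close>

lemma mpow_weighted_shift_card:
  fixes A :: "'a::comm_ring_1^('n::finite bit0)^('n bit0)"
  assumes "\<And>j k. A $ j $ k = (if k = j + 1 then g j else 0)"
  shows "trace (mpow A (2 * CARD('n))) = of_nat (2 * CARD('n)) * (\<Prod>k\<in>UNIV. g k)"
    and "mpow A (2 * CARD('n) - 1) $ j $ k * g (j - 1) = (if k = j - 1 then \<Prod>k\<in>UNIV. g k else 0)"
proof -
  have "mpow A (2 * CARD('n)) $ j $ j = (\<Prod>k\<in>UNIV. g k)" for j
    unfolding mpow_weighted_shift[OF assms] prod_of_nat_bit0 by simp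
  thus "trace (mpow A (2 * CARD('n))) = of_nat (2 * CARD('n)) * (\<Prod>k\<in>UNIV. g k)"
    by (simp add: trace_def)
  have o: "(of_nat (2 * CARD('n) - 1) :: 'n bit0) = -1"
    by (simp add: of_nat_diff)
  have "(\<Prod>k\<in>UNIV. g k) = (\<Prod>i<Suc (2 * CARD('n) - 1). g (j + of_nat i))"
    unfolding prod_of_nat_bit0[symmetric, of g j] by simp
  also have "\<dots> = (\<Prod>i<2 * CARD('n) - 1. g (j + of_nat i)) * g (j - 1)"
    using o by (simp only: prod.lessThan_Suc) simp
  finally show "mpow A (2 * CARD('n) - 1) $ j $ k * g (j - 1) = (if k = j - 1 then \<Prod>k\<in>UNIV. g k else 0)"
    unfolding mpow_weighted_shift[OF assms] o by simp
qed

lemma pole_zero: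
  assumes "w \<noteq> 0"
  shows "pole p 0 w = (if p = (-1 :: 'n::finite bit0) then - inverse w else 0)"
proof -
  have m1: "rep (-1 :: 'n bit0) = 2 * CARD('n) - 1"
    by (rule rep_unique) (simp_all add: of_nat_diff)
  have "0 < 2 * CARD('n) - 1 - rep p" if "p \<noteq> -1"
  proof -
    have "rep p \<noteq> 2 * CARD('n) - 1" using that of_nat_rep m1 by metis
    thus ?thesis using rep_less[of p] by linarith
  qed
  moreover have "w ^ (2 * CARD('n)) = w * w ^ (2 * CARD('n) - 1)"
    by (simp flip: power_Suc)
  ultimately show ?thesis using assms
    by (cases "p = -1") (simp_all add: pole_def m1 power_0_left field_simps)
qed

text \<open>At z = 0 only the residue 2n-1 survives, that is \<open>j - k = -1\<close>, the
  superdiagonal already occupied by K.\<close>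

lemma lax_zero:
  fixes \<Phi> :: "('n::finite, 'r::finite) phase"
  assumes "\<And>\<sigma>. l \<sigma> \<noteq> 0"
  shows "lax l 0 \<Phi> $ j $ k = (if k = j + 1 then gam l \<Phi> j else 0)"
proof -
  have "j - k = -1 \<longleftrightarrow> k = j + 1" by (auto simp: algebra_simps)
  thus ?thesis
    by (auto simp: lax_def pole_zero[OF assms] gam_def mom_def sum_negf sum_distrib_left algebra_simps
        power_int_minus)
qed

section \<open>Smoothness and the Hamiltonian \<open>H\<^sup>t\<close>\<close>

inductive elementary :: "'a::real_normed_vector set \<Rightarrow> ('a \<Rightarrow> real) \<Rightarrow> bool" for M where
  linear: "bounded_linear f \<Longrightarrow> elementary M f"
| const: "elementary M (\<lambda>x. c)"
| add: "elementary M f \<Longrightarrow> elementary M g \<Longrightarrow> elementary M (\<lambda>x. f x + g x)"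
| mult: "elementary M f \<Longrightarrow> elementary M g \<Longrightarrow> elementary M (\<lambda>x. f x * g x)"
| powr: "elementary M f \<Longrightarrow> (\<And>x. x \<in> M \<Longrightarrow> f x > 0) \<Longrightarrow> elementary M (\<lambda>x. f x powr a)"

lemma elementary_has_derivative:
  assumes "elementary M f"
  shows "\<exists>f'. (\<forall>v. elementary M (f' v)) \<and> (\<forall>x\<in>M. (f has_derivative (\<lambda>v. f' v x)) (at x))"
  using assms
proof induction
  case (linear f)
  thus ?case
    by (intro exI[of _ "\<lambda>v x. f v"]) (auto intro: elementary.const bounded_linear_imp_has_derivative)
next
  case (const c)
  show ?case by (intro exI[of _ "\<lambda>v x. 0"]) (auto intro: elementary.const)
next
  case (add f g)
  then obtain f' g' where "\<And>v. elementary M (f' v)" "\<And>v. elementary M (g' v)"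
    "\<And>x. x \<in> M \<Longrightarrow> (f has_derivative (\<lambda>v. f' v x)) (at x)"
    "\<And>x. x \<in> M \<Longrightarrow> (g has_derivative (\<lambda>v. g' v x)) (at x)" by blast
  thus ?case
    by (intro exI[of _ "\<lambda>v x. f' v x + g' v x"]) (auto intro: elementary.add has_derivative_add)
next
  case (mult f g)
  then obtain f' g' where "\<And>v. elementary M (f' v)" "\<And>v. elementary M (g' v)"
    "\<And>x. x \<in> M \<Longrightarrow> (f has_derivative (\<lambda>v. f' v x)) (at x)"
    "\<And>x. x \<in> M \<Longrightarrow> (g has_derivative (\<lambda>v. g' v x)) (at x)" by blast
  thus ?case
    by (intro exI[of _ "\<lambda>v x. f x * g' v x + f' v x * g x"])
      (use mult.hyps in \<open>auto intro!: elementary.add elementary.mult has_derivative_mult\<close>)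
next
  case (powr f a)
  then obtain f' where f': "\<And>v. elementary M (f' v)"
    "\<And>x. x \<in> M \<Longrightarrow> (f has_derivative (\<lambda>v. f' v x)) (at x)" by blast
  have "((\<lambda>x. f x powr a) has_derivative (\<lambda>v. f' v x * (a * f x powr (a - 1)))) (at x)" if "x \<in> M" for x
    by (rule DERIV_compose_FDERIV[OF _ f'(2)[OF that]])
      (use powr.hyps that in \<open>auto intro!: has_real_derivative_powr\<close>)
  moreover have "elementary M (\<lambda>x. f' v x * (a * f x powr (a - 1)))" for v
    using powr.hyps f'(1) by (intro elementary.mult elementary.const elementary.powr)
  ultimately show ?case by (intro exI[of _ "\<lambda>v x. f' v x * (a * f x powr (a - 1))"]) blast
qed

text \<open>The induction needs an arbitrary g agreeing with an elementary f on M: the derivative of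
  f has its closed form only at points of the open set M.\<close>

lemma dir_derivs_differentiable:
  assumes "open M" "elementary M f" "\<And>x. x \<in> M \<Longrightarrow> g x = f x" "x \<in> M"
  shows "dir_derivs vs g differentiable at x"
  using assms(2-)
proof (induction vs arbitrary: f g x)
  case Nil
  obtain f' where "(f has_derivative (\<lambda>v. f' v x)) (at x)"
    using elementary_has_derivative[OF Nil(1)] Nil(3) by blast
  hence "(g has_derivative (\<lambda>v. f' v x)) (at x)"
    by (rule has_derivative_transform_within_open[OF _ \<open>open M\<close> Nil(3)]) (simp add: Nil)
  thus ?case by (auto simp: differentiable_def)
next
  case (Cons v vs)
  obtain f' where f': "\<And>v. elementary M (f' v)" "\<And>x. x \<in> M \<Longrightarrow> (f has_derivative (\<lambda>v. f' v x)) (at x)"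
    using elementary_has_derivative[OF Cons.prems(1)] by blast
  have "(g has_derivative (\<lambda>v. f' v x)) (at x)" if "x \<in> M" for x
    by (rule has_derivative_transform_within_open[OF f'(2)[OF that] \<open>open M\<close> that]) (simp add: Cons.prems)
  hence "frechet_derivative g (at x) v = f' v x" if "x \<in> M" for x
    using frechet_derivative_at that by metis
  thus ?case
    using Cons.IH[OF f'(1)[of v], of "\<lambda>x. frechet_derivative g (at x) v", OF _ Cons.prems(3)] by simp
qed

lemma smooth_on_elementary: "open M \<Longrightarrow> elementary M f \<Longrightarrow> smooth_on M f"
  unfolding smooth_on_def using dir_derivs_differentiable by blast

lemma elementary_polynomial: "real_polynomial_function f \<Longrightarrow> elementary M f"
  by (induction rule: real_polynomial_function.induct) (auto intro: elementary.intros)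

lemma elementary_prod:
  "finite I \<Longrightarrow> (\<And>i. i \<in> I \<Longrightarrow> elementary M (f i)) \<Longrightarrow> elementary M (\<lambda>x. \<Prod>i\<in>I. f i x)"
  by (induction rule: finite_induct) (auto intro: elementary.intros)

lemma polynomial_phase_nth: "real_polynomial_function (\<lambda>\<Phi> :: real^'r::finite^'k::finite. \<Phi> $ j $ \<sigma>)"
  by (intro real_polynomial_function.intros(1) bounded_linear_compose[OF bounded_linear_vec_nth] bounded_linear_vec_nth)

lemma polynomial_mom: "real_polynomial_function (\<lambda>\<Phi>. mom l \<Phi> m j k)"
  unfolding mom_def
  by (intro real_polynomial_function_sum real_polynomial_function.intros(4) real_polynomial_function.intros(2)
      polynomial_phase_nth) simp

lemma polynomial_gam: "real_polynomial_function (\<lambda>\<Phi>. gam l \<Phi> j)"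
  unfolding gam_def
  by (intro real_polynomial_function_diff real_polynomial_function.intros(4) real_polynomial_function.intros(2) polynomial_mom)

lemma polynomial_Hx: "real_polynomial_function (Hx l)"
  unfolding Hx_def[abs_def]
  by (intro real_polynomial_function_sum real_polynomial_function.intros(3) real_polynomial_function.intros(4)
      real_polynomial_function.intros(2) real_polynomial_function_power polynomial_mom) simp_all

lemma polynomial_lax_nth: "real_polynomial_function (\<lambda>\<Phi>. lax l z \<Phi> $ j $ k)"
  unfolding lax_def vec_lambda_beta
  by (intro real_polynomial_function_sum real_polynomial_function.intros(3) real_polynomial_function.intros(4)
      real_polynomial_function.intros(2) polynomial_phase_nth) simp

lemma polynomial_dlax_nth: "real_polynomial_function (\<lambda>\<Phi>. dlax l z \<Phi> v $ j $ k)"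
  unfolding dlax_def vec_lambda_beta
  by (intro real_polynomial_function_sum real_polynomial_function.intros(3) real_polynomial_function.intros(4)
      real_polynomial_function.intros(2) polynomial_phase_nth) simp

lemma polynomial_mpow_lax_nth: "real_polynomial_function (\<lambda>\<Phi>. mpow (lax l z \<Phi>) m $ j $ k)"
proof (induction m arbitrary: j k)
  case 0
  show ?case by (simp add: real_polynomial_function.intros(2))
next
  case (Suc m)
  show ?case unfolding mpow_nth_Suc
    by (intro real_polynomial_function_sum real_polynomial_function.intros(4) polynomial_lax_nth Suc.IH) simp
qed

lemma polynomial_tr_lax: "real_polynomial_function (tr_lax l z m)"
  unfolding tr_lax_def[abs_def] trace_def
  by (intro real_polynomial_function_sum polynomial_mpow_lax_nth) simp

lemma polynomial_frechet_derivative_tr_lax: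
  "real_polynomial_function (\<lambda>\<Phi>. frechet_derivative (tr_lax l z m) (at \<Phi>) v)"
  unfolding frechet_derivative_tr_lax trace_def matrix_matrix_mult_def vec_lambda_beta
  by (intro real_polynomial_function_sum real_polynomial_function.intros(4) real_polynomial_function.intros(2)
      polynomial_mpow_lax_nth polynomial_dlax_nth) simp_all

lemma continuous_real_polynomial_function:
  "real_polynomial_function f \<Longrightarrow> continuous_on S f" for f :: "'a::euclidean_space \<Rightarrow> real"
  using continuous_on_polymonial_function real_polynomial_function_eq by blast

lemma open_gam_region: "open (gam_region l :: ('n::finite, 'r::finite) phase set)"
proof -
  have "gam_region l = (\<Inter>k. {\<Phi> :: ('n, 'r) phase. 0 < gam l \<Phi> k})"
    by (auto simp: gam_region_def)
  moreover have "open {\<Phi> :: ('n, 'r) phase. 0 < gam l \<Phi> k}" for k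
    by (intro open_Collect_less continuous_intros continuous_real_polynomial_function polynomial_gam)
  ultimately show ?thesis by (simp add: open_INT)
qed

lemma smooth_on_Ht: "smooth_on (gam_region l :: ('n::finite, 'r::finite) phase set) (Ht l)"
  unfolding Ht_def[abs_def] gam_def[symmetric]
  by (intro smooth_on_elementary open_gam_region elementary.mult elementary.const elementary_prod
      elementary.powr elementary_polynomial polynomial_gam) (auto simp: gam_region_def)

lemma Ht_eq: "Ht l \<Phi> = - real CARD('n) * Gam l (\<Phi> :: ('n::finite, 'r::finite) phase)"
  by (simp add: Ht_def Gam_def gam_def)

section \<open>The Hamiltonian field of \<open>Ht\<close> and its flow\<close>

lemma has_derivative_Gam:
  fixes \<Phi> :: "('n::finite, 'r::finite) phase"
  assumes "\<Phi> \<in> gam_region l" and "\<And>j. ((\<lambda>\<Psi>. gam l \<Psi> j) has_derivative D j) (at \<Phi>)"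
  shows "(Gam l has_derivative (\<lambda>v. Gam l \<Phi> / (2 * real CARD('n)) * (\<Sum>j\<in>UNIV. D j v / gam l \<Phi> j))) (at \<Phi>)"
proof -
  define p where "p = 1 / (2 * real CARD('n))"
  have pos: "gam l \<Phi> j > 0" for j using assms(1) by (simp add: gam_region_def)
  have d: "((\<lambda>\<Psi>. gam l \<Psi> j powr p) has_derivative (\<lambda>v. D j v * (p * gam l \<Phi> j powr (p - 1)))) (at \<Phi>)" for j
    by (rule DERIV_compose_FDERIV[OF _ assms(2)]) (auto intro!: has_real_derivative_powr pos)
  have "(Gam l has_derivative (\<lambda>v. \<Sum>j\<in>UNIV. D j v * (p * gam l \<Phi> j powr (p - 1)) * (\<Prod>k\<in>UNIV - {j}. gam l \<Phi> k powr p))) (at \<Phi>)"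
    unfolding Gam_def[abs_def] p_def[symmetric] by (rule has_derivative_prod) (rule d)
  moreover have "D j v * (p * gam l \<Phi> j powr (p - 1)) * (\<Prod>k\<in>UNIV - {j}. gam l \<Phi> k powr p) =
      Gam l \<Phi> * p * (D j v / gam l \<Phi> j)" for j v
  proof -
    have "Gam l \<Phi> = gam l \<Phi> j powr p * (\<Prod>k\<in>UNIV - {j}. gam l \<Phi> k powr p)"
      unfolding Gam_def p_def[symmetric] by (rule prod.remove) auto
    thus ?thesis using pos[of j] by (simp add: powr_diff)
  qed
  ultimately show ?thesis by (simp add: p_def sum_distrib_left)
qed

lemma has_derivative_gam:
  "((\<lambda>\<Phi>. gam l \<Phi> j) has_derivative (\<lambda>v. - (alt j *
     (\<Sum>\<sigma>\<in>UNIV. l \<sigma> powi (-1) * (v $ j $ \<sigma> * \<Phi> $ (- j) $ \<sigma> + \<Phi> $ j $ \<sigma> * v $ (- j) $ \<sigma>))))) (at \<Phi>)"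
  unfolding gam_def by (rule derivative_eq_intros has_derivative_mom refl)+ simp

text \<open>A coordinate of row k enters through the indices k and -k with equal contributions,
  since \<gamma>_k = \<gamma>_(-k). Their sum cancels the factor 1/2 left from n / 2n.\<close>

lemma pdiff_Ht:
  fixes \<Phi> :: "('n::finite, 'r::finite) phase"
  assumes "\<Phi> \<in> gam_region l"
  shows "pdiff (Ht l) k \<sigma> \<Phi> = Gam l \<Phi> * alt k * inverse (l \<sigma>) * \<Phi> $ (- k) $ \<sigma> / gam l \<Phi> k"
proof -
  have sw: "- j = k \<longleftrightarrow> j = - k" for j k :: "'n bit0" by auto
  have "(Ht l has_derivative (\<lambda>v. - real CARD('n) * (Gam l \<Phi> / (2 * real CARD('n)) * (\<Sum>j\<in>UNIV.
     - (alt j * (\<Sum>\<sigma>\<in>UNIV. l \<sigma> powi (-1) * (v $ j $ \<sigma> * \<Phi> $ (- j) $ \<sigma> + \<Phi> $ j $ \<sigma> * v $ (- j) $ \<sigma>)))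
       / gam l \<Phi> j)))) (at \<Phi>)"
    unfolding Ht_eq[abs_def]
    by (intro has_derivative_mult_right has_derivative_Gam[OF assms] has_derivative_gam)
  hence "pdiff (Ht l) k \<sigma> \<Phi> = - real CARD('n) * (Gam l \<Phi> / (2 * real CARD('n)) * (\<Sum>j\<in>UNIV.
     - (alt j * (l \<sigma> powi (-1) * ((if j = k then 1 else 0) * \<Phi> $ (- j) $ \<sigma> + (if - j = k then 1 else 0) * \<Phi> $ j $ \<sigma>)))
       / gam l \<Phi> j))"
    unfolding pdiff_def by (subst frechet_derivative_at[symmetric], assumption) (simp only: sum_axis_mult)
  also have "\<dots> = Gam l \<Phi> / 2 * (\<Sum>j\<in>UNIV. alt j * (l \<sigma> powi (-1) *
      ((if j = k then 1 else 0) * \<Phi> $ (- j) $ \<sigma> + (if - j = k then 1 else 0) * \<Phi> $ j $ \<sigma>)) / gam l \<Phi> j)"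
    by (simp add: sum_negf)
  also have "\<dots> = Gam l \<Phi> / 2 *
     ((\<Sum>j\<in>UNIV. (if j = k then 1 else 0) * (alt j * inverse (l \<sigma>) * \<Phi> $ (- j) $ \<sigma> / gam l \<Phi> j)) +
      (\<Sum>j\<in>UNIV. (if j = - k then 1 else 0) * (alt j * inverse (l \<sigma>) * \<Phi> $ j $ \<sigma> / gam l \<Phi> j)))"
    unfolding sw sum.distrib[symmetric]
    by (intro arg_cong2[where f = "(*)"] sum.cong refl) (simp add: power_int_minus add_divide_distrib algebra_simps)
  also have "\<dots> = Gam l \<Phi> * alt k * inverse (l \<sigma>) * \<Phi> $ (- k) $ \<sigma> / gam l \<Phi> k"
    unfolding sum_UNIV_delta_mult by (simp add: gam_minus)
  finally show ?thesis .
qed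

lemma t_field_nth:
  "t_field l \<Phi> $ j $ \<sigma> = inverse (l \<sigma>) * Gam l \<Phi> * inverse (gam l \<Phi> (j - 1)) * \<Phi> $ (j - 1) $ \<sigma>"
  by (simp add: t_field_def Gam_def)

lemma ham_field_Ht:
  assumes "\<Phi> \<in> gam_region l"
  shows "ham_field (Ht l) \<Phi> = t_field l (\<Phi> :: ('n::finite, 'r::finite) phase)"
proof -
  have "ham_field (Ht l) \<Phi> $ j $ \<sigma> = t_field l \<Phi> $ j $ \<sigma>" for j \<sigma>
  proof -
    have "ham_field (Ht l) \<Phi> $ j $ \<sigma> = (alt j * alt j) * (Gam l \<Phi> * inverse (l \<sigma>) * \<Phi> $ (j - 1) $ \<sigma>) / gam l \<Phi> (1 - j)"
      by (simp add: ham_field_nth pdiff_Ht[OF assms] alt_one_minus)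
    moreover have "gam l \<Phi> (1 - j) = gam l \<Phi> (j - 1)"
      using gam_minus[of l \<Phi> "j - 1"] by simp
    ultimately show ?thesis by (simp add: alt_square t_field_nth field_simps)
  qed
  thus ?thesis by (simp add: vec_eq_iff)
qed

text \<open>The t-flow is generated at spectral parameter 0 by the odd power L(0)^(2n-1), which has
  a single nonzero entry in each row; \<open>w \<noteq> 0\<close> separates w from that
  parameter.\<close>

lemma tr_lax_conserved_t_field:
  fixes \<Phi> :: "('n::finite, 'r::finite) phase"
  assumes l: "\<And>\<sigma>. l \<sigma> \<noteq> 0" and "w \<noteq> 0" and wl: "\<And>\<sigma>. w ^ (2 * CARD('n)) \<noteq> l \<sigma> ^ (2 * CARD('n))"
    and \<Phi>: "\<Phi> \<in> gam_region l"
  shows "frechet_derivative (tr_lax l w k) (at \<Phi>) (t_field l \<Phi>) = 0"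
proof (rule tr_lax_conserved_generated[of 0 w])
  show "odd (2 * CARD('n) - 1)" by simp
  \<comment> \<open>The minus sign compensates the one in \<open>pole_zero\<close>. Dividing by the
    product of all \<gamma>_k turns the relevant entry of the power into 1 / \<gamma>_(j-1).\<close>
  show "t_field l \<Phi> $ j $ \<sigma> = - (Gam l \<Phi> / (\<Prod>k\<in>UNIV. gam l \<Phi> k)) *
      (\<Sum>a\<in>UNIV. pole (a - j) 0 (l \<sigma>) * mpow (lax l 0 \<Phi>) (2 * CARD('n) - 1) $ j $ a * \<Phi> $ a $ \<sigma>)" for j \<sigma>
  proof -
    have pos: "gam l \<Phi> k > 0" for k using \<Phi> by (simp add: gam_region_def)
    have "mpow (lax l 0 \<Phi>) (2 * CARD('n) - 1) $ j $ (j - 1) * gam l \<Phi> (j - 1) = (\<Prod>k\<in>UNIV. gam l \<Phi> k)"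
      using mpow_weighted_shift_card(2)[of "lax l 0 \<Phi>" "gam l \<Phi>" j "j - 1", OF lax_zero, OF l] by simp
    hence m: "mpow (lax l 0 \<Phi>) (2 * CARD('n) - 1) $ j $ (j - 1) = (\<Prod>k\<in>UNIV. gam l \<Phi> k) / gam l \<Phi> (j - 1)"
      using pos[of "j - 1"] by (simp add: field_simps)
    have "(\<Sum>a\<in>UNIV. pole (a - j) 0 (l \<sigma>) * mpow (lax l 0 \<Phi>) (2 * CARD('n) - 1) $ j $ a * \<Phi> $ a $ \<sigma>) =
      (\<Sum>a\<in>UNIV. (if a = j - 1 then 1 else 0) *
        (- inverse (l \<sigma>) * mpow (lax l 0 \<Phi>) (2 * CARD('n) - 1) $ j $ a * \<Phi> $ a $ \<sigma>))"
    proof (intro sum.cong refl)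
      fix a :: "'n bit0"
      have "a - j = -1 \<longleftrightarrow> a = j - 1" by (auto simp: algebra_simps)
      thus "pole (a - j) 0 (l \<sigma>) * mpow (lax l 0 \<Phi>) (2 * CARD('n) - 1) $ j $ a * \<Phi> $ a $ \<sigma> =
        (if a = j - 1 then 1 else 0) *
        (- inverse (l \<sigma>) * mpow (lax l 0 \<Phi>) (2 * CARD('n) - 1) $ j $ a * \<Phi> $ a $ \<sigma>)"
        by (simp add: pole_zero l)
    qed
    also have "\<dots> = - inverse (l \<sigma>) * ((\<Prod>k\<in>UNIV. gam l \<Phi> k) / gam l \<Phi> (j - 1)) * \<Phi> $ (j - 1) $ \<sigma>"
      unfolding sum_UNIV_delta_mult m ..
    finally show ?thesis
      using pos by (simp add: t_field_nth field_simps less_imp_neq[symmetric])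
  qed
qed (use assms in \<open>simp_all add: power_0_left\<close>)

lemma poisson_tr_lax_Ht:
  fixes \<Phi> :: "('n::finite, 'r::finite) phase"
  assumes "\<And>\<sigma>. l \<sigma> \<noteq> 0" and "w \<noteq> 0" and "\<And>\<sigma>. w ^ (2 * CARD('n)) \<noteq> l \<sigma> ^ (2 * CARD('n))"
    and "\<Phi> \<in> gam_region l"
  shows "poisson (tr_lax l w k) (Ht l) \<Phi> = 0"
  using tr_lax_conserved_t_field[OF assms]
  by (simp add: poisson_eq_frechet_derivative[OF differentiable_tr_lax] ham_field_Ht[OF assms(4)])

section \<open>Functional independence\<close>

text \<open>Clearing denominators gives a polynomial of degree below r that vanishes at the r points
  \<open>X \<tau>\<close>, hence everywhere; at \<open>Z i\<close> all summands but one contain a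
  zero factor.\<close>

lemma cauchy_matrix_kernel:
  fixes a Z X :: "'r::finite \<Rightarrow> real"
  assumes Z: "inj Z" and X: "inj X" and ZX: "\<And>i j. Z i \<noteq> X j"
    and eq: "\<And>\<tau>. (\<Sum>i\<in>UNIV. a i / (Z i - X \<tau>)) = 0"
  shows "a i = 0"
proof -
  define P where "P = (\<Sum>i\<in>UNIV. smult (a i) (\<Prod>j\<in>UNIV - {i}. [:Z j, -1:]))"
  have poly_P: "poly P x = (\<Sum>i\<in>UNIV. a i * (\<Prod>j\<in>UNIV - {i}. Z j - x))" for x
    by (simp add: P_def poly_sum poly_prod)
  have "degree P \<le> CARD('r) - 1"
    unfolding P_def
  proof (rule degree_sum_le)
    fix i :: 'r
    have "degree (\<Prod>j\<in>UNIV - {i}. [:Z j, -1:]) \<le> (\<Sum>j\<in>UNIV - {i}. 1)"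
      by (rule order.trans[OF degree_prod_sum_le]) (auto intro: sum_mono)
    thus "degree (smult (a i) (\<Prod>j\<in>UNIV - {i}. [:Z j, -1:])) \<le> CARD('r) - 1"
      by (intro order.trans[OF degree_smult_le]) (simp add: card_Diff_singleton)
  qed simp
  hence deg: "degree P < card (range X)"
    using X by (simp add: card_image) (metis One_nat_def Suc_pred finite_UNIV_card_ge_0 finite less_Suc_eq_le)
  have "poly P (X \<tau>) = 0" for \<tau>
  proof -
    have "a i * (\<Prod>j\<in>UNIV - {i}. Z j - X \<tau>) = (\<Prod>j\<in>UNIV. Z j - X \<tau>) * (a i / (Z i - X \<tau>))" for i
    proof -
      have "(\<Prod>j\<in>UNIV. Z j - X \<tau>) = (Z i - X \<tau>) * (\<Prod>j\<in>UNIV - {i}. Z j - X \<tau>)"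
        by (rule prod.remove) auto
      thus ?thesis using ZX[of i \<tau>] by simp
    qed
    hence "poly P (X \<tau>) = (\<Prod>j\<in>UNIV. Z j - X \<tau>) * (\<Sum>i\<in>UNIV. a i / (Z i - X \<tau>))"
      by (simp add: poly_P sum_distrib_left)
    thus ?thesis using eq by simp
  qed
  hence "P = 0"
    using deg by (intro poly_eqI_degree[of "range X"]) auto
  hence "0 = poly P (Z i)" by simp
  also have "\<dots> = (\<Sum>k\<in>UNIV. if k = i then a i * (\<Prod>j\<in>UNIV - {i}. Z j - Z i) else 0)"
    unfolding poly_P by (intro sum.cong refl) auto
  also have "\<dots> = a i * (\<Prod>j\<in>UNIV - {i}. Z j - Z i)" by simp
  finally show ?thesis using Z by (auto simp: inj_def)
qed

text \<open>On the line from y to x0 the function is a univariate polynomial, nonzero at parameter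
  1, so it has finitely many roots and arbitrarily small parameters avoid them.\<close>

lemma polynomial_nonzero_dense:
  fixes f :: "'a::euclidean_space \<Rightarrow> real"
  assumes f: "real_polynomial_function f" and x0: "f x0 \<noteq> 0"
  shows "closure {x. f x \<noteq> 0} = UNIV"
proof -
  have "\<exists>x\<in>{x. f x \<noteq> 0}. dist x y < e" if "e > 0" for y e
  proof -
    define g where "g t = f (y + t *\<^sub>R (x0 - y))" for t
    have "real_polynomial_function (f \<circ> (\<lambda>t. y + t *\<^sub>R (x0 - y)))"
      by (intro real_polynomial_function_compose[OF _ f] polynomial_function_add polynomial_function_const
          polynomial_function_mult polynomial_function_id)
    then obtain a n where a: "g = (\<lambda>t. \<Sum>i\<le>n. a i * t ^ i)"
      unfolding g_def o_def real_polynomial_function_iff_sum by blast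
    have "g 1 \<noteq> 0" using x0 by (simp add: g_def)
    hence "\<exists>i\<le>n. a i \<noteq> 0" unfolding a by (auto intro: ccontr)
    hence fin: "finite {t. g t = 0}" unfolding a polyfun_finite_roots .
    define d where "d = e / (1 + norm (x0 - y))"
    have "d > 0" using \<open>e > 0\<close> by (simp add: d_def add_pos_nonneg)
    hence "infinite {0<..<d}" by simp
    hence "\<not> {0<..<d} \<subseteq> {t. g t = 0}" using fin finite_subset by blast
    then obtain t where "t \<in> {0<..<d}" "g t \<noteq> 0" by blast
    hence t: "0 < t" "t < d" "g t \<noteq> 0" by simp_all
    have "dist (y + t *\<^sub>R (x0 - y)) y = t * norm (x0 - y)"
      using t by (simp add: dist_norm)
    also have "\<dots> \<le> t * (1 + norm (x0 - y))" using t by simp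
    also have "\<dots> < d * (1 + norm (x0 - y))" using t by (intro mult_strict_right_mono) (simp_all add: add_pos_nonneg)
    also have "\<dots> = e" by (simp add: d_def add_nonneg_eq_0_iff)
    finally show ?thesis using t by (auto simp: g_def)
  qed
  thus ?thesis by (auto simp: closure_approachable)
qed

text \<open>Phrased for the left kernel because a linear relation between differentials is a
  relation between rows of the Jacobian.\<close>

lemma invertible_iff_ker:
  "invertible (A :: real^'m::finite^'m) \<longleftrightarrow> (\<forall>x. (\<forall>q. (\<Sum>p\<in>UNIV. x $ p * A $ p $ q) = 0) \<longrightarrow> x = 0)"
proof -
  have "invertible A \<longleftrightarrow> invertible (transpose A)"
    by (simp add: invertible_det_nz)
  also have "\<dots> \<longleftrightarrow> (\<forall>x. transpose A *v x = 0 \<longrightarrow> x = 0)"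
    by (simp add: invertible_left_inverse matrix_left_invertible_ker)
  finally show ?thesis
    by (simp add: vec_eq_iff matrix_vector_mult_def transpose_def mult.commute)
qed

lemma dlax_at_scaleR: "dlax l z (t *\<^sub>R \<Phi>) v = t *\<^sub>R dlax l z \<Phi> v"
  by (simp add: dlax_def vec_eq_iff algebra_simps sum_distrib_left)

text \<open>To first order at \<open>t = 0\<close> only the quadratic part of \<open>tr L\<^sup>2\<^sup>h\<close> contributes, which pairs the row
  \<open>0\<close> with the row \<open>2h\<close>.\<close>

lemma trace_mpow_lax_zero_dlax:
  fixes \<Phi>0 :: "('n::finite, 'r::finite) phase"
  assumes "odd m"
  defines "\<Phi>0 \<equiv> axis 0 (\<chi> \<sigma>. 1)"
  shows "trace (mpow (lax l z (0 :: ('n, 'r) phase)) m ** dlax l z \<Phi>0 (axis \<kappa> (axis \<tau> 1))) =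
    (if \<kappa> = of_nat (Suc m) then 2 * pole (of_nat m :: 'n bit0) z (l \<tau>) else 0)"
proof -
  define M where "M = (of_nat m :: 'n bit0)"
  have "lax l z (0 :: ('n, 'r) phase) $ j $ k = (if k = j + 1 then 1 else 0)" for j k
    by (simp add: lax_def)
  from mpow_weighted_shift[where g = "\<lambda>_. 1", OF this]
  have m: "mpow (lax l z (0 :: ('n, 'r) phase)) m $ j $ k = (if k = j + M then 1 else 0)" for j k
    by (simp add: M_def)
  have sw: "j + M = \<kappa> \<and> 1 - j = 0 \<longleftrightarrow> j = 1 \<and> \<kappa> = M + 1"
    "j + M = 0 \<and> 1 - j = \<kappa> \<longleftrightarrow> j = - M \<and> \<kappa> = M + 1" for j
  proof -
    have "j + M = 0 \<longleftrightarrow> j = - M" "1 - j = 0 \<longleftrightarrow> j = 1"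
      using eq_neg_iff_add_eq_0[of j M] by auto
    thus "j + M = \<kappa> \<and> 1 - j = 0 \<longleftrightarrow> j = 1 \<and> \<kappa> = M + 1"
      "j + M = 0 \<and> 1 - j = \<kappa> \<longleftrightarrow> j = - M \<and> \<kappa> = M + 1"
      by (auto simp: add.commute)
  qed
  \<comment> \<open>As m is odd, the signs at \<open>j = 1\<close> and \<open>j = - M\<close> are
    both 1, so the two diagonal entries add instead of cancelling.\<close>
  have altM: "alt (1 + M) = (1 :: real)"
    using assms(1) alt_of_nat[of "Suc m", where 'n = 'n and 'a = real] by (simp add: M_def)
  have D: "dlax l z \<Phi>0 (axis \<kappa> (axis \<tau> 1)) $ (j + M) $ j = pole M z (l \<tau>) *
      ((if j = 1 then 1 else 0) * (if \<kappa> = M + 1 then 1 else 0) +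
       (if j = - M then 1 else 0) * (if \<kappa> = M + 1 then 1 else 0)) * alt (1 - j)" for j
  proof -
    have "dlax l z \<Phi>0 (axis \<kappa> (axis \<tau> 1)) $ (j + M) $ j = (\<Sum>\<sigma>\<in>UNIV. (if \<sigma> = \<tau> then 1 else 0) *
       (pole M z (l \<sigma>) * ((if j + M = \<kappa> \<and> 1 - j = 0 then 1 else 0) + (if j + M = 0 \<and> 1 - j = \<kappa> then 1 else 0)) * alt (1 - j)))"
      unfolding dlax_def vec_lambda_beta \<Phi>0_def by (intro sum.cong refl) (auto simp: axis_def)
    thus ?thesis unfolding sum_UNIV_delta_mult sw by (auto)
  qed
  have "trace (mpow (lax l z (0 :: ('n, 'r) phase)) m ** dlax l z \<Phi>0 (axis \<kappa> (axis \<tau> 1))) =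
    (\<Sum>j\<in>UNIV. \<Sum>k\<in>UNIV. (if k = j + M then 1 else 0) * dlax l z \<Phi>0 (axis \<kappa> (axis \<tau> 1)) $ k $ j)"
    by (simp add: trace_def matrix_matrix_mult_def m)
  also have "\<dots> = (\<Sum>j\<in>UNIV. dlax l z \<Phi>0 (axis \<kappa> (axis \<tau> 1)) $ (j + M) $ j)"
    by (simp only: sum_UNIV_delta_mult)
  also have "\<dots> = (\<Sum>j\<in>(UNIV :: 'n bit0 set). (if j = 1 then 1 else 0) * (pole M z (l \<tau>) * (if \<kappa> = M + 1 then 1 else 0) * alt (1 - j))) +
      (\<Sum>j\<in>UNIV. (if j = - M then 1 else 0) * (pole M z (l \<tau>) * (if \<kappa> = M + 1 then 1 else 0) * alt (1 - j)))"
    by (subst sum.distrib[symmetric]) (rule sum.cong[OF refl], simp add: D algebra_simps)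
  also have "\<dots> = (if \<kappa> = M + 1 then 2 * pole M z (l \<tau>) else 0)"
    unfolding sum_UNIV_delta_mult using altM by auto
  finally show ?thesis by (simp add: M_def add.commute)
qed

lemma power_inj_pos:
  fixes x y :: real
  assumes "0 < k" "x > 0" "y > 0" "x ^ k = y ^ k"
  shows "x = y"
  using assms power_eq_imp_eq_base[of x k y] by simp

lemma spectral_parameters_exist:
  fixes l :: "'r::finite \<Rightarrow> real"
  obtains z :: "'k::finite \<Rightarrow> real" where "\<And>p. z p > 0" "inj z" "\<And>p \<sigma>. \<bar>l \<sigma>\<bar> < z p"
proof -
  obtain g :: "'k \<Rightarrow> nat" where g: "inj g"
    using finite_imp_inj_to_nat_seg[of "UNIV :: 'k set"] by auto
  \<comment> \<open>The constant part exceeds every eigenvalue in absolute value, which keeps the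
    2n-th powers off the poles; positivity and the injective offset keep them apart from each
    other.\<close>
  define z where "z p = 1 + (\<Sum>\<sigma>\<in>UNIV. \<bar>l \<sigma>\<bar>) + real (g p)" for p
  have lt: "\<bar>l \<sigma>\<bar> < z p" for \<sigma> p
  proof -
    have "\<bar>l \<sigma>\<bar> \<le> (\<Sum>\<sigma>\<in>UNIV. \<bar>l \<sigma>\<bar>)"
      by (rule member_le_sum) auto
    thus ?thesis unfolding z_def using of_nat_0_le_iff[of "g p", where 'a = real] by linarith
  qed
  have "z p > 0" for p using lt[of undefined p] by linarith
  moreover have "inj z" using g by (auto simp: inj_def z_def)
  ultimately show ?thesis using lt that by blast
qed

text \<open>The integrals are fixed once for all Hamiltonians; only their commutation with H has to
  be supplied. The condition \<open>w > 0\<close> excludes the spectral point 0 of the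
  t-flow.\<close>

lemma liouville_integrableI:
  fixes l :: "'r::finite \<Rightarrow> real" and M :: "('n::finite, 'r) phase set"
  assumes l0: "\<And>\<sigma>. l \<sigma> \<noteq> 0" and inj: "inj (\<lambda>\<sigma>. (l \<sigma>)\<^sup>2)"
    and smooth: "smooth_on M H"
    and comm: "\<And>w k \<Phi>. \<Phi> \<in> M \<Longrightarrow> w > 0 \<Longrightarrow> (\<And>\<sigma>. w ^ (2 * CARD('n)) \<noteq> l \<sigma> ^ (2 * CARD('n))) \<Longrightarrow>
      poisson (tr_lax l w k) H \<Phi> = 0"
  shows "liouville_integrable M H"
proof -
  define N where "N = 2 * CARD('n)"
  have N0: "N > 0" by (simp add: N_def)
  have opM: "open M" using smooth by (simp add: smooth_on_def)
  obtain z :: "'n \<times> 'r \<Rightarrow> real" where z: "\<And>p. z p > 0" "inj z" "\<And>p \<sigma>. \<bar>l \<sigma>\<bar> < z p"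
    using spectral_parameters_exist by blast
  have zl: "z p ^ N \<noteq> l \<sigma> ^ N" for p \<sigma>
  proof -
    have "\<bar>l \<sigma>\<bar> ^ N < z p ^ N" using z(3) N0 by (intro power_strict_mono) auto
    moreover have "\<bar>l \<sigma>\<bar> ^ N = l \<sigma> ^ N" by (simp add: N_def power_even_abs)
    ultimately show ?thesis by simp
  qed
  have zz: "z p ^ N \<noteq> z q ^ N" if "p \<noteq> q" for p q
    using that z(1,2) N0 power_inj_pos by (metis injD)
  have lN: "inj (\<lambda>\<sigma>. l \<sigma> ^ N)"
  proof (rule injI)
    fix \<sigma> \<tau> assume "l \<sigma> ^ N = l \<tau> ^ N"
    hence "((l \<sigma>)\<^sup>2) ^ CARD('n) = ((l \<tau>)\<^sup>2) ^ CARD('n)" by (simp add: N_def power_mult)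
    hence "(l \<sigma>)\<^sup>2 = (l \<tau>)\<^sup>2" using l0 by (rule_tac power_eq_imp_eq_base[of _ "CARD('n)"]) auto
    thus "\<sigma> = \<tau>" using inj by (simp add: inj_def)
  qed
  \<comment> \<open>\<open>h\<close> labels the exponents 2, 4, ..., 2n. Modulo 2n they still name n
    different rows, with 2n becoming row 0.\<close>
  obtain h :: "'n \<Rightarrow> nat" where h: "bij_betw h UNIV {1..CARD('n)}"
    using finite_same_card_bij[of "UNIV :: 'n set" "{1..CARD('n)}"] by auto
  have h_range: "1 \<le> h i" "h i \<le> CARD('n)" for i
    using bij_betw_apply[OF h, of i] by simp_all
  have h_inj: "(of_nat (2 * h i) :: 'n bit0) = of_nat (2 * h k) \<longleftrightarrow> i = k" for i k
  proof -
    have eq: "(of_nat (2 * h i) :: 'n bit0) = of_nat (2 * h k) \<longleftrightarrow>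
        (h i) mod CARD('n) = (h k) mod CARD('n)"
      by (simp only: of_nat_bit0_eq_iff) simp
    have "h i = h k" if "h i mod CARD('n) = h k mod CARD('n)"
    proof -
      have md: "(a mod CARD('n) = 0 \<and> a = CARD('n)) \<or> (a mod CARD('n) = a \<and> a < CARD('n))"
        if "1 \<le> a" "a \<le> CARD('n)" for a
        using that by (cases "a = CARD('n)") auto
      show ?thesis using md[OF h_range, of i] md[OF h_range, of k] that h_range(1)[of i] h_range(1)[of k] by linarith
    qed
    moreover have "i = k" if "h i = h k" using that h by (auto simp: bij_betw_def inj_def)
    ultimately show ?thesis using eq by auto
  qed
  define G :: "'n \<times> 'r \<Rightarrow> ('n, 'r) phase \<Rightarrow> real" where "G p = tr_lax l (z p) (2 * h (fst p))" for p
  \<comment> \<open>Test directions: to first order at the origin the exponent 2h sees only row 2h,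
    so these rows with all columns give a square minor of size nr.\<close>
  define v :: "'n \<times> 'r \<Rightarrow> ('n, 'r) phase" where "v q = axis (of_nat (2 * h (fst q))) (axis (snd q) 1)" for q
  define J where "J \<Phi> = (\<chi> p q. frechet_derivative (G p) (at \<Phi>) (v q))" for \<Phi> :: "('n, 'r) phase"
  define \<Phi>0 :: "('n, 'r) phase" where "\<Phi>0 = axis 0 (\<chi> \<sigma>. 1)"
  define E where "E t = (\<chi> p q. real (2 * h (fst p)) *
      trace (mpow (lax l (z p) (t *\<^sub>R \<Phi>0)) (2 * h (fst p) - 1) ** dlax l (z p) \<Phi>0 (v q)))" for t :: real

  \<comment> \<open>The Jacobian vanishes at the origin; splitting off t leaves a matrix that can be
    evaluated at t = 0.\<close>
  have JE: "J (t *\<^sub>R \<Phi>0) = t *\<^sub>R E t" for t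
    by (simp add: J_def G_def E_def frechet_derivative_tr_lax vec_eq_iff dlax_at_scaleR
        trace_def matrix_matrix_mult_def sum_distrib_left algebra_simps)
  have E0: "E 0 $ p $ q = (if fst p = fst q then real (4 * h (fst p)) *
      (l (snd q) ^ (2 * h (fst p) - 1) * (z p ^ (N - 2 * h (fst p)) / (z p ^ N - l (snd q) ^ N))) else 0)" for p q
  proof -
    define m where "m = 2 * h (fst p) - 1"
    have m: "odd m" "Suc m = 2 * h (fst p)" "m < N" using h_range[of "fst p"] by (auto simp: m_def N_def)
    have "rep (of_nat m :: 'n bit0) = m" using m(3) by (simp add: rep_of_nat N_def)
    hence "pole (of_nat m :: 'n bit0) (z p) (l (snd q)) =
        l (snd q) ^ m * (z p ^ (N - Suc m) / (z p ^ N - l (snd q) ^ N))"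
      by (simp add: pole_def N_def)
    moreover have "(of_nat (2 * h (fst q)) = (of_nat (Suc m) :: 'n bit0)) = (fst p = fst q)"
      unfolding m(2) h_inj by auto
    ultimately show ?thesis
      unfolding E_def vec_lambda_beta m_def[symmetric] v_def \<Phi>0_def scaleR_zero_left
      by (subst trace_mpow_lax_zero_dlax[OF m(1)]) (use m(2) in simp)
  qed
  \<comment> \<open>Blocks are indexed by the exponent. Inside a block, the powers of z and of the
    eigenvalues only rescale the rows and columns of a Cauchy matrix by nonzero factors.\<close>
  have "invertible (E 0)" unfolding invertible_iff_ker
  proof (intro allI impI)
    fix x assume x: "\<forall>q. (\<Sum>p\<in>UNIV. x $ p * E 0 $ p $ q) = 0"
    have "x $ (b, i) = 0" for b i
    proof -
      define a where "a i = x $ (b, i) * z (b, i) ^ (N - 2 * h b)" for i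
      have "(\<Sum>i\<in>UNIV. a i / (z (b, i) ^ N - l \<tau> ^ N)) = 0" for \<tau>
      proof -
        have "0 = (\<Sum>p\<in>UNIV. x $ p * E 0 $ p $ (b, \<tau>))" using x by simp
        also have "\<dots> = (\<Sum>c\<in>UNIV. \<Sum>i\<in>UNIV. x $ (c, i) * E 0 $ (c, i) $ (b, \<tau>))"
          by (simp add: sum.cartesian_product)
        also have "\<dots> = (\<Sum>c\<in>UNIV. (if c = b then 1 else 0) *
            (real (4 * h b) * l \<tau> ^ (2 * h b - 1) * (\<Sum>i\<in>UNIV. a i / (z (b, i) ^ N - l \<tau> ^ N))))"
          by (intro sum.cong refl) (simp add: E0 a_def sum_distrib_left mult_ac)
        also have "\<dots> = real (4 * h b) * l \<tau> ^ (2 * h b - 1) * (\<Sum>i\<in>UNIV. a i / (z (b, i) ^ N - l \<tau> ^ N))"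
          by (rule sum_UNIV_delta_mult)
        finally show ?thesis using l0[of \<tau>] h_range(1)[of b] by simp
      qed
      moreover have "inj (\<lambda>i. z (b, i) ^ N)"
        using zz by (meson injI prod.inject)
      ultimately have "a i = 0"
        by (intro cauchy_matrix_kernel[of "\<lambda>i. z (b, i) ^ N" "\<lambda>\<tau>. l \<tau> ^ N" a])
          (use zl lN in auto)
      thus ?thesis using z(1)[of "(b, i)"] by (simp add: a_def)
    qed
    thus "x = 0" by (simp add: vec_eq_iff)
  qed
  hence dE: "det (E 0) \<noteq> 0" by (simp add: invertible_det_nz)
  \<comment> \<open>Continuity carries invertibility of E from t = 0, where J itself vanishes, to
    some nonzero t.\<close>
  have "continuous_on UNIV (\<lambda>t. det (E t))"
  proof -
    have cont: "continuous_on UNIV (\<lambda>t :: real. mpow (lax l (z p) (t *\<^sub>R \<Phi>0)) m $ j $ k)" for p m j k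
      by (rule continuous_on_compose2[OF continuous_real_polynomial_function[OF polynomial_mpow_lax_nth]])
        (auto intro!: continuous_intros)
    thus ?thesis
      unfolding det_def E_def vec_lambda_beta trace_def matrix_matrix_mult_def
      by (intro continuous_on_sum continuous_on_prod continuous_on_mult continuous_on_const cont)
  qed
  hence "(\<lambda>t. det (E t)) \<midarrow>0\<rightarrow> det (E 0)"
    by (simp add: continuous_on_eq_continuous_at isCont_def)
  hence "eventually (\<lambda>t. det (E t) \<noteq> 0) (at 0)"
    using dE by (rule tendsto_imp_eventually_ne)
  hence "\<exists>t. t \<noteq> 0 \<and> det (E t) \<noteq> 0"
    using eventually_conj[OF _ eventually_neq_at_within[of 0 0 UNIV]] eventually_happens'[of "at (0::real)"]
    by (smt (verit) at_neq_bot)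
  then obtain t where t: "t \<noteq> 0" "det (E t) \<noteq> 0" by blast
  have J0: "det (J (t *\<^sub>R \<Phi>0)) \<noteq> 0"
    using t unfolding JE by (metis invertible_det_nz scalar_invertible)
  have polyJ: "real_polynomial_function (\<lambda>\<Phi>. det (J \<Phi>))"
    unfolding det_def J_def vec_lambda_beta G_def
    by (intro real_polynomial_function_sum real_polynomial_function_prod real_polynomial_function.intros(2,4)
        polynomial_frechet_derivative_tr_lax) (simp_all add: finite_permutations)
  obtain e :: "nat \<Rightarrow> 'n \<times> 'r" where e: "bij_betw e {..<CARD('n) * CARD('r)} UNIV"
    using finite_same_card_bij[of "{..<CARD('n) * CARD('r)}" "UNIV :: ('n \<times> 'r) set"] by auto
  define U where "U = M \<inter> {\<Phi>. det (J \<Phi>) \<noteq> 0}"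
  have "open {\<Phi>. det (J \<Phi>) \<noteq> 0}"
    by (intro open_Collect_neq continuous_intros continuous_real_polynomial_function[OF polyJ])
  hence opU: "open U" using opM by (simp add: U_def open_Int)
  have dense: "M \<subseteq> closure U"
    using open_Int_closure_subset[OF opM, of "{\<Phi>. det (J \<Phi>) \<noteq> 0}"]
      polynomial_nonzero_dense[OF polyJ J0] by (simp add: U_def)
  have indep: "functionally_independent_at (CARD('n) * CARD('r)) (\<lambda>i. G (e i)) \<Phi>" if "\<Phi> \<in> U" for \<Phi>
    unfolding functionally_independent_at_def
  proof (intro allI impI)
    fix c :: "nat \<Rightarrow> real" and i
    assume c: "\<forall>v. (\<Sum>i<CARD('n) * CARD('r). c i * frechet_derivative (G (e i)) (at \<Phi>) v) = 0"
      and i: "i < CARD('n) * CARD('r)"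
    define x where "x = (\<chi> p. c (the_inv_into {..<CARD('n) * CARD('r)} e p))"
    have xe: "x $ e i = c i" if "i < CARD('n) * CARD('r)" for i
      using that e by (simp add: x_def the_inv_into_f_f bij_betw_def)
    have "invertible (J \<Phi>)" using that by (simp add: U_def invertible_det_nz)
    moreover have "(\<Sum>p\<in>UNIV. x $ p * J \<Phi> $ p $ q) = 0" for q
    proof -
      have "(\<Sum>p\<in>UNIV. x $ p * J \<Phi> $ p $ q) = (\<Sum>i<CARD('n) * CARD('r). x $ e i * J \<Phi> $ e i $ q)"
        by (rule sum.reindex_bij_betw[OF e, symmetric])
      also have "\<dots> = (\<Sum>i<CARD('n) * CARD('r). c i * frechet_derivative (G (e i)) (at \<Phi>) (v q))"
        by (intro sum.cong refl) (simp add: xe J_def)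
      finally show ?thesis using c by simp
    qed
    ultimately have "x = 0" unfolding invertible_iff_ker by blast
    thus "c i = 0" using xe[OF i] by simp
  qed
  \<comment> \<open>Different labels have different spectral parameters, also when the exponents
    agree; equal labels are covered by antisymmetry.\<close>
  have invol: "poisson (G p) (G q) \<Phi> = 0" for p q \<Phi>
  proof (cases "p = q")
    case True
    thus ?thesis by (simp add: poisson_self)
  next
    case False
    have "odd (2 * h (fst q) - 1)" "Suc (2 * h (fst q) - 1) = 2 * h (fst q)"
      using h_range(1)[of "fst q"] by auto
    thus ?thesis
      using poisson_tr_lax[of "z q" "z p" l "2 * h (fst q) - 1" "2 * h (fst p)" \<Phi>] zz[of q p] zl False
      by (simp add: G_def N_def)
  qed
  show ?thesis
    unfolding liouville_integrable_def
  proof (intro conjI exI[of _ "\<lambda>i. G (e i)"] allI impI ballI exI[of _ U])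
    show "smooth_on M (G (e i))" for i
      unfolding G_def by (intro smooth_on_elementary opM elementary_polynomial polynomial_tr_lax)
    show "poisson (G (e i)) H \<Phi> = 0" if "\<Phi> \<in> M" for i \<Phi>
      unfolding G_def using that z(1) zl by (intro comm) (auto simp: N_def)
  qed (use smooth opU dense indep invol in \<open>auto simp: U_def\<close>)
qed

section \<open>The complex Lax matrix at zero and at infinity\<close>

definition om :: "'n::finite bit0 \<Rightarrow> complex" where
  "om j = ((rho CARD('n))\<^sup>2) ^ rep j"

lemma rho_square: "(rho n)\<^sup>2 = exp (2 * of_real pi * \<i> * of_nat 1 / of_nat (2 * n))"
  by (simp add: rho_def power2_eq_square mult.commute flip: exp_add)

lemma rho_square_power: "n > 0 \<Longrightarrow> ((rho n)\<^sup>2) ^ (2 * n) = 1"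
  unfolding rho_square by (rule complex_root_unity) simp

lemma rho_nonzero [simp]: "rho n \<noteq> 0"
  by (simp add: rho_def)

lemma om_of_nat: "om (of_nat m :: 'n::finite bit0) = ((rho CARD('n))\<^sup>2) ^ m"
proof -
  have "((rho CARD('n))\<^sup>2) ^ m = ((rho CARD('n))\<^sup>2) ^ (2 * CARD('n) * (m div (2 * CARD('n))) + m mod (2 * CARD('n)))"
    by simp
  also have "\<dots> = ((rho CARD('n))\<^sup>2) ^ (m mod (2 * CARD('n)))"
    unfolding power_add power_mult[of _ "2 * CARD('n)"] by (simp add: rho_square_power)
  finally show ?thesis by (simp add: om_def rep_of_nat)
qed

lemma om_add: "om (j + k :: 'n::finite bit0) = om j * om k"
proof -
  have "j + k = of_nat (rep j + rep k)" by simp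
  hence "om (j + k) = ((rho CARD('n))\<^sup>2) ^ (rep j + rep k)" by (simp only: om_of_nat)
  thus ?thesis by (simp add: om_def power_add)
qed

lemma om_0 [simp]: "om 0 = 1"
  using om_of_nat[of 0] by simp

lemma om_nonzero [simp]: "om j \<noteq> 0"
  by (simp add: om_def)

lemma om_eq_1_iff: "om (p :: 'n::finite bit0) = 1 \<longleftrightarrow> p = 0"
proof
  assume "om p = 1"
  hence "exp (2 * of_real pi * \<i> * of_nat (rep p) / of_nat (2 * CARD('n))) = 1"
    by (simp add: om_def rho_square flip: exp_of_nat_mult) (simp add: algebra_simps)
  hence "2 * CARD('n) dvd rep p"
    by (subst (asm) complex_root_unity_eq_1) (simp_all add: Suc_le_eq)
  hence "rep p = 0" using rep_less[of p] by (auto dest: dvd_imp_le)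
  thus "p = 0" using of_nat_rep[of p] by simp
qed simp

lemma sum_om_power:
  "(\<Sum>\<alpha> = 1..2 * CARD('n). om (p :: 'n::finite bit0) ^ \<alpha>) = (if p = 0 then of_nat (2 * CARD('n)) else 0)"
proof (cases "p = 0")
  case False
  have "(x ^ a) ^ b = (x ^ b) ^ a" for x :: complex and a b
    by (metis power_mult mult.commute)
  hence "om p ^ (2 * CARD('n)) = ((rho CARD('n))\<^sup>2 ^ (2 * CARD('n))) ^ rep p"
    unfolding om_def .
  hence one: "om p ^ (2 * CARD('n)) = 1" by (simp add: rho_square_power)
  have "(\<Sum>\<alpha> = 1..2 * CARD('n). om p ^ \<alpha>) = om p * (\<Sum>\<alpha><2 * CARD('n). om p ^ \<alpha>)"
    by (simp add: sum_distrib_left sum.shift_bounds_Suc_ivl[symmetric] sum.atLeast1_atMost_eq)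
  also have "(\<Sum>\<alpha><2 * CARD('n). om p ^ \<alpha>) = 0"
    using False one by (subst geometric_sum) (auto simp: om_eq_1_iff)
  finally show ?thesis using False by simp
qed simp

lemma mpow_Omega: "mpow Omega \<alpha> $ j $ k =
  (if j = k then (rho CARD('n) powi (1 - 2 * int (idx (j :: 'n::finite bit0)))) ^ \<alpha> else 0)"
proof (induction \<alpha> arbitrary: j k)
  case 0
  show ?case by (simp add: mat_def)
next
  case (Suc \<alpha>)
  have "mpow Omega (Suc \<alpha>) $ j $ k = (\<Sum>i\<in>UNIV. if i = j then
      rho CARD('n) powi (1 - 2 * int (idx j)) * mpow Omega \<alpha> $ i $ k else 0)"
    unfolding mpow_nth_Suc by (intro sum.cong refl) (simp add: Omega_def)
  thus ?case by (simp add: Suc.IH)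
qed

text \<open>\<Omega> has odd powers of \<rho> as entries, but L contains them in pairs, at row j and
  at the row 1 - k that W links to column k. The product is an even power of \<rho>, hence a power
  of \<omega>.\<close>

lemma rho_powi_om:
  "rho CARD('n) powi (1 - 2 * int (idx (j :: 'n::finite bit0))) * rho CARD('n) powi (1 - 2 * int (idx (1 - k))) = om (k - j)"
proof -
  have r: "rho CARD('n) powi (1 - 2 * int (idx i)) * om i = rho CARD('n)" for i :: "'n bit0"
  proof -
    have "om i = rho CARD('n) ^ (2 * idx i)"
      using om_of_nat[where 'n = 'n, of "idx i"] unfolding of_nat_idx power_mult .
    also have "\<dots> = rho CARD('n) powi (2 * int (idx i))"
      unfolding power_int_of_nat[symmetric] by simp
    finally show ?thesis by (simp flip: power_int_add)
  qed
  have "(rho CARD('n) powi (1 - 2 * int (idx j)) * om j) * (rho CARD('n) powi (1 - 2 * int (idx (1 - k))) * om (1 - k)) =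
      (rho CARD('n))\<^sup>2"
    unfolding r by (simp add: power2_eq_square)
  also have "\<dots> = om (of_nat 1 :: 'n bit0)" by (simp only: om_of_nat power_one_right)
  also have "\<dots> = om ((k - j) + (j + (1 - k)))" by simp
  also have "\<dots> = om (k - j) * (om j * om (1 - k))" by (simp only: om_add)
  finally have "(rho CARD('n) powi (1 - 2 * int (idx j)) * rho CARD('n) powi (1 - 2 * int (idx (1 - k)))) *
      (om j * om (1 - k)) = om (k - j) * (om j * om (1 - k))"
    by (simp add: mult_ac)
  thus ?thesis by simp
qed

lemma mscale_nth: "mscale c A $ j $ k = c * A $ j $ k"
  by (simp add: mscale_def)

text \<open>An entry of the rank-one matrix \<Phi>_\<sigma> \<Phi>_\<sigma>^T W.\<close>

definition bil :: "('n::finite, 'r::finite) phase \<Rightarrow> 'r \<Rightarrow> 'n bit0 \<Rightarrow> 'n bit0 \<Rightarrow> complex" where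
  "bil \<Phi> \<sigma> j k = of_real (\<Phi> $ j $ \<sigma> * \<Phi> $ (1 - k) $ \<sigma> * alt (1 - k))"

lemma Lax_nth:
  fixes \<Phi> :: "('n::finite, 'r::finite) phase"
  shows "Lax l \<Phi> z $ j $ k = (if k = j + 1 then 1 else 0) + 1 / of_nat (2 * CARD('n)) *
    (\<Sum>\<alpha> = 1..2 * CARD('n). \<Sum>\<sigma>\<in>UNIV. 1 / (z - (rho CARD('n))\<^sup>2 ^ \<alpha> * of_real (l \<sigma>)) *
      (om (k - j) ^ \<alpha> * bil \<Phi> \<sigma> j k))"
proof -
  have E: "(mpow Omega \<alpha> ** outer (cvec (column \<sigma> \<Phi>)) ** transpose (mpow Omega \<alpha>) ** Wmat) $ j $ k =
      om (k - j) ^ \<alpha> * bil \<Phi> \<sigma> j k" for \<alpha> \<sigma>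
  proof -
    define R where "R j = (rho CARD('n) powi (1 - 2 * int (idx (j :: 'n bit0)))) ^ \<alpha>" for j
    define f where "f j = complex_of_real (\<Phi> $ j $ \<sigma>)" for j
    have 1: "(mpow Omega \<alpha> ** outer (cvec (column \<sigma> \<Phi>))) $ j $ m = R j * f j * f m" for j m
    proof -
      have "(mpow Omega \<alpha> ** outer (cvec (column \<sigma> \<Phi>))) $ j $ m = (\<Sum>i\<in>UNIV. if i = j then R j * (f i * f m) else 0)"
        unfolding matrix_matrix_mult_def vec_lambda_beta
        by (intro sum.cong refl) (simp add: mpow_Omega R_def f_def outer_def cvec_def column_def)
      thus ?thesis by simp
    qed
    have 2: "(mpow Omega \<alpha> ** outer (cvec (column \<sigma> \<Phi>)) ** transpose (mpow Omega \<alpha>)) $ j $ m = R j * f j * f m * R m" for j m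
    proof -
      have "(mpow Omega \<alpha> ** outer (cvec (column \<sigma> \<Phi>)) ** transpose (mpow Omega \<alpha>)) $ j $ m =
          (\<Sum>i\<in>UNIV. if i = m then R j * f j * f i * R m else 0)"
        by (subst matrix_matrix_mult_def, unfold vec_lambda_beta 1)
          (intro sum.cong refl, simp add: mpow_Omega R_def transpose_def)
      thus ?thesis by simp
    qed
    have "(mpow Omega \<alpha> ** outer (cvec (column \<sigma> \<Phi>)) ** transpose (mpow Omega \<alpha>) ** Wmat) $ j $ k =
        (\<Sum>m\<in>UNIV. if m = 1 - k then R j * f j * f m * R m * alt m else 0)"
    proof (subst matrix_matrix_mult_def, unfold vec_lambda_beta 2, intro sum.cong refl)
      fix m :: "'n bit0"
      have "k = 1 - m \<longleftrightarrow> m = 1 - k" by (auto simp: algebra_simps)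
      thus "R j * f j * f m * R m * Wmat $ m $ k = (if m = 1 - k then R j * f j * f m * R m * alt m else 0)"
        by (simp add: Wmat_def)
    qed
    also have "\<dots> = (R j * R (1 - k)) * (f j * f (1 - k) * alt (1 - k))" by simp
    also have "R j * R (1 - k) = om (k - j) ^ \<alpha>"
      unfolding R_def power_mult_distrib[symmetric] rho_powi_om ..
    finally show ?thesis by (simp add: bil_def f_def of_real_alt)
  qed
  show ?thesis
    by (simp add: Lax_def mscale_nth sum_component E Kmat_def)
qed

lemma sum_poles_om:
  fixes p :: "'n::finite bit0" and c :: "'r::finite \<Rightarrow> complex"
  shows "1 / of_nat (2 * CARD('n)) * (\<Sum>\<alpha> = 1..2 * CARD('n). \<Sum>\<sigma>\<in>UNIV. om p ^ \<alpha> * c \<sigma>) =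
    (if p = 0 then \<Sum>\<sigma>\<in>UNIV. c \<sigma> else 0)"
proof -
  have "(\<Sum>\<alpha> = 1..2 * CARD('n). \<Sum>\<sigma>\<in>UNIV. om p ^ \<alpha> * c \<sigma>) = (\<Sum>\<alpha> = 1..2 * CARD('n). om p ^ \<alpha>) * (\<Sum>\<sigma>\<in>UNIV. c \<sigma>)"
    by (simp only: sum_distrib_left[symmetric] sum_distrib_right[symmetric])
  thus ?thesis unfolding sum_om_power by simp
qed

lemma Lax_zero:
  fixes \<Phi> :: "('n::finite, 'r::finite) phase"
  assumes l: "\<And>\<sigma>. l \<sigma> \<noteq> 0"
  shows "Lax l \<Phi> 0 $ j $ k = (if k = j + 1 then of_real (gam l \<Phi> j) else 0)"
proof -
  have sw: "k - j - 1 = 0 \<longleftrightarrow> k = j + 1" by (auto simp: algebra_simps)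
  \<comment> \<open>At z = 0 each pole contributes a factor \<omega>^(-\<alpha>), which lowers the
    character from \<open>k - j\<close> to \<open>k - j - 1\<close>; averaging over \<alpha> then
    selects the superdiagonal.\<close>
  have "1 / (0 - (rho CARD('n))\<^sup>2 ^ \<alpha> * of_real (l \<sigma>)) * (om (k - j) ^ \<alpha> * bil \<Phi> \<sigma> j k) =
      om (k - j - 1) ^ \<alpha> * (- (bil \<Phi> \<sigma> j k / of_real (l \<sigma>)))" for \<alpha> \<sigma>
  proof -
    have o1: "om (1 :: 'n bit0) = (rho CARD('n))\<^sup>2" using om_of_nat[where 'n = 'n, of 1] by simp
    have "om (k - j - 1 + 1) = om (k - j - 1) * (rho CARD('n))\<^sup>2"
      unfolding om_add o1 ..
    hence "om (k - j) = om (k - j - 1) * (rho CARD('n))\<^sup>2" by simp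
    thus ?thesis using l[of \<sigma>] by (simp add: power_mult_distrib field_simps)
  qed
  hence "Lax l \<Phi> 0 $ j $ k = (if k = j + 1 then 1 else 0) +
      (if k = j + 1 then \<Sum>\<sigma>\<in>UNIV. - (bil \<Phi> \<sigma> j k / of_real (l \<sigma>)) else 0)"
    unfolding Lax_nth sum_poles_om[symmetric] sw[symmetric] by simp
  thus ?thesis
    by (auto simp: gam_def mom_def bil_def sum_negf sum_distrib_left power_int_minus field_simps
        of_real_alt intro!: sum.cong)
qed

lemma Lax_zero_powers:
  fixes \<Phi> :: "('n::finite, 'r::finite) phase"
  assumes l: "\<And>\<sigma>. l \<sigma> \<noteq> 0"
  shows "1 / of_nat (2 * CARD('n)) * trace (mpow (Lax l \<Phi> 0) (2 * CARD('n))) = of_real (\<Prod>k\<in>UNIV. gam l \<Phi> k)"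
    and "mpow (Lax l \<Phi> 0) (2 * CARD('n) - 1) $ j $ k * of_real (gam l \<Phi> (j - 1)) =
      (if k = j - 1 then of_real (\<Prod>k\<in>UNIV. gam l \<Phi> k) else 0)"
  using mpow_weighted_shift_card[of "Lax l \<Phi> 0" "\<lambda>j. of_real (gam l \<Phi> j)", OF Lax_zero, OF l] by simp_all

lemma gam_powr:
  fixes \<Phi> :: "('n::finite, 'r::finite) phase"
  assumes "\<Phi> \<in> gam_region l"
  shows "(\<Prod>k\<in>UNIV. gam l \<Phi> k) > 0" "(\<Prod>k\<in>UNIV. gam l \<Phi> k) powr (1 / (2 * real CARD('n))) = Gam l \<Phi>"
proof -
  have pos: "gam l \<Phi> k > 0" for k using assms by (simp add: gam_region_def)
  show "(\<Prod>k\<in>UNIV. gam l \<Phi> k) > 0" by (simp add: prod_pos pos)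
  show "(\<Prod>k\<in>UNIV. gam l \<Phi> k) powr (1 / (2 * real CARD('n))) = Gam l \<Phi>"
    unfolding Gam_def by (rule prod_powr_distrib)
qed

text \<open>On \<open>gam_region\<close> the base is a positive real, where the principal complex
  power agrees with the real one.\<close>

lemma Lax_zero_Ht:
  fixes \<Phi> :: "('n::finite, 'r::finite) phase"
  assumes l: "\<And>\<sigma>. l \<sigma> \<noteq> 0" and \<Phi>: "\<Phi> \<in> gam_region l"
  shows "- of_nat CARD('n) * (1 / of_nat (2 * CARD('n)) * trace (mpow (Lax l \<Phi> 0) (2 * CARD('n))))
    powr (1 / of_nat (2 * CARD('n))) = complex_of_real (Ht l \<Phi>)"
proof -
  have "complex_of_real (\<Prod>k\<in>UNIV. gam l \<Phi> k) powr (1 / of_nat (2 * CARD('n))) =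
      complex_of_real (\<Prod>k\<in>UNIV. gam l \<Phi> k) powr of_real (1 / (2 * real CARD('n)))"
    by simp
  also have "\<dots> = of_real (Gam l \<Phi>)"
    using gam_powr[OF \<Phi>] by (subst powr_of_real) (simp_all add: less_imp_le)
  finally show ?thesis unfolding Lax_zero_powers(1)[OF l] Ht_eq by simp
qed

lemma lax_form_t_eq:
  fixes \<Phi> :: "('n::finite, 'r::finite) phase"
  assumes l: "\<And>\<sigma>. l \<sigma> \<noteq> 0" and \<Phi>: "\<Phi> \<in> gam_region l"
  shows "cvec (column \<sigma> (t_field l \<Phi>)) = lax_form_t l \<Phi> \<sigma>"
proof -
  define P where "P = (\<Prod>k\<in>UNIV. gam l \<Phi> k)"
  have P: "P > 0" "P powr (1 / (2 * real CARD('n))) = Gam l \<Phi>"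
    using gam_powr[OF \<Phi>] by (simp_all add: P_def)
  have pos: "gam l \<Phi> k > 0" for k using \<Phi> by (simp add: gam_region_def)
  have "complex_of_real P powr (1 / of_nat (2 * CARD('n)) - 1) =
      complex_of_real P powr of_real (1 / (2 * real CARD('n)) - 1)"
    by simp
  also have "\<dots> = of_real (P powr (1 / (2 * real CARD('n)) - 1))"
    using P by (subst powr_of_real) simp_all
  also have "P powr (1 / (2 * real CARD('n)) - 1) = Gam l \<Phi> / P"
    using P by (simp add: powr_diff)
  finally have pw: "complex_of_real P powr (1 / of_nat (2 * CARD('n)) - 1) = of_real (Gam l \<Phi> / P)" .
  have "lax_form_t l \<Phi> \<sigma> $ j = cvec (column \<sigma> (t_field l \<Phi>)) $ j" for j
  proof -
    have m: "mpow (Lax l \<Phi> 0) (2 * CARD('n) - 1) $ j $ k =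
        (if k = j - 1 then of_real (P / gam l \<Phi> (j - 1)) else 0)" for k
      using Lax_zero_powers(2)[where l = l and \<Phi> = \<Phi> and j = j and k = k, OF l] pos[of "j - 1"]
      by (auto simp: P_def field_simps split: if_splits)
    have "lax_form_t l \<Phi> \<sigma> $ j = (\<Sum>k\<in>UNIV. if k = j - 1 then
        inverse (of_real (l \<sigma>)) * of_real (Gam l \<Phi> / P) * of_real (P / gam l \<Phi> (j - 1)) * of_real (\<Phi> $ k $ \<sigma>) else 0)"
      unfolding lax_form_t_def Lax_zero_powers(1)[OF l] P_def[symmetric] pw matrix_vector_mult_def vec_lambda_beta
        mscale_nth m
      by (intro sum.cong refl) (simp add: cvec_def column_def)
    also have "\<dots> = inverse (of_real (l \<sigma>)) * of_real (Gam l \<Phi> / P) * of_real (P / gam l \<Phi> (j - 1)) * of_real (\<Phi> $ (j - 1) $ \<sigma>)"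
      by (subst sum.delta) simp_all
    also have "\<dots> = of_real (t_field l \<Phi> $ j $ \<sigma>)"
      using P(1) by (simp add: t_field_nth field_simps)
    finally show ?thesis by (simp add: cvec_def column_def)
  qed
  thus ?thesis by (simp add: vec_eq_iff)
qed

section \<open>Expansion of the Lax matrix at infinity\<close>

lemma has_fps_expansion_simple_pole:
  fixes a :: complex
  shows "(\<lambda>w. w * inverse (1 - a * w)) has_fps_expansion Abs_fps (\<lambda>n. if n = 0 then 0 else a ^ (n - 1))"
proof -
  have "(\<lambda>w. w * inverse (1 - a * w)) has_fps_expansion fps_X * inverse (1 - fps_const a * fps_X)"
    by (intro fps_expansion_intros) simp
  also have "inverse (1 - fps_const a * fps_X) = Abs_fps (\<lambda>n. a ^ n)"
  proof (rule fps_inverse_unique)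
    have "Abs_fps (\<lambda>n. a ^ n) = 1 + fps_X * (fps_const a * Abs_fps (\<lambda>n. a ^ n))"
      by (auto simp: fps_eq_iff power_eq_if)
    thus "(1 - fps_const a * fps_X) * Abs_fps (\<lambda>n. a ^ n) = 1"
      by (simp add: algebra_simps)
  qed
  also have "fps_X * Abs_fps (\<lambda>n. a ^ n) = Abs_fps (\<lambda>n. if n = 0 then 0 else a ^ (n - 1))"
    by (auto simp: fps_eq_iff)
  finally show ?thesis .
qed

text \<open>The series in w = 1/z: 1/(z - a) is w/(1 - a w), a geometric series in a, and averaging
  over \<alpha> leaves only the orders in one residue class modulo 2n.\<close>

definition Lax_fps :: "('r::finite \<Rightarrow> real) \<Rightarrow> ('n::finite, 'r) phase \<Rightarrow> 'n bit0 \<Rightarrow> 'n bit0 \<Rightarrow> complex fps" where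
  "Lax_fps l \<Phi> j k = Abs_fps (\<lambda>m. if m = 0 then (if k = j + 1 then 1 else 0)
     else if k - j + of_nat (m - 1) = 0 then \<Sum>\<sigma>\<in>UNIV. of_real (l \<sigma>) ^ (m - 1) * bil \<Phi> \<sigma> j k else 0)"

lemma Lax_has_laurent_expansion:
  fixes \<Phi> :: "('n::finite, 'r::finite) phase"
  shows "(\<lambda>w. Lax l \<Phi> (inverse w) $ j $ k) has_laurent_expansion fps_to_fls (Lax_fps l \<Phi> j k)"
proof -
  define G where "G a = Abs_fps (\<lambda>n. if n = 0 then 0 else a ^ (n - 1))" for a :: complex
  define F where "F = fps_const (if k = j + 1 then 1 else 0) + fps_const (1 / of_nat (2 * CARD('n))) *
    (\<Sum>\<alpha> = 1..2 * CARD('n). \<Sum>\<sigma>\<in>UNIV. G ((rho CARD('n))\<^sup>2 ^ \<alpha> * of_real (l \<sigma>)) *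
      fps_const (om (k - j) ^ \<alpha> * bil \<Phi> \<sigma> j k))"
  have "(\<lambda>w. (if k = j + 1 then 1 else 0) + 1 / of_nat (2 * CARD('n)) *
    (\<Sum>\<alpha> = 1..2 * CARD('n). \<Sum>\<sigma>\<in>UNIV. w * inverse (1 - (rho CARD('n))\<^sup>2 ^ \<alpha> * of_real (l \<sigma>) * w) *
      (om (k - j) ^ \<alpha> * bil \<Phi> \<sigma> j k))) has_fps_expansion F"
    unfolding F_def G_def
    by (intro has_fps_expansion_add has_fps_expansion_mult has_fps_expansion_const has_fps_expansion_sum
        has_fps_expansion_simple_pole)
  hence "(\<lambda>w. (if k = j + 1 then 1 else 0) + 1 / of_nat (2 * CARD('n)) *
    (\<Sum>\<alpha> = 1..2 * CARD('n). \<Sum>\<sigma>\<in>UNIV. w * inverse (1 - (rho CARD('n))\<^sup>2 ^ \<alpha> * of_real (l \<sigma>) * w) *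
      (om (k - j) ^ \<alpha> * bil \<Phi> \<sigma> j k))) has_laurent_expansion fps_to_fls F"
    by (rule has_laurent_expansion_fps)
  also have "?this \<longleftrightarrow> (\<lambda>w. Lax l \<Phi> (inverse w) $ j $ k) has_laurent_expansion fps_to_fls F"
  \<comment> \<open>The functions are compared off w = 0 only; at w = 0 the convention
    \<open>inverse 0 = 0\<close> yields the unrelated value at z = 0.\<close>
  proof (rule has_laurent_expansion_cong[OF _ refl])
    have "w * inverse (1 - a * w) = 1 / (inverse w - a)" if "w \<noteq> 0" for w a :: complex
    proof -
      have "inverse w - a = (1 - a * w) / w" using that by (simp add: field_simps)
      thus ?thesis by (simp add: divide_inverse mult.commute)
    qed
    hence "(if k = j + 1 then 1 else 0) + 1 / of_nat (2 * CARD('n)) *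
      (\<Sum>\<alpha> = 1..2 * CARD('n). \<Sum>\<sigma>\<in>UNIV. w * inverse (1 - (rho CARD('n))\<^sup>2 ^ \<alpha> * of_real (l \<sigma>) * w) *
      (om (k - j) ^ \<alpha> * bil \<Phi> \<sigma> j k)) = Lax l \<Phi> (inverse w) $ j $ k" if "w \<noteq> 0" for w
      unfolding Lax_nth using that by simp
    thus "\<forall>\<^sub>F w in at 0. (if k = j + 1 then 1 else 0) + 1 / of_nat (2 * CARD('n)) *
      (\<Sum>\<alpha> = 1..2 * CARD('n). \<Sum>\<sigma>\<in>UNIV. w * inverse (1 - (rho CARD('n))\<^sup>2 ^ \<alpha> * of_real (l \<sigma>) * w) *
      (om (k - j) ^ \<alpha> * bil \<Phi> \<sigma> j k)) = Lax l \<Phi> (inverse w) $ j $ k"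
      using eventually_neq_at_within[of 0 0 UNIV] by (auto elim!: eventually_mono)
  qed
  also have "F = Lax_fps l \<Phi> j k"
  proof (rule fps_ext)
    fix m
    show "fps_nth F m = fps_nth (Lax_fps l \<Phi> j k) m"
    proof (cases m)
      case 0
      thus ?thesis by (simp add: F_def G_def Lax_fps_def fps_sum_nth fps_mult_right_const_nth)
    next
      case (Suc i)
      have om_i: "om (k - j + of_nat i) = om (k - j) * ((rho CARD('n))\<^sup>2) ^ i"
        by (simp only: om_add om_of_nat)
      have "fps_nth F m = 1 / of_nat (2 * CARD('n)) * (\<Sum>\<alpha> = 1..2 * CARD('n). \<Sum>\<sigma>\<in>UNIV.
          om (k - j + of_nat i) ^ \<alpha> * (of_real (l \<sigma>) ^ i * bil \<Phi> \<sigma> j k))"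
        by (simp add: F_def G_def Suc fps_sum_nth fps_mult_right_const_nth om_i power_mult_distrib
            mult_ac power_mult[symmetric])
      thus ?thesis unfolding sum_poles_om by (simp add: Lax_fps_def Suc)
    qed
  qed
  finally show ?thesis .
qed

text \<open>The factor z shifts orders by one. The guard \<open>m \<le> 1\<close> is essential, as
  \<open>nat (1 - m)\<close> would send every larger m to order 0.\<close>

lemma coeff_infinity_scaled:
  assumes "\<And>j k. (\<lambda>w. N (inverse w) $ j $ k) has_laurent_expansion fps_to_fls (F j k)"
  shows "coeff_infinity (\<lambda>z. mscale z (N z)) m = (\<chi> j k. if m \<le> 1 then fps_nth (F j k) (nat (1 - m)) else 0)"
proof -
  have "laurent_expansion (\<lambda>w. mscale (inverse w) (N (inverse w)) $ j $ k) 0 = fls_X_inv * fps_to_fls (F j k)" for j k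
  proof (rule laurent_expansion_eqI)
    show "(\<lambda>x. mscale (inverse (0 + x)) (N (inverse (0 + x))) $ j $ k) has_laurent_expansion fls_X_inv * fps_to_fls (F j k)"
      unfolding mscale_nth add_0_left
      by (intro has_laurent_expansion_mult has_laurent_expansion_fls_X_inv assms)
  qed
  thus ?thesis
    by (auto simp: coeff_infinity_def vec_eq_iff fls_X_inv_times_conv_shift)
qed

lemma plus_part_Lax:
  fixes \<Phi> :: "('n::finite, 'r::finite) phase"
  shows "plus_part (\<lambda>z. mscale z (Lax l \<Phi> z)) z $ j $ k =
    (if k = j + 1 then z else 0) + (if k = j then of_real (alt (j - 1) * mom l \<Phi> 0 j (1 - j)) else 0)"
proof -
  define C where "C = coeff_infinity (\<lambda>z. mscale z (Lax l \<Phi> z))"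
  have C: "C m = (\<chi> j k. if m \<le> 1 then fps_nth (Lax_fps l \<Phi> j k) (nat (1 - m)) else 0)" for m
    unfolding C_def by (rule coeff_infinity_scaled[OF Lax_has_laurent_expansion])
  have "plus_part (\<lambda>z. mscale z (Lax l \<Phi> z)) z = (\<Sum>m | 0 \<le> m \<and> C m \<noteq> 0. mscale (z powi m) (C m))"
    by (simp add: plus_part_def C_def)
  also have "\<dots> = (\<Sum>m \<in> {0, 1}. mscale (z powi m) (C m))"
  proof (rule sum.mono_neutral_left)
    show "{m. 0 \<le> m \<and> C m \<noteq> 0} \<subseteq> {0, 1}"
    proof
      fix m assume "m \<in> {m. 0 \<le> m \<and> C m \<noteq> 0}"
      hence "0 \<le> m" "\<not> m > 1" by (auto simp: C vec_eq_iff)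
      thus "m \<in> {0, 1}" by auto
    qed
  qed (auto simp: mscale_def vec_eq_iff)
  finally have "plus_part (\<lambda>z. mscale z (Lax l \<Phi> z)) z $ j $ k = C 0 $ j $ k + z * C 1 $ j $ k"
    by (simp add: mscale_nth)
  moreover have "C 0 $ j $ k = (if k = j then of_real (alt (j - 1) * mom l \<Phi> 0 j (1 - j)) else 0)"
    by (auto simp: C Lax_fps_def bil_def mom_def alt_diff of_real_alt sum_distrib_left sum_negf algebra_simps)
  moreover have "C 1 $ j $ k = (if k = j + 1 then 1 else 0)"
    by (simp add: C Lax_fps_def)
  ultimately show ?thesis by simp
qed

lemma lax_form_x_eq:
  fixes \<Phi> :: "('n::finite, 'r::finite) phase"
  shows "cvec (column \<sigma> (x_field l \<Phi>)) = lax_form_x l \<Phi> \<sigma>"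
proof -
  have "lax_form_x l \<Phi> \<sigma> $ j = of_real (x_field l \<Phi> $ j $ \<sigma>)" for j
  proof -
    have "lax_form_x l \<Phi> \<sigma> $ j = (\<Sum>k\<in>UNIV. (if k = j + 1 then of_real (l \<sigma>) * of_real (\<Phi> $ k $ \<sigma>) else 0)) +
       (\<Sum>k\<in>UNIV. if k = j then of_real (alt (j - 1) * mom l \<Phi> 0 j (1 - j)) * of_real (\<Phi> $ k $ \<sigma>) else 0)"
      unfolding lax_form_x_def matrix_vector_mult_def vec_lambda_beta plus_part_Lax sum.distrib[symmetric]
      by (intro sum.cong refl) (simp add: cvec_def column_def distrib_right)
    thus ?thesis by (simp add: x_field_def)
  qed
  thus ?thesis by (simp add: vec_eq_iff cvec_def column_def)
qed

lemma fps_nth_Lax_fps_012: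
  fixes \<Phi> :: "('n::finite, 'r::finite) phase"
  shows "fps_nth (Lax_fps l \<Phi> j k) 0 = (if k = j + 1 then 1 else 0)"
    and "fps_nth (Lax_fps l \<Phi> j k) 1 = (if k = j then of_real (- alt j * mom l \<Phi> 0 j (1 - j)) else 0)"
    and "fps_nth (Lax_fps l \<Phi> j k) 2 = (if j = k + 1 then of_real (alt j * mom l \<Phi> 1 j (2 - j)) else 0)"
proof -
  show "fps_nth (Lax_fps l \<Phi> j k) 0 = (if k = j + 1 then 1 else 0)"
    by (simp add: Lax_fps_def)
  show "fps_nth (Lax_fps l \<Phi> j k) 1 = (if k = j then of_real (- alt j * mom l \<Phi> 0 j (1 - j)) else 0)"
    by (auto simp: Lax_fps_def bil_def mom_def alt_diff of_real_alt sum_distrib_left sum_negf algebra_simps)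
  have sw: "k - j + 1 = 0 \<longleftrightarrow> j = k + 1" by (auto simp: algebra_simps)
  show "fps_nth (Lax_fps l \<Phi> j k) 2 = (if j = k + 1 then of_real (alt j * mom l \<Phi> 1 j (2 - j)) else 0)"
  proof (cases "j = k + 1")
    case True
    have "2 - j = 1 - k" "alt (1 - k) = (alt j :: real)" by (simp_all add: True alt_diff alt_add)
    thus ?thesis using True
      by (simp add: Lax_fps_def sw bil_def mom_def sum_distrib_left mult_ac)
  qed (simp add: Lax_fps_def sw)
qed

lemma fps_to_fls_sum: "fps_to_fls (\<Sum>i\<in>I. f i) = (\<Sum>i\<in>I. fps_to_fls (f i))" for f :: "'i \<Rightarrow> 'a::comm_ring_1 fps"
  by (induction I rule: infinite_finite_induct) simp_all

text \<open>The residue of z L^2 is the coefficient of w^2 in L^2. Products of orders 0 and 2 appear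
  in both arrangements and have the same cyclic sum, which the factor 1/2 accounts for.\<close>

lemma trace_Res_Lax_square:
  fixes \<Phi> :: "('n::finite, 'r::finite) phase"
  shows "1 / 2 * trace (Res_infinity (\<lambda>z. mscale z (mpow (Lax l \<Phi> z) 2))) = complex_of_real (Hx l \<Phi>)"
proof -
  define F where "F j k = (\<Sum>m\<in>UNIV. Lax_fps l \<Phi> j m * Lax_fps l \<Phi> m k)" for j k
  have "(\<lambda>w. mpow (Lax l \<Phi> (inverse w)) 2 $ j $ k) has_laurent_expansion fps_to_fls (F j k)" for j k
  proof -
    have "(\<lambda>w. mpow (Lax l \<Phi> (inverse w)) 2 $ j $ k) =
        (\<lambda>w. \<Sum>m\<in>UNIV. Lax l \<Phi> (inverse w) $ j $ m * Lax l \<Phi> (inverse w) $ m $ k)"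
      by (simp add: numeral_2_eq_2 fun_eq_iff) (simp add: matrix_matrix_mult_def)
    moreover have "fps_to_fls (F j k) = (\<Sum>m\<in>UNIV. fps_to_fls (Lax_fps l \<Phi> j m) * fps_to_fls (Lax_fps l \<Phi> m k))"
      by (simp add: F_def fps_to_fls_sum fls_times_fps_to_fls)
    ultimately show ?thesis
      by (simp only:) (intro has_laurent_expansion_sum has_laurent_expansion_mult Lax_has_laurent_expansion)
  qed
  from coeff_infinity_scaled[OF this, of "-1"]
  have R: "Res_infinity (\<lambda>z. mscale z (mpow (Lax l \<Phi> z) 2)) = (\<chi> j k. fps_nth (F j k) 2)"
    by (simp add: Res_infinity_def)
  define a where "a j = complex_of_real (alt j * mom l \<Phi> 1 j (2 - j))" for j
  define b where "b j = complex_of_real (mom l \<Phi> 0 j (1 - j))" for j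
  have "fps_nth (F j j) 2 = a (j + 1) + (b j)\<^sup>2 + a j" for j
  proof -
    \<comment> \<open>Three separate conditionals instead of a case distinction: for n = 1 the
      indices \<open>j + 1\<close> and \<open>j - 1\<close> coincide and both terms count.\<close>
    have "fps_nth (F j j) 2 = (\<Sum>m\<in>UNIV. (if m = j + 1 then a m else 0) + (if m = j then (b m)\<^sup>2 else 0) +
        (if m = j - 1 then a j else 0))"
      unfolding F_def fps_sum_nth
    proof (intro sum.cong refl)
      fix m :: "'n bit0"
      have "j = m + 1 \<longleftrightarrow> m = j - 1" by (auto simp: algebra_simps)
      moreover have "{0..2::nat} = {0, 1, 2}" by auto
      moreover have "(alt j * x) * (alt j * x) = x\<^sup>2" for x :: complex
        using alt_square[of j, where 'a = complex] by (simp add: power2_eq_square mult_ac flip: mult.assoc)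
      ultimately show "fps_nth (Lax_fps l \<Phi> j m * Lax_fps l \<Phi> m j) 2 =
          (if m = j + 1 then a m else 0) + (if m = j then (b m)\<^sup>2 else 0) + (if m = j - 1 then a j else 0)"
        by (auto simp: fps_mult_nth fps_nth_Lax_fps_012[unfolded One_nat_def] a_def b_def of_real_alt)
    qed
    thus ?thesis by (simp add: sum.distrib)
  qed
  hence "trace (Res_infinity (\<lambda>z. mscale z (mpow (Lax l \<Phi> z) 2))) =
      (\<Sum>j\<in>UNIV. a (j + 1)) + (\<Sum>j\<in>UNIV. (b j)\<^sup>2) + (\<Sum>j\<in>UNIV. a j)"
    by (simp add: R trace_def sum.distrib)
  also have "(\<Sum>j\<in>UNIV. a (j + 1)) = (\<Sum>j\<in>UNIV. a j)"
    by (rule sum.reindex_bij_witness[of _ "\<lambda>j. j - 1" "\<lambda>j. j + 1"]) auto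
  finally show ?thesis
    by (simp add: Hx_def a_def b_def distrib_left)
qed

section \<open>The constraint\<close>

lemma has_vector_derivative_vec_iff:
  fixes f :: "real \<Rightarrow> 'a::euclidean_space^'k::finite"
  shows "(f has_vector_derivative f') (at x) \<longleftrightarrow> (\<forall>i. ((\<lambda>s. f s $ i) has_vector_derivative f' $ i) (at x))"
proof (intro iffI allI)
  fix i assume "(f has_vector_derivative f') (at x)"
  thus "((\<lambda>s. f s $ i) has_vector_derivative f' $ i) (at x)"
    by (rule bounded_linear.has_vector_derivative[OF bounded_linear_vec_nth])
next
  assume nth: "\<forall>i. ((\<lambda>s. f s $ i) has_vector_derivative f' $ i) (at x)"
  have ax: "y = (\<Sum>i\<in>UNIV. axis i (y $ i))" for y :: "'a^'k"
  proof -
    have "axis i (y $ i) $ k = (if i = k then y $ k else 0)" for i k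
      by (simp add: axis_def)
    thus ?thesis by (simp add: vec_eq_iff)
  qed
  have "bounded_linear (axis i :: 'a \<Rightarrow> 'a^'k)" for i
    unfolding linear_conv_bounded_linear[symmetric] by (rule linearI) (simp_all add: axis_def vec_eq_iff)
  hence "((\<lambda>s. axis i (f s $ i)) has_vector_derivative (axis i (f' $ i) :: 'a^'k)) (at x)" for i
    using nth bounded_linear.has_vector_derivative by blast
  hence "((\<lambda>s. \<Sum>i\<in>UNIV. axis i (f s $ i)) has_vector_derivative (\<Sum>i\<in>UNIV. axis i (f' $ i))) (at x)"
    by (intro has_vector_derivative_sum)
  thus "(f has_vector_derivative f') (at x)" by (simp only: ax[symmetric])
qed

lemma has_vector_derivative_of_real_iff:
  "((\<lambda>s. complex_of_real (g s)) has_vector_derivative of_real g') (at x) \<longleftrightarrow> (g has_vector_derivative g') (at x)"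
  using bounded_linear.has_vector_derivative[OF bounded_linear_of_real, of g g' "at x"]
    bounded_linear.has_vector_derivative[OF bounded_linear_Re, of "\<lambda>s. complex_of_real (g s)" "of_real g'" "at x"]
  by auto

lemma has_vector_derivative_columns_iff:
  fixes f :: "real \<Rightarrow> real^'r::finite^'k::finite"
  shows "(f has_vector_derivative f') (at x) \<longleftrightarrow>
    (\<forall>\<sigma>. ((\<lambda>s. column \<sigma> (f s)) has_vector_derivative column \<sigma> f') (at x))"
  unfolding has_vector_derivative_vec_iff column_def vec_lambda_beta by blast

lemma has_vector_derivative_cvec_columns_iff:
  fixes f :: "real \<Rightarrow> real^'r::finite^'k::finite"
  shows "(f has_vector_derivative f') (at x) \<longleftrightarrow>
    (\<forall>\<sigma>. ((\<lambda>s. cvec (column \<sigma> (f s))) has_vector_derivative cvec (column \<sigma> f')) (at x))"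
  unfolding has_vector_derivative_vec_iff column_def cvec_def vec_lambda_beta has_vector_derivative_of_real_iff
  by blast

text \<open>With \<open>a k = ln \<gamma>\<^sub>k\<close> the constraint reads \<open>u\<^sub>i = toda a i\<close>; by linearity, with \<open>a k = \<gamma>\<^sub>k' / \<gamma>\<^sub>k\<close>
  this is the derivative of \<open>u\<^sub>i\<close>.\<close>

definition toda :: "('n::finite bit0 \<Rightarrow> real) \<Rightarrow> nat \<Rightarrow> real" where
  "toda a i = (real i - 1 / 2) * ((\<Sum>k\<in>UNIV. a k) / (2 * real CARD('n))) - 1 / 2 * a 0 -
     (\<Sum>k = 1..i - 1. a (of_nat k))"

lemma toda_Suc:
  assumes "1 \<le> i"
  shows "toda a (i + 1) - toda a i = (\<Sum>k\<in>UNIV. a k) / (2 * real CARD('n)) - a (of_nat i :: 'n::finite bit0)"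
proof -
  have "(\<Sum>k = 1..i. a (of_nat k)) = (\<Sum>k = 1..i - 1. a (of_nat k)) + a (of_nat i)"
    using assms by (cases i) simp_all
  moreover define A where "A = (\<Sum>k\<in>UNIV. a k) / (2 * real CARD('n))"
  ultimately show ?thesis unfolding toda_def A_def[symmetric] by (simp add: algebra_simps)
qed

lemma toda_1: "2 * toda a 1 = (\<Sum>k\<in>UNIV. a k) / (2 * real CARD('n)) - a (0 :: 'n::finite bit0)"
  by (simp add: toda_def)

text \<open>Evenness lets the partial sum be folded back to its complement in the cycle. The
  continuation of u to 2n indices is therefore odd under reflection, matching the signs in the
  second half of P.\<close>

lemma toda_reflect:
  fixes a :: "'n::finite bit0 \<Rightarrow> real"
  assumes even: "\<And>k. a (- k) = a k" and i: "1 \<le> i" "i \<le> 2 * CARD('n)"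
  shows "toda a (2 * CARD('n) + 1 - i) = - toda a i"
proof -
  have "(\<Sum>k = 1..2 * CARD('n) - i. a (of_nat k)) = (\<Sum>k = i..2 * CARD('n) - 1. a (of_nat k))"
  proof (rule sum.reindex_bij_witness[of _ "\<lambda>k. 2 * CARD('n) - k" "\<lambda>k. 2 * CARD('n) - k"])
    fix k assume "k \<in> {1..2 * CARD('n) - i}"
    hence "k \<le> 2 * CARD('n)" by auto
    hence "(of_nat (2 * CARD('n) - k) :: 'n bit0) = - of_nat k"
      by (simp add: of_nat_diff)
    thus "a (of_nat (2 * CARD('n) - k)) = a (of_nat k)" by (simp only: even)
  qed (use i in auto)
  moreover have "(\<Sum>k = 1..i - 1. a (of_nat k)) + (\<Sum>k = i..2 * CARD('n) - 1. a (of_nat k)) + a 0 = (\<Sum>k\<in>UNIV. a k)"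
  proof -
    have "(\<Sum>k\<in>UNIV. a k) = (\<Sum>k<2 * CARD('n). a (0 + of_nat k))"
      by (rule sum.reindex_bij_betw[OF bij_betw_of_nat_bit0, symmetric])
    also have "{..<2 * CARD('n)} = insert 0 ({1..i - 1} \<union> {i..2 * CARD('n) - 1})"
      using i by auto
    also have "(\<Sum>k\<in>\<dots>. a (0 + of_nat k)) = a 0 + (\<Sum>k\<in>{1..i - 1} \<union> {i..2 * CARD('n) - 1}. a (of_nat k))"
      using i by (subst sum.insert) auto
    also have "(\<Sum>k\<in>{1..i - 1} \<union> {i..2 * CARD('n) - 1}. a (of_nat k)) =
        (\<Sum>k = 1..i - 1. a (of_nat k)) + (\<Sum>k = i..2 * CARD('n) - 1. a (of_nat k))"
      by (rule sum.union_disjoint) auto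
    finally show ?thesis by simp
  qed
  moreover have "real (2 * CARD('n) + 1 - i) = 2 * real CARD('n) + 1 - real i"
    using i by (simp add: of_nat_diff)
  moreover have "2 * CARD('n) + 1 - i - 1 = 2 * CARD('n) - i" by simp
  moreover define A where "A = (\<Sum>k\<in>UNIV. a k) / (2 * real CARD('n))"
  moreover have "(\<Sum>k\<in>UNIV. a k) = 2 * real CARD('n) * A" by (simp add: A_def)
  ultimately show ?thesis
    unfolding toda_def A_def[symmetric] by (simp add: algebra_simps)
qed

text \<open>With u continued by \<open>toda\<close>, the first three clauses of \<open>qcoef\<close>
  become a difference of neighbours, using the reflection from the middle onwards, and the last
  closes the cycle. In terms of \<gamma> this reads q_k = \<Gamma> / \<gamma>_k.\<close>

lemma qcoef_toda:
  fixes a :: "'n::finite bit0 \<Rightarrow> real"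
  assumes even: "\<And>k. a (- k) = a k" and k: "1 \<le> k" "k \<le> 2 * CARD('n)"
    and v: "\<And>i. 1 \<le> i \<Longrightarrow> i \<le> CARD('n) \<Longrightarrow> v i = toda a i"
  shows "qcoef CARD('n) v k = exp ((\<Sum>k\<in>UNIV. a k) / (2 * real CARD('n)) - a (of_nat k))"
proof -
  have n: "1 \<le> CARD('n)" by (simp add: Suc_le_eq)
  consider "k < CARD('n)" | "k = CARD('n)" | "CARD('n) < k" "k < 2 * CARD('n)" | "k = 2 * CARD('n)"
    using k by linarith
  thus ?thesis
  proof cases
    case 1
    thus ?thesis using k by (simp add: qcoef_def v toda_Suc[OF k(1), symmetric])
  next
    case 2
    have "2 * CARD('n) + 1 - k = k + 1" using 2 by simp
    hence "toda a (k + 1) = - toda a k" using toda_reflect[of a, OF even k] by simp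
    moreover have "v CARD('n) = toda a k" using v[of "CARD('n)"] n 2 by simp
    ultimately have "- 2 * v CARD('n) = (\<Sum>k\<in>UNIV. a k) / (2 * real CARD('n)) - a (of_nat k)"
      using toda_Suc[OF k(1), of a] by linarith
    thus ?thesis using 2 by (simp add: qcoef_def)
  next
    case 3
    have "2 * CARD('n) + 1 - (k + 1) = 2 * CARD('n) - k" by simp
    hence "toda a (2 * CARD('n) - k) = - toda a (k + 1)"
      using toda_reflect[of a, OF even, of "k + 1"] 3 by simp
    moreover have "toda a (2 * CARD('n) + 1 - k) = - toda a k"
      using toda_reflect[of a, OF even k] by simp
    moreover have "v (2 * CARD('n) + 1 - k) = toda a (2 * CARD('n) + 1 - k)"
      "v (2 * CARD('n) - k) = toda a (2 * CARD('n) - k)"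
      using 3 by (auto intro!: v)
    ultimately show ?thesis using 3 by (simp add: qcoef_def toda_Suc[OF k(1), symmetric])
  next
    case 4
    have "v 1 = toda a 1" using n by (intro v) auto
    moreover have "(of_nat k :: 'n bit0) = 0" unfolding 4 by (rule of_nat_bit0_card)
    ultimately show ?thesis using 4 n toda_1[of a] by (simp add: qcoef_def)
  qed
qed

lemma idx_one_minus: "idx (1 - j :: 'n::finite bit0) = 2 * CARD('n) + 1 - idx j"
proof -
  have "(of_nat (idx (1 - j)) :: 'n bit0) = of_nat (2 * CARD('n) + 1 - idx j)"
    using idx_bounds[of j] by (simp add: of_nat_idx of_nat_diff)
  hence "idx (1 - j) mod (2 * CARD('n)) = (2 * CARD('n) + 1 - idx j) mod (2 * CARD('n))"
    by (simp only: of_nat_bit0_eq_iff)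
  moreover have md: "(a mod (2 * CARD('n)) = 0 \<and> a = 2 * CARD('n)) \<or> (a mod (2 * CARD('n)) = a \<and> a < 2 * CARD('n))"
    if "1 \<le> a" "a \<le> 2 * CARD('n)" for a
    using that by (cases "a = 2 * CARD('n)") auto
  ultimately show ?thesis
    using md[of "idx (1 - j)"] md[of "2 * CARD('n) + 1 - idx j"] idx_bounds[of j] idx_bounds[of "1 - j"]
    by linarith
qed

lemma idx_add_1: "idx (j + 1 :: 'n::finite bit0) = (if idx j < 2 * CARD('n) then idx j + 1 else 1)"
proof -
  have "(of_nat (idx (j + 1)) :: 'n bit0) = of_nat (idx j + 1)"
    by (simp add: of_nat_idx)
  hence mod: "idx (j + 1) mod (2 * CARD('n)) = (idx j + 1) mod (2 * CARD('n))"
    by (simp only: of_nat_bit0_eq_iff)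
  have md: "(a mod (2 * CARD('n)) = 0 \<and> a = 2 * CARD('n)) \<or> (a mod (2 * CARD('n)) = a \<and> a < 2 * CARD('n))"
    if "1 \<le> a" "a \<le> 2 * CARD('n)" for a
    using that by (cases "a = 2 * CARD('n)") auto
  have one: "(2 * CARD('n) + 1) mod (2 * CARD('n)) = 1" by (simp add: mod_Suc)
  show ?thesis
  proof (cases "idx j < 2 * CARD('n)")
    case True
    hence "(idx j + 1) mod (2 * CARD('n)) = 0 \<and> idx j + 1 = 2 * CARD('n) \<or>
        (idx j + 1) mod (2 * CARD('n)) = idx j + 1 \<and> idx j + 1 < 2 * CARD('n)"
      by (intro md) simp_all
    hence "idx (j + 1) = idx j + 1"
      using mod md[OF idx_bounds[of "j + 1"]] idx_bounds(1)[of "j + 1"] by linarith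
    thus ?thesis using True by simp
  next
    case False
    hence "idx j = 2 * CARD('n)" using idx_bounds[of j] by simp
    hence "idx (j + 1) mod (2 * CARD('n)) = 1" using mod one by simp
    hence "idx (j + 1) = 1"
      using md[OF idx_bounds[of "j + 1"]] by linarith
    thus ?thesis using False by simp
  qed
qed

lemma toda_idx_add_1:
  fixes a :: "'n::finite bit0 \<Rightarrow> real"
  assumes even: "\<And>k. a (- k) = a k"
  shows "toda a (idx (j + 1)) - toda a (idx j) = (\<Sum>k\<in>UNIV. a k) / (2 * real CARD('n)) - a j"
proof (cases "idx j < 2 * CARD('n)")
  case True
  thus ?thesis using toda_Suc[OF idx_bounds(1)[of j], of a] by (simp add: idx_add_1 of_nat_idx)
next
  case False
  hence i: "idx j = 2 * CARD('n)" using idx_bounds[of j] by simp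
  have "j = 0" using of_nat_idx[of j] unfolding i of_nat_bit0_card by simp
  hence "a j = a 0" by simp
  moreover have "toda a (2 * CARD('n)) = - toda a 1"
    using toda_reflect[of a, OF even, of 1] by (simp add: Suc_le_eq)
  moreover have "idx (j + 1) = 1" by (simp add: idx_add_1 i)
  ultimately show ?thesis using toda_1[of a] unfolding i by simp
qed

lemma toda_idx_one_minus:
  fixes a :: "'n::finite bit0 \<Rightarrow> real"
  assumes even: "\<And>k. a (- k) = a k"
  shows "toda a (idx (1 - j)) = - toda a (idx (j :: 'n bit0))"
  unfolding idx_one_minus by (rule toda_reflect[of a, OF even idx_bounds])

lemma constraint_toda:
  fixes \<Phi> :: "('n::finite, 'r::finite) phase"
  assumes \<Phi>: "\<Phi> \<in> gam_region l"
    and u: "exp v = Gam l \<Phi> powr (real j - 1 / 2) * gam l \<Phi> 0 powr (- 1 / 2) *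
      (\<Prod>k = 1..j - 1. inverse (gam l \<Phi> (of_nat k)))"
  shows "v = toda (\<lambda>k. ln (gam l \<Phi> k)) j"
proof -
  have pos: "gam l \<Phi> k > 0" for k using \<Phi> by (simp add: gam_region_def)
  hence nz: "gam l \<Phi> k \<noteq> 0" for k by (metis less_irrefl)
  have lnGam: "ln (Gam l \<Phi>) = (\<Sum>k\<in>UNIV. ln (gam l \<Phi> k)) / (2 * real CARD('n))"
  proof -
    have "ln (Gam l \<Phi>) = (\<Sum>k\<in>UNIV. ln (gam l \<Phi> k powr (1 / (2 * real CARD('n)))))"
      unfolding Gam_def using pos by (intro ln_prod) (auto simp: nz)
    also have "\<dots> = (\<Sum>k\<in>UNIV. ln (gam l \<Phi> k)) / (2 * real CARD('n))"
      unfolding sum_divide_distrib using pos by (intro sum.cong refl) (simp add: ln_powr)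
    finally show ?thesis .
  qed
  have Gpos: "Gam l \<Phi> > 0" using pos by (auto simp: Gam_def nz intro!: prod_pos)
  have ppos: "(\<Prod>k = 1..j - 1. inverse (gam l \<Phi> (of_nat k))) > 0"
    using pos by (intro prod_pos) simp
  have lnp: "ln (\<Prod>k = 1..j - 1. inverse (gam l \<Phi> (of_nat k))) = - (\<Sum>k = 1..j - 1. ln (gam l \<Phi> (of_nat k)))"
  proof -
    have "ln (\<Prod>k = 1..j - 1. inverse (gam l \<Phi> (of_nat k))) = (\<Sum>k = 1..j - 1. ln (inverse (gam l \<Phi> (of_nat k))))"
      using pos by (intro ln_prod) (auto simp: nz)
    also have "\<dots> = (\<Sum>k = 1..j - 1. - ln (gam l \<Phi> (of_nat k)))"
      using pos by (intro sum.cong refl) (simp add: ln_inverse)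
    finally show ?thesis by (simp add: sum_negf)
  qed
  have "v = ln (exp v)" by simp
  also have "\<dots> = (real j - 1 / 2) * ln (Gam l \<Phi>) + (- 1 / 2) * ln (gam l \<Phi> 0) - (\<Sum>k = 1..j - 1. ln (gam l \<Phi> (of_nat k)))"
    unfolding u using Gpos pos[of 0] ppos lnp by (simp add: ln_mult ln_powr nz)
  finally show ?thesis by (simp add: toda_def lnGam)
qed

lemma eq_if_shift_invariant_odd:
  fixes d :: "'n::finite bit0 \<Rightarrow> real"
  assumes "\<And>j. d (j + 1) = d j" and "\<And>j. d (1 - j) = - d j"
  shows "d j = 0"
proof -
  have "d (of_nat m) = d 0" for m
  proof (induction m)
    case (Suc m)
    thus ?case using assms(1)[of "of_nat m"] by (simp add: add.commute)
  qed simp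
  hence c: "d j = d 0" for j by (metis of_nat_rep)
  have "d 1 = - d 0" using assms(2)[of 0] by simp
  thus ?thesis using c[of j] c[of 1] by simp
qed

definition pcoef :: "('r::finite \<Rightarrow> real) \<Rightarrow> ('n::finite, 'r) phase \<Rightarrow> 'n bit0 \<Rightarrow> real" where
  "pcoef l \<Phi> j = alt (j - 1) * mom l \<Phi> 0 j (1 - j)"

lemma pcoef_one_minus: "pcoef l \<Phi> (1 - j) = - pcoef l \<Phi> j"
  by (simp add: pcoef_def alt_diff mom_commute[of l \<Phi> 0 "1 - j" j])

text \<open>Both the Lax equation and the reduced equation have the form below, with \<open>p\<close> equal to \<open>q\<close> or to
  \<open>pcoef\<close>; in either case the two agree because \<open>q - pcoef\<close> is constant in the index and odd.\<close>

lemma constraint_x_derivative: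
  fixes \<Phi> :: "real \<Rightarrow> ('n::finite, 'r::finite) phase"
  assumes l: "\<And>\<sigma>. l \<sigma> \<noteq> 0" and region: "\<Phi> x \<in> gam_region l"
    and der: "(\<Phi> has_vector_derivative V) (at x)"
    and V: "\<And>j \<sigma>. V $ j $ \<sigma> = l \<sigma> * \<Phi> x $ (j + 1) $ \<sigma> + p j * \<Phi> x $ j $ \<sigma>"
    and S: "open S" "x \<in> S"
    and u: "\<And>s i. s \<in> S \<Longrightarrow> 1 \<le> i \<Longrightarrow> i \<le> CARD('n) \<Longrightarrow> u i s = toda (\<lambda>k. ln (gam l (\<Phi> s) k)) i"
    and q: "\<And>j. q j = (if idx j \<le> CARD('n) then deriv (u (idx j)) x
        else - deriv (u (2 * CARD('n) + 1 - idx j)) x)"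
    and pq: "p = q \<or> p = pcoef l (\<Phi> x)"
  shows "q = pcoef l (\<Phi> x)"
proof -
  define \<gamma> where "\<gamma> = gam l (\<Phi> x)"
  define a where "a = pcoef l (\<Phi> x)"
  have pos: "\<gamma> k > 0" for k using region by (simp add: gam_region_def \<gamma>_def)
  define D where "D j = - (alt j * (\<Sum>\<sigma>\<in>UNIV. l \<sigma> powi (-1) * (V $ j $ \<sigma> * \<Phi> x $ (- j) $ \<sigma> + \<Phi> x $ j $ \<sigma> * V $ (- j) $ \<sigma>)))" for j
  define g where "g j = D j / \<gamma> j" for j
  have gam_der: "((\<lambda>s. gam l (\<Phi> s) j) has_real_derivative D j) (at x)" for j
  proof -
    have nth: "((\<lambda>s. \<Phi> s $ j $ \<sigma>) has_real_derivative V $ j $ \<sigma>) (at x)" for j \<sigma>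
      using der by (simp add: has_vector_derivative_vec_iff has_real_derivative_iff_has_vector_derivative)
    show ?thesis unfolding gam_def mom_def D_def
      by (rule derivative_eq_intros nth refl)+ (simp add: algebra_simps)
  qed
  have g_even: "g (- k) = g k" for k
    by (simp add: g_def D_def \<gamma>_def gam_minus algebra_simps)
  have u_der: "deriv (u i) x = toda g i" if "1 \<le> i" "i \<le> CARD('n)" for i
  proof (rule DERIV_imp_deriv)
    have ln_der: "((\<lambda>s. ln (gam l (\<Phi> s) k)) has_real_derivative g k) (at x)" for k
      using DERIV_ln_divide pos[of k] gam_der[of k]
      by (auto intro!: derivative_eq_intros simp: \<gamma>_def g_def)
    have "((\<lambda>s. toda (\<lambda>k. ln (gam l (\<Phi> s) k)) i) has_real_derivative toda g i) (at x)"
      unfolding toda_def by (rule derivative_eq_intros ln_der refl | simp)+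
    thus "(u i has_real_derivative toda g i) (at x)"
      by (rule has_field_derivative_transform_within_open[OF _ S]) (rule u[OF _ that, symmetric])
  qed
  have q_toda: "q j = toda g (idx j)" for j
  proof (cases "idx j \<le> CARD('n)")
    case True
    thus ?thesis using idx_bounds[of j] by (simp add: q u_der)
  next
    case False
    hence "q j = - toda g (2 * CARD('n) + 1 - idx j)"
      using idx_bounds[of j] by (simp add: q u_der)
    thus ?thesis using toda_reflect[of g, OF g_even idx_bounds, of j] by simp
  qed
  define G where "G = (\<Sum>k\<in>UNIV. g k) / (2 * real CARD('n))"
  have q_step: "q (j + 1) - q j = G - g j" for j
    unfolding q_toda G_def by (rule toda_idx_add_1[of g, OF g_even])
  have q_odd: "q (1 - j) = - q j" for j
    unfolding q_toda by (rule toda_idx_one_minus[of g, OF g_even])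
  have a_odd: "a (1 - j) = - a j" for j by (simp add: a_def pcoef_one_minus)
  have p_odd: "p (1 - j) = - p j" for j using pq q_odd a_odd by (auto simp: a_def)
  \<comment> \<open>The evolution of \<gamma>_j along V: the shift part turns \<pi> of order -1 into
    \<pi> of order 0, which yields the difference of \<open>a\<close>, and the diagonal part
    rescales 1 - \<gamma>_j. Oddness of p replaces the value at -j.\<close>
  have D_eq: "D j = a j - a (j + 1) - (p j - p (j + 1)) * (1 - \<gamma> j)" for j
  proof -
    have pm: "p (- j) = - p (j + 1)" using p_odd[of "j + 1"] by simp
    have sum_eq: "(\<Sum>\<sigma>\<in>UNIV. l \<sigma> powi (-1) * (V $ j $ \<sigma> * \<Phi> x $ (- j) $ \<sigma> + \<Phi> x $ j $ \<sigma> * V $ (- j) $ \<sigma>)) =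
        mom l (\<Phi> x) 0 (j + 1) (- j) + mom l (\<Phi> x) 0 j (1 - j) + (p j - p (j + 1)) * mom l (\<Phi> x) (-1) j (- j)"
      unfolding mom_def sum_distrib_left sum.distrib[symmetric]
    proof (intro sum.cong refl)
      fix \<sigma>
      have "- j + 1 = 1 - j" by simp
      thus "l \<sigma> powi (-1) * (V $ j $ \<sigma> * \<Phi> x $ (- j) $ \<sigma> + \<Phi> x $ j $ \<sigma> * V $ (- j) $ \<sigma>) =
        l \<sigma> powi 0 * \<Phi> x $ (j + 1) $ \<sigma> * \<Phi> x $ (- j) $ \<sigma> + l \<sigma> powi 0 * \<Phi> x $ j $ \<sigma> * \<Phi> x $ (1 - j) $ \<sigma> +
        (p j - p (j + 1)) * (l \<sigma> powi (-1) * \<Phi> x $ j $ \<sigma> * \<Phi> x $ (- j) $ \<sigma>)"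
        using l[of \<sigma>] by (simp add: V pm power_int_minus field_simps)
    qed
    have gam_eq: "1 - \<gamma> j = alt j * mom l (\<Phi> x) (-1) j (- j)" by (simp add: \<gamma>_def gam_def)
    have a_eq: "a j = - alt j * mom l (\<Phi> x) 0 j (1 - j)" "a (j + 1) = alt j * mom l (\<Phi> x) 0 (j + 1) (- j)"
      by (simp_all add: a_def pcoef_def alt_diff)
    show ?thesis unfolding D_def sum_eq gam_eq a_eq by (simp add: algebra_simps)
  qed
  have shift: "(\<Sum>j\<in>UNIV. f (j + 1)) = (\<Sum>j\<in>UNIV. f j)" for f :: "'n bit0 \<Rightarrow> real"
    by (rule sum.reindex_bij_witness[of _ "\<lambda>j. j - 1" "\<lambda>j. j + 1"]) auto
  have sum_g: "(\<Sum>k\<in>UNIV. g k) = 2 * real CARD('n) * G" by (simp add: G_def)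
  have G0: "G = 0 \<and> (\<forall>j. g j = a j - a (j + 1))"
    using pq
  proof
    assume "p = q"
    have gj: "g j = a j - a (j + 1) + G * (1 - \<gamma> j)" for j
    proof -
      have "D j = g j * \<gamma> j" using pos[of j] by (simp add: g_def)
      moreover have "D j = a j - a (j + 1) + (q (j + 1) - q j) * (1 - \<gamma> j)"
        using D_eq[of j] \<open>p = q\<close> by (simp add: algebra_simps)
      ultimately have "g j * \<gamma> j = a j - a (j + 1) + (G - g j) * (1 - \<gamma> j)"
        by (simp only: q_step)
      thus ?thesis by (simp add: algebra_simps)
    qed
    \<comment> \<open>G is the logarithmic derivative of \<Gamma>. Around the cycle the differences
      of \<open>a\<close> cancel, and so does 2n G, leaving G times the positive sum of all
      \<gamma>_j.\<close>
    have "2 * real CARD('n) * G = (\<Sum>j\<in>UNIV. a j) - (\<Sum>j\<in>UNIV. a (j + 1)) + G * (\<Sum>j\<in>UNIV. 1 - \<gamma> j)"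
      unfolding sum_g[symmetric] gj by (simp add: sum.distrib sum_subtractf flip: sum_distrib_left)
    hence "G * (\<Sum>j\<in>UNIV. \<gamma> j) = 0"
      by (simp add: shift sum_subtractf algebra_simps)
    moreover have "(\<Sum>j\<in>UNIV. \<gamma> j) > 0" using pos by (intro sum_pos) auto
    ultimately have "G = 0" by simp
    thus ?thesis using gj by simp
  next
    assume "p = pcoef l (\<Phi> x)"
    hence "D j = (a j - a (j + 1)) * \<gamma> j" for j
      using D_eq[of j] by (simp add: a_def algebra_simps)
    hence gj: "g j = a j - a (j + 1)" for j using pos[of j] by (simp add: g_def less_imp_neq[symmetric])
    have "2 * real CARD('n) * G = (\<Sum>j\<in>UNIV. a j) - (\<Sum>j\<in>UNIV. a (j + 1))"
      unfolding sum_g[symmetric] gj by (simp add: sum_subtractf)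
    thus ?thesis using gj by (simp add: shift)
  qed
  have "q j - a j = 0" for j
  proof (rule eq_if_shift_invariant_odd)
    show "q (j + 1) - a (j + 1) = q j - a j" for j
      using q_step[of j] G0 by (simp add: algebra_simps)
    show "q (1 - j) - a (1 - j) = - (q j - a j)" for j by (simp add: q_odd a_odd)
  qed
  thus ?thesis by (simp add: fun_eq_iff a_def)
qed

section \<open>Equivalence of the Lax pair with the reduced ODEs\<close>

lemma lax_x_matrix_nth:
  fixes \<Phi> :: "('n::finite, 'r::finite) phase"
  shows "((mscale c Kmat + Pmat u x t) *v column \<sigma> \<Phi>) $ j = c * \<Phi> $ (j + 1) $ \<sigma> + Pmat u x t $ j $ j * \<Phi> $ j $ \<sigma>"
proof -
  have "((mscale c Kmat + Pmat u x t) *v column \<sigma> \<Phi>) $ j =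
      (\<Sum>k\<in>UNIV. if k = j + 1 then c * \<Phi> $ k $ \<sigma> else 0) + (\<Sum>k\<in>UNIV. if k = j then Pmat u x t $ j $ j * \<Phi> $ k $ \<sigma> else 0)"
    unfolding matrix_vector_mult_def vec_lambda_beta sum.distrib[symmetric]
    by (intro sum.cong refl) (auto simp: mscale_nth Kmat_def Pmat_def column_def algebra_simps)
  thus ?thesis by simp
qed

lemma lax_x_iff_ode_x:
  fixes \<Phi> :: "real \<Rightarrow> real \<Rightarrow> ('n::finite, 'r::finite) phase"
  assumes l: "\<And>\<sigma>. l \<sigma> \<noteq> 0" and D: "open D" and con: "constraint_on D l u \<Phi>"
  shows "lax_x_on D l u \<Phi> \<longleftrightarrow> ode_x_on D l \<Phi>"
proof -
  have pointwise: "(\<forall>\<sigma>. ((\<lambda>s. column \<sigma> (\<Phi> s t)) has_vector_derivative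
      (mscale (l \<sigma>) Kmat + Pmat u x t) *v column \<sigma> (\<Phi> x t)) (at x)) \<longleftrightarrow>
    ((\<lambda>s. \<Phi> s t) has_vector_derivative x_field l (\<Phi> x t)) (at x)" if xt: "(x, t) \<in> D" for x t
  proof -
    define q where "q j = Pmat u x t $ j $ (j :: 'n bit0)" for j
    define V where "V = (\<chi> j \<sigma>. l \<sigma> * \<Phi> x t $ (j + 1) $ \<sigma> + q j * \<Phi> x t $ j $ \<sigma>)"
    have region: "\<Phi> x t \<in> gam_region l" using con xt by (auto simp: constraint_on_def)
    have x_field_pcoef: "x_field l (\<Phi> x t) $ j $ \<sigma> = l \<sigma> * \<Phi> x t $ (j + 1) $ \<sigma> + pcoef l (\<Phi> x t) j * \<Phi> x t $ j $ \<sigma>" for j \<sigma>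
      by (simp add: x_field_def pcoef_def)
    \<comment> \<open>The open x-slice of D through the point: the constraint has to hold at all
      nearby x in order to be differentiated.\<close>
    define S where "S = {s. (s, t) \<in> D}"
    have "open ((\<lambda>s. (s, t)) -` D)" using D by (intro open_vimage continuous_intros)
    hence S: "open S" "x \<in> S" using xt by (simp_all add: S_def vimage_def)
    have u: "u i s t = toda (\<lambda>k. ln (gam l (\<Phi> s t) k)) i" if "s \<in> S" "1 \<le> i" "i \<le> CARD('n)" for s i
      using con that by (intro constraint_toda) (auto simp: constraint_on_def S_def)
    have q: "q j = (if idx j \<le> CARD('n) then deriv (\<lambda>s. u (idx j) s t) x
        else - deriv (\<lambda>s. u (2 * CARD('n) + 1 - idx j) s t) x)" for j
      by (simp add: q_def Pmat_def)
    \<comment> \<open>Either equation supplies the derivative of \<Phi> needed to identify q, and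
      then the two fields coincide; this yields both directions at once.\<close>
    have "q = pcoef l (\<Phi> x t)" if "((\<lambda>s. \<Phi> s t) has_vector_derivative V') (at x)"
      and "V' = V \<or> V' = x_field l (\<Phi> x t)" for V'
      using that(2)
    proof
      assume "V' = V"
      show ?thesis
        by (rule constraint_x_derivative[where \<Phi> = "\<lambda>s. \<Phi> s t" and p = q and u = "\<lambda>i s. u i s t",
            OF l region that(1) _ S u q]) (simp_all add: \<open>V' = V\<close> V_def)
    next
      assume "V' = x_field l (\<Phi> x t)"
      show ?thesis
        by (rule constraint_x_derivative[where \<Phi> = "\<lambda>s. \<Phi> s t" and p = "pcoef l (\<Phi> x t)" and u = "\<lambda>i s. u i s t",
            OF l region that(1) _ S u q]) (simp_all add: \<open>V' = x_field l (\<Phi> x t)\<close> x_field_pcoef)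
    qed
    moreover have "V = x_field l (\<Phi> x t)" if "q = pcoef l (\<Phi> x t)"
      using that by (simp add: vec_eq_iff V_def x_field_pcoef)
    moreover have "(mscale (l \<sigma>) Kmat + Pmat u x t) *v column \<sigma> (\<Phi> x t) = column \<sigma> V" for \<sigma>
      unfolding vec_eq_iff lax_x_matrix_nth by (simp add: V_def q_def column_def)
    hence "(\<forall>\<sigma>. ((\<lambda>s. column \<sigma> (\<Phi> s t)) has_vector_derivative
      (mscale (l \<sigma>) Kmat + Pmat u x t) *v column \<sigma> (\<Phi> x t)) (at x)) \<longleftrightarrow>
      ((\<lambda>s. \<Phi> s t) has_vector_derivative V) (at x)"
      by (simp only: has_vector_derivative_columns_iff[symmetric])
    ultimately show ?thesis by metis
  qed
  show ?thesis unfolding lax_x_on_def ode_x_on_def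
  proof (rule ball_cong[OF refl])
    fix p assume "p \<in> D"
    thus "(case p of (x, t) \<Rightarrow> \<forall>\<sigma>. ((\<lambda>s. column \<sigma> (\<Phi> s t)) has_vector_derivative
        (mscale (l \<sigma>) Kmat + Pmat u x t) *v column \<sigma> (\<Phi> x t)) (at x)) \<longleftrightarrow>
      (case p of (x, t) \<Rightarrow> ((\<lambda>s. \<Phi> s t) has_vector_derivative x_field l (\<Phi> x t)) (at x))"
      using pointwise[of "fst p" "snd p"] by (simp add: case_prod_beta)
  qed
qed

text \<open>The t-part is algebraic: at each point the constraint turns q_k into \<Gamma> /
  \<gamma>_k, so the two right-hand sides are equal.\<close>

lemma lax_t_iff_ode_t:
  fixes \<Phi> :: "real \<Rightarrow> real \<Rightarrow> ('n::finite, 'r::finite) phase"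
  assumes con: "constraint_on D l u \<Phi>"
  shows "lax_t_on D l u \<Phi> \<longleftrightarrow> ode_t_on D l \<Phi>"
proof -
  have rhs: "mscale (inverse (l \<sigma>)) (Qmat u x t) *v column \<sigma> (\<Phi> x t) = column \<sigma> (t_field l (\<Phi> x t))"
    if xt: "(x, t) \<in> D" for x t \<sigma>
  proof -
    have region: "\<Phi> x t \<in> gam_region l" using con xt by (auto simp: constraint_on_def)
    have pos: "gam l (\<Phi> x t) k > 0" for k using region by (simp add: gam_region_def)
    have nz: "gam l (\<Phi> x t) k \<noteq> 0" for k using pos[of k] by simp
    have u: "u i x t = toda (\<lambda>k. ln (gam l (\<Phi> x t) k)) i" if "1 \<le> i" "i \<le> CARD('n)" for i
      using con xt that by (intro constraint_toda) (auto simp: constraint_on_def)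
    have q: "qcoef CARD('n) (\<lambda>i. u i x t) (idx k) = Gam l (\<Phi> x t) / gam l (\<Phi> x t) k" for k :: "'n bit0"
    proof -
      have "qcoef CARD('n) (\<lambda>i. u i x t) (idx k) =
          exp ((\<Sum>k\<in>UNIV. ln (gam l (\<Phi> x t) k)) / (2 * real CARD('n)) - ln (gam l (\<Phi> x t) (of_nat (idx k))))"
        by (rule qcoef_toda[OF _ idx_bounds u]) (simp add: gam_minus)
      also have "\<dots> = exp ((\<Sum>k\<in>UNIV. ln (gam l (\<Phi> x t) k)) / (2 * real CARD('n))) / gam l (\<Phi> x t) k"
        using pos by (simp add: of_nat_idx exp_diff)
      also have "exp ((\<Sum>k\<in>UNIV. ln (gam l (\<Phi> x t) k)) / (2 * real CARD('n))) = Gam l (\<Phi> x t)"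
        unfolding Gam_def sum_divide_distrib exp_sum[OF finite] using pos
        by (intro prod.cong refl) (simp add: powr_def nz)
      finally show ?thesis .
    qed
    have "(mscale (inverse (l \<sigma>)) (Qmat u x t) *v column \<sigma> (\<Phi> x t)) $ j = t_field l (\<Phi> x t) $ j $ \<sigma>" for j
    proof -
      have "(mscale (inverse (l \<sigma>)) (Qmat u x t) *v column \<sigma> (\<Phi> x t)) $ j =
          (\<Sum>k\<in>UNIV. (if k = j - 1 then 1 else 0) * (inverse (l \<sigma>) * (Gam l (\<Phi> x t) / gam l (\<Phi> x t) k) * \<Phi> x t $ k $ \<sigma>))"
        unfolding matrix_vector_mult_def vec_lambda_beta
      proof (intro sum.cong refl)
        fix k :: "'n bit0"
        have "j = k + 1 \<longleftrightarrow> k = j - 1" by (auto simp: algebra_simps)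
        thus "mscale (inverse (l \<sigma>)) (Qmat u x t) $ j $ k * column \<sigma> (\<Phi> x t) $ k =
          (if k = j - 1 then 1 else 0) * (inverse (l \<sigma>) * (Gam l (\<Phi> x t) / gam l (\<Phi> x t) k) * \<Phi> x t $ k $ \<sigma>)"
          by (simp add: mscale_nth Qmat_def q column_def)
      qed
      thus ?thesis unfolding sum_UNIV_delta_mult by (simp add: t_field_nth field_simps)
    qed
    thus ?thesis by (simp add: vec_eq_iff column_def)
  qed
  have "(\<forall>\<sigma>. ((\<lambda>s. column \<sigma> (\<Phi> x s)) has_vector_derivative
      mscale (inverse (l \<sigma>)) (Qmat u x t) *v column \<sigma> (\<Phi> x t)) (at t)) \<longleftrightarrow>
    ((\<lambda>s. \<Phi> x s) has_vector_derivative t_field l (\<Phi> x t)) (at t)" if "(x, t) \<in> D" for x t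
    by (simp only: rhs[OF that] has_vector_derivative_columns_iff[symmetric])
  hence pointwise: "(\<forall>\<sigma>. ((\<lambda>s. column \<sigma> (\<Phi> (fst p) s)) has_vector_derivative
      mscale (inverse (l \<sigma>)) (Qmat u (fst p) (snd p)) *v column \<sigma> (\<Phi> (fst p) (snd p))) (at (snd p))) \<longleftrightarrow>
    ((\<lambda>s. \<Phi> (fst p) s) has_vector_derivative t_field l (\<Phi> (fst p) (snd p))) (at (snd p))" if "p \<in> D" for p
    using that by simp
  show ?thesis unfolding lax_t_on_def ode_t_on_def case_prod_beta
    by (rule ball_cong[OF refl pointwise])
qed

lemma ode_x_iff_lax_ode_x: "ode_x_on D l \<Phi> \<longleftrightarrow> lax_ode_x_on D l \<Phi>"
  for \<Phi> :: "real \<Rightarrow> real \<Rightarrow> ('n::finite, 'r::finite) phase"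
  unfolding ode_x_on_def lax_ode_x_on_def has_vector_derivative_cvec_columns_iff lax_form_x_eq ..

lemma ode_t_iff_lax_ode_t:
  fixes \<Phi> :: "real \<Rightarrow> real \<Rightarrow> ('n::finite, 'r::finite) phase"
  assumes l: "\<And>\<sigma>. l \<sigma> \<noteq> 0" and con: "constraint_on D l u \<Phi>"
  shows "ode_t_on D l \<Phi> \<longleftrightarrow> lax_ode_t_on D l \<Phi>"
proof -
  have "cvec (column \<sigma> (t_field l (\<Phi> x t))) = lax_form_t l (\<Phi> x t) \<sigma>" if "(x, t) \<in> D" for x t \<sigma>
    using con that by (intro lax_form_t_eq l) (auto simp: constraint_on_def)
  thus ?thesis
    unfolding ode_t_on_def lax_ode_t_on_def has_vector_derivative_cvec_columns_iff by auto
qed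

theorem theorem8:
  fixes l :: "'r::finite \<Rightarrow> real"
  assumes "\<And>\<sigma>. l \<sigma> \<noteq> 0" and "inj (\<lambda>\<sigma>. (l \<sigma>)\<^sup>2)"
  shows
    \<comment> \<open>under the constraint, the Lax pair becomes the system of ODEs\<close>
    "(\<forall>D u (\<Phi> :: real \<Rightarrow> real \<Rightarrow> ('n::finite, 'r) phase).
       open D \<and> constraint_on D l u \<Phi> \<longrightarrow>
         (lax_x_on D l u \<Phi> \<longleftrightarrow> ode_x_on D l \<Phi>) \<and> (ode_x_on D l \<Phi> \<longleftrightarrow> lax_ode_x_on D l \<Phi>) \<and>
         (lax_t_on D l u \<Phi> \<longleftrightarrow> ode_t_on D l \<Phi>) \<and> (ode_t_on D l \<Phi> \<longleftrightarrow> lax_ode_t_on D l \<Phi>)) \<and>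
     \<comment> \<open>the two forms of the ODEs have the same right-hand sides on the whole phase space\<close>
     (\<forall>\<Phi> :: ('n, 'r) phase. \<forall>\<sigma>. cvec (column \<sigma> (x_field l \<Phi>)) = lax_form_x l \<Phi> \<sigma>) \<and>
     (\<forall>\<Phi> \<in> (gam_region l :: ('n, 'r) phase set). \<forall>\<sigma>.
        cvec (column \<sigma> (t_field l \<Phi>)) = lax_form_t l \<Phi> \<sigma>) \<and>
     \<comment> \<open>the two expressions for each Hamiltonian function\<close>
     (\<forall>\<Phi> :: ('n, 'r) phase.
        1 / 2 * trace (Res_infinity (\<lambda>z. mscale z (mpow (Lax l \<Phi> z) 2))) =
          complex_of_real (Hx l \<Phi>)) \<and>
     (\<forall>\<Phi> \<in> (gam_region l :: ('n, 'r) phase set).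
        - of_nat CARD('n) *
          (1 / of_nat (2 * CARD('n)) * trace (mpow (Lax l \<Phi> 0) (2 * CARD('n))))
            powr (1 / of_nat (2 * CARD('n))) = complex_of_real (Ht l \<Phi>)) \<and>
     \<comment> \<open>for the bracket normalised by the inverse of W, the function generating the x-system is
        one half of \<open>Hx\<close>\<close>
     hamiltonian_system (UNIV :: ('n, 'r) phase set) (x_field l) (\<lambda>\<Phi>. Hx l \<Phi> / 2) \<and>
     liouville_integrable (UNIV :: ('n, 'r) phase set) (\<lambda>\<Phi>. Hx l \<Phi> / 2) \<and>
     liouville_integrable (UNIV :: ('n, 'r) phase set) (Hx l) \<and>
     hamiltonian_system (gam_region l :: ('n, 'r) phase set) (t_field l) (Ht l) \<and>
     liouville_integrable (gam_region l :: ('n, 'r) phase set) (Ht l)"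
proof -
  have x: "hamiltonian_system (UNIV :: ('n, 'r) phase set) (x_field l) (\<lambda>\<Phi>. Hx l \<Phi> / 2)"
    "smooth_on (UNIV :: ('n, 'r) phase set) (Hx l)" "smooth_on (UNIV :: ('n, 'r) phase set) (\<lambda>\<Phi>. Hx l \<Phi> / 2)"
    unfolding hamiltonian_system_def ham_field_half_Hx
    by (auto intro!: smooth_on_elementary elementary_polynomial real_polynomial_function_divide polynomial_Hx)
  have t: "hamiltonian_system (gam_region l :: ('n, 'r) phase set) (t_field l) (Ht l)"
    unfolding hamiltonian_system_def by (simp add: smooth_on_Ht ham_field_Ht)
  have Lx: "liouville_integrable (UNIV :: ('n, 'r) phase set) (\<lambda>\<Phi>. Hx l \<Phi> / 2)"
    "liouville_integrable (UNIV :: ('n, 'r) phase set) (Hx l)"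
    by (rule liouville_integrableI[OF assms x(3)] liouville_integrableI[OF assms x(2)];
        rule poisson_tr_lax_Hx; assumption)+
  have Lt: "liouville_integrable (gam_region l :: ('n, 'r) phase set) (Ht l)"
    by (rule liouville_integrableI[OF assms smooth_on_Ht], rule poisson_tr_lax_Ht[OF assms(1)]) simp_all
  show ?thesis
  proof (intro conjI allI impI ballI, goal_cases)
    case (1 D u \<Phi>)
    thus ?case by (intro lax_x_iff_ode_x[OF assms(1)]) simp_all
  next
    case (2 D u \<Phi>)
    show ?case by (rule ode_x_iff_lax_ode_x)
  next
    case (3 D u \<Phi>)
    thus ?case by (intro lax_t_iff_ode_t) simp
  next
    case (4 D u \<Phi>)
    hence "constraint_on D l u \<Phi>" by simp
    thus ?case by (rule ode_t_iff_lax_ode_t[OF assms(1)])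
  next
    case (5 \<Phi> \<sigma>)
    show ?case by (rule lax_form_x_eq)
  next
    case (6 \<Phi> \<sigma>)
    thus ?case by (rule lax_form_t_eq[OF assms(1)])
  next
    case (7 \<Phi>)
    show ?case by (rule trace_Res_Lax_square)
  next
    case (8 \<Phi>)
    thus ?case by (rule Lax_zero_Ht[OF assms(1)])
  qed (rule x t Lx Lt)+
qed

end
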